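(* For $d,n\in\mathbb{N}$, the functor $\mathbf{A}_d(n,-)_{\mathbf{0}}:\mathbf{gr}^{op}\to\mathbb{K}\text{-}\mathrm{Mod}$ is an outer functor if and only if $n=0$ or $d=0$.
   Context: $\mathbb{K}$ is a field of characteristic $0$, $\mathbb{K}\text{-}\mathrm{Mod}$ the category of $\mathbb{K}$-vector spaces, $\mathbb{N}=\{0,1,2,\dots\}$. $\mathbf{gr}$ is the category of finitely generated free groups with objects $n\in\mathbb{N}$ identified with the free group $F_n=\langle x_1,\dots,x_n\rangle$; $\mathbf{gr}(m,n)=\mathrm{Hom}(F_m,F_n)$. A functor $N:\mathbf{gr}^{op}\to\mathbb{K}\text{-}\mathrm{Mod}$ is an outer functor if for every $m\in\mathbb{N}$ the inner automorphisms of $F_m$ act trivially on $N(m)$. Beaded Jacobi diagrams. $X_m$ is the oriented $1$-manifold consisting of $m$ arcs (numbered $1,\dots,m$). A Jacobi diagram $D$ on $X_m$ is a finite uni-trivalent graph with a cyclic order of the half-edges at each trivalent vertex, whose univalent vertices are embedded in the interior of $X_m$, each connected component of $D$ having at least one univalent vertex. Its degree is half its number of vertices. An $F_n$-beaded Jacobi diagram on $X_m$ is a Jacobi diagram on $X_m$ with oriented edges, together with finitely many beads, i.e. points of the interior of $X_m$ or of edges of $D$ away from vertices, labelled by elements of $F_n$. Equivalence of beaded diagrams is generated by (up to isomorphism): two consecutive beads $w$ then $x$ (along the orientation of an arc of $X_m$ or an edge) may be replaced by one bead $wx$; a bead $1$ may be removed; reversing the orientation of an edge with one bead $w$ replaces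 $w$ by $w^{-1}$; a bead $w$ on an arc just before a univalent vertex $v$ may be replaced by a bead $w$ on the arc just after $v$ and a bead $w$ on the edge at $v$, oriented away from $v$ (next to $v$); a bead $w$ on an edge entering a trivalent vertex, the two other edges being oriented outwards, may be replaced by a bead $w$ on each of the two outgoing edges (next to the vertex). $\mathbf{A}(n,m)$ is the $\mathbb{K}$-vector space generated by equivalence classes of $F_n$-beaded Jacobi diagrams on $X_m$ modulo the STU relation: if an unbeaded edge joins a point of an arc to a trivalent vertex with cyclic order (edge to the arc, $b$, $a$), the diagram equals the one where $a,b$ are attached directly to the arc with $a$ just before $b$, minus the one with $b$ just before $a$. $\mathbf{A}_d(n,m)\subset\mathbf{A}(n,m)$ is the subspace generated by diagrams of degree $d$. Functoriality. These are the morphism spaces of the Habiro–Massuyeau linear category $\mathbf{A}$ of Jacobi diagrams in handlebodies, whose degree $0$ part $\mathbf{A}_0$ is isomorphic to the $\mathbb{K}$-linearization of $\mathbf{gr}^{op}$; composition with $\mathbf{A}_0$ makes $\mathbf{A}(n,-)$ a functor on $\mathbf{gr}^{op}$ with subfunctors $\mathbf{A}_d(n,-)$. Explicitly, let $g:F_{m'}\to F_m$ with $g(x_j)=x_{p_{j,1}}^{e_{j,1}}\cdots x_{p_{j,r_j}}^{e_{j,r_j}}$, $e_{j,s}=\pm1$. Then $g$ induces $\mathbf{A}(n,m)\to\mathbf{A}(n,m')$ as follows: arc $j$ of $X_{m'}$ is the concatenation, in the order $s=1,\dots,r_j$, of copies of the arcs $p_{j,s}$ of $X_m$ with their beads, the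 copy being reversed and its beads inverted when $e_{j,s}=-1$; $D$ is sent to the sum, over all ways of attaching each univalent vertex of $D$ lying on an arc $p$ to the corresponding point on one of the copies of the arc $p$, of the resulting diagrams, with sign $(-1)^{r}$, $r$ the number of univalent vertices attached to reversed copies (the sum is $0$ if some arc carrying univalent vertices has no copy). The homotopy class $\mathbf{0}$ part. $\mathbf{A}(n,m)_{\mathbf{0}}\subset\mathbf{A}(n,m)$ is the subspace generated by the beaded diagrams such that, for each arc of $X_m$, the product of the beads along it is $1\in F_n$ (equivalently, diagrams that can be represented without beads on $X_m$, beads on the edges of the Jacobi diagram being allowed). $\mathbf{A}_d(n,m)_{\mathbf{0}}$ is its degree $d$ part. These define subfunctors of $\mathbf{A}(n,-)$ on $\mathbf{gr}^{op}$. *)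

theory Defs
  imports
    Complex_Main
    "HOL-Library.FuncSet"
    "HOL-Library.Multiset"
    "HOL-Library.Poly_Mapping"
    "HOL-Algebra.Module"
begin

section \<open>Free groups and functors on the opposite of their category\<close>

text \<open>
  Generators are numbered from \<open>0\<close>; the letter \<open>(p, True)\<close> is the generator number \<open>p\<close> and
  \<open>(p, False)\<close> is its inverse.  Elements of free groups are reduced words.
\<close>

type_synonym letter = "nat \<times> bool"
type_synonym word = "letter list"

definition inv_letter :: "letter \<Rightarrow> letter" where
  "inv_letter a = (fst a, \<not> snd a)"

definition reduced :: "word \<Rightarrow> bool" where
  "reduced w \<longleftrightarrow> successively (\<lambda>a b. b \<noteq> inv_letter a) w"

fun push :: "letter \<Rightarrow> word \<Rightarrow> word" where
  "push a [] = [a]"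
| "push a (b # w) = (if b = inv_letter a then w else a # b # w)"

definition reduce :: "word \<Rightarrow> word" where
  "reduce w = foldr push w []"

definition free_group :: "nat \<Rightarrow> word monoid" where
  "free_group n =
    \<lparr>carrier = {w. reduced w \<and> (\<forall>a \<in> set w. fst a < n)},
     monoid.mult = (\<lambda>u v. reduce (u @ v)),
     one = []\<rparr>"

abbreviation gen :: "nat \<Rightarrow> word" where
  "gen j \<equiv> [(j, True)]"

definition coeff_ring :: "'k::field ring" where
  "coeff_ring = \<lparr>carrier = UNIV, monoid.mult = (*), one = 1, zero = 0, add = (+)\<rparr>"

text \<open>
  A morphism \<open>g\<close> from \<open>m'\<close> to \<open>m\<close> in the category of finitely generated free groups is an element
  of \<open>hom (free_group m') (free_group m)\<close>, and it is sent to a map \<open>Mor m' m g\<close> from \<open>Obj m\<close> to \<open>Obj m'\<close>.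
  Members of \<^const>\<open>hom\<close> are unconstrained outside the carrier, whence the axiom \<open>Mor_cong\<close>.
\<close>

locale gr_op_functor =
  fixes Obj :: "nat \<Rightarrow> ('k::field, 'v) module"
    and Mor :: "nat \<Rightarrow> nat \<Rightarrow> (word \<Rightarrow> word) \<Rightarrow> 'v \<Rightarrow> 'v"
  assumes Obj_module: "module coeff_ring (Obj m)"
    and Mor_add: "g \<in> hom (free_group m') (free_group m) \<Longrightarrow>
      Mor m' m g \<in> hom (add_monoid (Obj m)) (add_monoid (Obj m'))"
    and Mor_smult: "\<lbrakk>g \<in> hom (free_group m') (free_group m); x \<in> carrier (Obj m)\<rbrakk> \<Longrightarrow>
      Mor m' m g (c \<odot>\<^bsub>Obj m\<^esub> x) = c \<odot>\<^bsub>Obj m'\<^esub> Mor m' m g x"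
    and Mor_cong: "\<lbrakk>g \<in> hom (free_group m') (free_group m); g' \<in> hom (free_group m') (free_group m);
      \<forall>w \<in> carrier (free_group m'). g w = g' w; x \<in> carrier (Obj m)\<rbrakk> \<Longrightarrow>
      Mor m' m g x = Mor m' m g' x"
    and Mor_id: "x \<in> carrier (Obj m) \<Longrightarrow> Mor m m (\<lambda>w. w) x = x"
    and Mor_comp: "\<lbrakk>g \<in> hom (free_group m') (free_group m); h \<in> hom (free_group m'') (free_group m');
      x \<in> carrier (Obj m)\<rbrakk> \<Longrightarrow>
      Mor m'' m (g \<circ> h) x = Mor m'' m' h (Mor m' m g x)"

locale outer_functor = gr_op_functor +
  assumes inner_trivial: "\<lbrakk>a \<in> carrier (free_group m); x \<in> carrier (Obj m)\<rbrakk> \<Longrightarrow>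
    Mor m m (\<lambda>w. a \<otimes>\<^bsub>free_group m\<^esub> w \<otimes>\<^bsub>free_group m\<^esub> inv\<^bsub>free_group m\<^esub> a) x = x"


section \<open>Beaded Jacobi diagrams\<close>

text \<open>
  Half-edges of the uni-trivalent graph are natural numbers, and a univalent vertex is identified
  with its unique half-edge.
  \<^item> \<open>arcs\<close>: for each arc, the beads and univalent vertices lying on it, in the order of its
    orientation.
  \<^item> \<open>tris\<close>: the trivalent vertices; \<open>(a, b, c)\<close> lists the three half-edges in their cyclic
    order, starting anywhere.
  \<^item> \<open>edges\<close>: \<open>(s, ws, t)\<close> is an edge oriented from its half-edge \<open>s\<close> to its half-edge \<open>t\<close>, with
    the beads \<open>ws\<close> in the order of that orientation.
\<close>

datatype point = Bead word | Leg nat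

datatype bdiag = BDiag
  (arcs: "point list list")
  (tris: "(nat \<times> nat \<times> nat) multiset")
  (edges: "(nat \<times> word list \<times> nat) multiset")

definition legs_mset :: "bdiag \<Rightarrow> nat multiset" where
  "legs_mset D = mset [h. Leg h \<leftarrow> concat (arcs D)]"

definition vertex_halves :: "bdiag \<Rightarrow> nat multiset" where
  "vertex_halves D = legs_mset D + (\<Sum>(a, b, c) \<in># tris D. {#a, b, c#})"

definition edge_halves :: "bdiag \<Rightarrow> nat multiset" where
  "edge_halves D = (\<Sum>(s, ws, t) \<in># edges D. {#s, t#})"

abbreviation legs :: "bdiag \<Rightarrow> nat set" where
  "legs D \<equiv> set_mset (legs_mset D)"

abbreviation halves :: "bdiag \<Rightarrow> nat set" where
  "halves D \<equiv> set_mset (vertex_halves D)"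

definition joined :: "bdiag \<Rightarrow> (nat \<times> nat) set" where
  "joined D = {(s, t). \<exists>ws. (s, ws, t) \<in># edges D} \<union>
     {(h, h'). \<exists>a b c. (a, b, c) \<in># tris D \<and> h \<in> {a, b, c} \<and> h' \<in> {a, b, c}}"

definition beaded_diagram :: "nat \<Rightarrow> nat \<Rightarrow> bdiag \<Rightarrow> bool" where
  "beaded_diagram n m D \<longleftrightarrow>
    length (arcs D) = m \<and>
    (\<forall>arc \<in> set (arcs D). \<forall>w. Bead w \<in> set arc \<longrightarrow> w \<in> carrier (free_group n)) \<and>
    (\<forall>(s, ws, t) \<in># edges D. set ws \<subseteq> carrier (free_group n)) \<and>
    vertex_halves D = edge_halves D \<and>
    (\<forall>h. count (vertex_halves D) h \<le> 1) \<and>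
    (\<forall>h \<in> halves D. \<exists>l \<in> legs D. (h, l) \<in> (joined D \<union> (joined D)\<inverse>)\<^sup>*)"

text \<open>
  The number of vertices of a Jacobi diagram is even, having the parity of the number of
  half-edges.
\<close>

definition degree :: "bdiag \<Rightarrow> nat" where
  "degree D = (size (legs_mset D) + size (tris D)) div 2"

definition homotopically_trivial :: "nat \<Rightarrow> bdiag \<Rightarrow> bool" where
  "homotopically_trivial n D \<longleftrightarrow>
    (\<forall>arc \<in> set (arcs D). foldr (\<lambda>u v. u \<otimes>\<^bsub>free_group n\<^esub> v) [w. Bead w \<leftarrow> arc] \<one>\<^bsub>free_group n\<^esub> = \<one>\<^bsub>free_group n\<^esub>)"


section \<open>Equivalence of beaded diagrams\<close>

definition rename :: "(nat \<Rightarrow> nat) \<Rightarrow> bdiag \<Rightarrow> bdiag" where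
  "rename f D = BDiag
    (map (map (\<lambda>x. case x of Bead w \<Rightarrow> Bead w | Leg h \<Rightarrow> Leg (f h))) (arcs D))
    (image_mset (\<lambda>(a, b, c). (f a, f b, f c)) (tris D))
    (image_mset (\<lambda>(s, ws, t). (f s, ws, f t)) (edges D))"

text \<open>
  \<open>emit n H w\<close> puts, on an edge, one new bead next to each of its half-edges in \<open>H\<close>: the bead \<open>w\<close>
  with respect to the outward orientation, hence \<open>w\<close> at the source and the inverse of \<open>w\<close> at the
  target.  Acting on all edges at once, it also covers an edge with both ends at one vertex.
\<close>

definition emit :: "nat \<Rightarrow> nat set \<Rightarrow> word \<Rightarrow> nat \<times> word list \<times> nat \<Rightarrow> nat \<times> word list \<times> nat" where
  "emit n H w = (\<lambda>(s, ws, t).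
    (s, (if s \<in> H then [w] else []) @ ws @ (if t \<in> H then [inv\<^bsub>free_group n\<^esub> w] else []), t))"

inductive bead_move :: "nat \<Rightarrow> bdiag \<Rightarrow> bdiag \<Rightarrow> bool" for n :: nat where
  isomorphism: "inj_on f (halves D) \<Longrightarrow> bead_move n D (rename f D)"
| cyclic: "bead_move n (BDiag A (add_mset (a, b, c) V) E) (BDiag A (add_mset (b, c, a) V) E)"
| merge_arc: "bead_move n
    (BDiag (A @ (p @ Bead w # Bead x # q) # B) V E)
    (BDiag (A @ (p @ Bead (w \<otimes>\<^bsub>free_group n\<^esub> x) # q) # B) V E)"
| merge_edge: "bead_move n
    (BDiag A V (add_mset (s, us @ w # x # vs, t) E))
    (BDiag A V (add_mset (s, us @ (w \<otimes>\<^bsub>free_group n\<^esub> x) # vs, t) E))"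
| unit_arc: "bead_move n
    (BDiag (A @ (p @ Bead \<one>\<^bsub>free_group n\<^esub> # q) # B) V E)
    (BDiag (A @ (p @ q) # B) V E)"
| unit_edge: "bead_move n
    (BDiag A V (add_mset (s, us @ \<one>\<^bsub>free_group n\<^esub> # vs, t) E))
    (BDiag A V (add_mset (s, us @ vs, t) E))"
| reverse: "bead_move n
    (BDiag A V (add_mset (s, [w], t) E))
    (BDiag A V (add_mset (t, [inv\<^bsub>free_group n\<^esub> w], s) E))"
| slide_univalent: "bead_move n
    (BDiag (A @ (p @ Bead w # Leg v # q) # B) V E)
    (BDiag (A @ (p @ Leg v # Bead w # q) # B) V (image_mset (emit n {v} w) E))"
| slide_trivalent: "bead_move n
    (BDiag A (add_mset (a, b, c) V) (add_mset (s, us @ [w], a) E))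
    (BDiag A (add_mset (a, b, c) V) (image_mset (emit n {b, c} w) (add_mset (s, us, a) E)))"

definition bead_equiv :: "nat \<Rightarrow> nat \<Rightarrow> bdiag rel" where
  "bead_equiv n m =
    (let M = {(D, D'). beaded_diagram n m D \<and> beaded_diagram n m D' \<and> bead_move n D D'}
     in (M \<union> M\<inverse>)\<^sup>*)"


section \<open>The vector spaces\<close>

definition scale :: "'k::field \<Rightarrow> (bdiag \<Rightarrow>\<^sub>0 'k) \<Rightarrow> (bdiag \<Rightarrow>\<^sub>0 'k)" where
  "scale c v = Poly_Mapping.map ((*) c) v"

lemma lookup_scale: "Poly_Mapping.lookup (scale c v) D = c * Poly_Mapping.lookup v D"
  by (simp add: scale_def Poly_Mapping.map.rep_eq when_def)

interpretation diagrams: vector_space "scale :: 'k::field \<Rightarrow> (bdiag \<Rightarrow>\<^sub>0 'k) \<Rightarrow> _"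
  by unfold_locales
    (auto intro!: poly_mapping_eqI simp: lookup_scale lookup_add algebra_simps)

definition dgm :: "bdiag \<Rightarrow> bdiag \<Rightarrow>\<^sub>0 'k::field" where
  "dgm D = Poly_Mapping.single D 1"

definition stu :: "bdiag \<Rightarrow> bdiag \<Rightarrow> bdiag \<Rightarrow> bool" where
  "stu D D1 D2 \<longleftrightarrow> (\<exists>A B p q V E h x a b.
    D = BDiag (A @ (p @ Leg h # q) # B) (add_mset (x, b, a) V) (add_mset (h, [], x) E) \<and>
    D1 = BDiag (A @ (p @ Leg a # Leg b # q) # B) V E \<and>
    D2 = BDiag (A @ (p @ Leg b # Leg a # q) # B) V E)"

definition relations :: "nat \<Rightarrow> nat \<Rightarrow> (bdiag \<Rightarrow>\<^sub>0 'k::field) set" where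
  "relations n m = diagrams.span
    ({dgm D - dgm D' | D D'. beaded_diagram n m D \<and> (D, D') \<in> bead_equiv n m} \<union>
     {dgm D - (dgm D1 - dgm D2) | D D1 D2. beaded_diagram n m D \<and> stu D D1 D2})"

text \<open>
  Elements of the quotient by \<^const>\<open>relations\<close> are cosets.  Operations on cosets are written as the
  union of the cosets of all results on representatives; this is a single coset exactly when the
  operation is well defined.
\<close>

definition rel_coset :: "nat \<Rightarrow> nat \<Rightarrow> (bdiag \<Rightarrow>\<^sub>0 'k::field) \<Rightarrow> (bdiag \<Rightarrow>\<^sub>0 'k) set" where
  "rel_coset n m v = (\<lambda>r. v + r) ` relations n m"

text \<open>
  The subspace, spanned by the classes of the diagrams in \<open>S\<close>, of the quotient of the space of
  \<open>F\<^sub>n\<close>-beaded diagrams on \<open>m\<close> arcs.  The fields \<open>mult\<close> and \<open>one\<close> play no role in a module.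
\<close>

definition A_span :: "nat \<Rightarrow> nat \<Rightarrow> bdiag set \<Rightarrow> ('k::field, (bdiag \<Rightarrow>\<^sub>0 'k) set) module" where
  "A_span n m S =
    \<lparr>carrier = rel_coset n m ` diagrams.span (dgm ` S),
     monoid.mult = undefined,
     one = undefined,
     zero = rel_coset n m 0,
     add = (\<lambda>X Y. \<Union>x \<in> X. \<Union>y \<in> Y. rel_coset n m (x + y)),
     smult = (\<lambda>c X. \<Union>x \<in> X. rel_coset n m (scale c x))\<rparr>"

definition A_deg_trivial :: "nat \<Rightarrow> nat \<Rightarrow> nat \<Rightarrow> ('k::field, (bdiag \<Rightarrow>\<^sub>0 'k) set) module" where
  "A_deg_trivial d n m =
    A_span n m {D. beaded_diagram n m D \<and> degree D = d \<and> homotopically_trivial n D}"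


section \<open>The action of homomorphisms of free groups\<close>

text \<open>
  Let \<open>g\<close> be a homomorphism from \<open>F\<^bsub>m'\<^esub>\<close> to \<open>F\<^sub>m\<close>.  The copy \<open>(j, s)\<close> is the one given by the letter
  number \<open>s\<close> of the reduced word \<open>g (gen j)\<close>: it is a copy of the arc \<open>p\<close> if this letter is
  \<open>(p, e)\<close>, and it is reversed if \<open>e\<close> is false.
\<close>

definition copies :: "(word \<Rightarrow> word) \<Rightarrow> nat \<Rightarrow> nat \<Rightarrow> (nat \<times> nat) set" where
  "copies g m' p = {(j, s). j < m' \<and> s < length (g (gen j)) \<and> fst (g (gen j) ! s) = p}"

definition attachments :: "(word \<Rightarrow> word) \<Rightarrow> nat \<Rightarrow> bdiag \<Rightarrow> (nat \<Rightarrow> nat \<times> nat) set" where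
  "attachments g m' D =
    (\<Pi>\<^sub>E h \<in> legs D. \<Union>p \<in> {p. p < length (arcs D) \<and> Leg h \<in> set (arcs D ! p)}. copies g m' p)"

definition copy_of_arc :: "nat \<Rightarrow> (word \<Rightarrow> word) \<Rightarrow> bdiag \<Rightarrow> (nat \<Rightarrow> nat \<times> nat) \<Rightarrow> nat \<Rightarrow> nat \<Rightarrow> point list" where
  "copy_of_arc n g D \<chi> j s =
    (let (p, e) = g (gen j) ! s;
         pts = filter (\<lambda>x. case x of Bead w \<Rightarrow> True | Leg h \<Rightarrow> \<chi> h = (j, s)) (arcs D ! p)
     in if e then pts
        else rev (map (\<lambda>x. case x of Bead w \<Rightarrow> Bead (inv\<^bsub>free_group n\<^esub> w) | Leg h \<Rightarrow> Leg h) pts))"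

definition attach :: "nat \<Rightarrow> (word \<Rightarrow> word) \<Rightarrow> nat \<Rightarrow> bdiag \<Rightarrow> (nat \<Rightarrow> nat \<times> nat) \<Rightarrow> bdiag" where
  "attach n g m' D \<chi> = BDiag
    (map (\<lambda>j. concat (map (copy_of_arc n g D \<chi> j) [0..<length (g (gen j))])) [0..<m'])
    (tris D) (edges D)"

definition n_reversed :: "(word \<Rightarrow> word) \<Rightarrow> bdiag \<Rightarrow> (nat \<Rightarrow> nat \<times> nat) \<Rightarrow> nat" where
  "n_reversed g D \<chi> = card {h \<in> legs D. \<not> snd (g (gen (fst (\<chi> h))) ! snd (\<chi> h))}"

definition act_diagram :: "nat \<Rightarrow> (word \<Rightarrow> word) \<Rightarrow> nat \<Rightarrow> bdiag \<Rightarrow> bdiag \<Rightarrow>\<^sub>0 'k::field" where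
  "act_diagram n g m' D =
    (\<Sum>\<chi> \<in> attachments g m' D. scale ((- 1) ^ n_reversed g D \<chi>) (dgm (attach n g m' D \<chi>)))"

definition act :: "nat \<Rightarrow> (word \<Rightarrow> word) \<Rightarrow> nat \<Rightarrow> (bdiag \<Rightarrow>\<^sub>0 'k::field) \<Rightarrow> (bdiag \<Rightarrow>\<^sub>0 'k)" where
  "act n g m' v =
    (\<Sum>D \<in> Poly_Mapping.keys v. scale (Poly_Mapping.lookup v D) (act_diagram n g m' D))"

definition A_mor :: "nat \<Rightarrow> nat \<Rightarrow> nat \<Rightarrow> (word \<Rightarrow> word) \<Rightarrow> (bdiag \<Rightarrow>\<^sub>0 'k::field) set \<Rightarrow> (bdiag \<Rightarrow>\<^sub>0 'k) set" where
  "A_mor n m' m g X = (\<Union>v \<in> X. rel_coset n m' (act n g m' v))"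

end

theory Submission
  imports Defs
begin

text \<open>
  A homomorphism acts on a diagram by a sum over the ways of attaching the legs to copies of
  arcs.  Here copies carry labels, so that the sums can be manipulated by bijections of
  attachments.  The action maps relations to relations because each move at a leg or along an arc can be
  carried out in every copy (\<open>lact_bead_move\<close>, \<open>lact_stu\<close>).  Two actions in a row are indexed by
  pairs of labels and give the action of the composed words before free reduction (\<open>lact_lact\<close>).
  Cancelling a letter with its inverse does not change the action: among the legs on the two copies, the one
  nearest to their junction can be moved to the other copy at the cost of a sign, so
  that the attachments using these copies cancel in pairs (\<open>lact_cancel\<close>).

  In degree \<open>0\<close> there are no legs, and the arcs can be cleared of beads.  If \<open>n = 0\<close>, all
  beads are trivial.  Conjugation by \<open>a\<close> is then factored through one more generator \<open>x\<^sub>m\<close>: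
  substitute \<open>a\<close> for \<open>x\<^sub>m\<close>, then conjugate by \<open>x\<^sub>m\<close>.  The first step sends a diagram to itself plus diagrams with legs
  on the additional arc, and the second step kills the latter.  To see this, resolve the
  trivalent vertices by STU, which leaves chord diagrams.  The first leg \<open>l\<close> on
  the additional arc is then attached at the beginning of every other arc, and with the opposite sign at the end.  The
  difference telescopes into a sum over all legs \<open>k\<close> of the difference of the diagrams with \<open>l\<close> just before and just after \<open>k\<close>,
  in which the two ends of each chord cancel.  This is the four-term relation (\<open>four_term\<close>), and it follows from STU
  because the tripods obtained at the two ends of a chord differ by their cyclic orders.

  If \<open>n > 0\<close> and \<open>d > 0\<close>, one part of this argument fails: a chord with adjacent ends cannot be turned around if
  it carries a bead, and the difference is a tadpole whose loop carries this bead.  An integer \<open>weight\<close> detects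
  it: it adds up the exponents of the loops formed by chords with both ends on one arc, signed by the order of the ends.  It
  respects the bead moves, and it extends to STU by counting tadpoles.  If a chord with bead \<open>x\<close>
  joins two arcs, conjugation by the generator of the first arc adds the two chords on the second
  arc with weights \<open>1\<close> and \<open>- 1\<close>, with opposite signs, and the total weight changes by \<open>2\<close> (\<open>conj_witness\<close>), which
  is not \<open>0\<close> in characteristic \<open>0\<close>.
\<close>


section \<open>Free groups\<close>

definition inv_word :: "word \<Rightarrow> word" where
  "inv_word w = map inv_letter (rev w)"

lemma inv_letter_inv_letter [simp]: "inv_letter (inv_letter a) = a"
  by (simp add: inv_letter_def)

lemma inv_letter_neq [simp]: "a \<noteq> inv_letter a"
  by (simp add: inv_letter_def prod_eq_iff)

lemma fst_inv_letter [simp]: "fst (inv_letter a) = fst a"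
  by (simp add: inv_letter_def)

lemma inv_word_simps [simp]:
  "inv_word [] = []" "inv_word (u @ v) = inv_word v @ inv_word u" "inv_word (a # u) = inv_word u @ [inv_letter a]"
  by (simp_all add: inv_word_def)

lemma reduced_Nil [simp]: "reduced []" and reduced_single [simp]: "reduced [a]"
  by (simp_all add: reduced_def)

lemma reduced_Cons: "reduced (a # b # w) \<longleftrightarrow> b \<noteq> inv_letter a \<and> reduced (b # w)"
  by (simp add: reduced_def)

lemma reduced_ConsD: "reduced (a # w) \<Longrightarrow> reduced w"
  by (cases w) (auto simp: reduced_Cons)

lemma reduced_push: "reduced w \<Longrightarrow> reduced (push a w)"
  by (cases w) (auto simp: reduced_Cons dest: reduced_ConsD)

lemma push_reduced: "reduced (a # w) \<Longrightarrow> push a w = a # w"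
  by (cases w) (auto simp: reduced_Cons)

lemma push_push_inv: "reduced w \<Longrightarrow> push a (push (inv_letter a) w) = w"
  by (cases w; cases "tl w") (auto simp: reduced_Cons)

lemma reduced_foldr_push: "reduced w \<Longrightarrow> reduced (foldr push u w)"
  by (induction u) (auto simp: reduced_push)

lemma reduced_reduce: "reduced (reduce w)"
  by (simp add: reduce_def reduced_foldr_push)

lemma reduce_reduced: "reduced w \<Longrightarrow> reduce w = w"
proof (induction w)
  case (Cons a w)
  then show ?case
    using push_reduced[of a w] reduced_ConsD[of a w] by (simp add: reduce_def)
qed (simp add: reduce_def)

lemma reduce_Cons: "reduce (a # w) = push a (reduce w)"
  by (simp add: reduce_def)

lemma reduce_append: "reduce (u @ v) = foldr push u (reduce v)"
  by (simp add: reduce_def)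

text \<open>
  Letters act on reduced words by \<open>push\<close>, and \<open>push_push_inv\<close> makes this an action of the free
  group; hence a word and its reduction act in the same way.  Associativity of the product follows.
\<close>

lemma foldr_push_reduce:
  assumes "reduced w"
  shows "foldr push (reduce u) w = foldr push u w"
proof (induction u)
  case (Cons a u)
  show ?case
  proof (cases "reduce u")
    case (Cons b r)
    show ?thesis
    proof (cases "b = inv_letter a")
      case True
      have "foldr push u w = push b (foldr push r w)"
        using Cons.IH Cons by simp
      then show ?thesis
        using True Cons push_push_inv[OF reduced_foldr_push[OF assms]] by (simp add: reduce_Cons)
    next
      case False
      then show ?thesis
        using Cons.IH Cons by (simp add: reduce_Cons)
    qed
  qed (use Cons.IH in \<open>simp add: reduce_Cons\<close>)
qed (simp add: reduce_def)

lemma reduce_append_left [simp]: "reduce (reduce u @ v) = reduce (u @ v)"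
  by (simp add: reduce_append foldr_push_reduce reduced_reduce)

lemma reduce_append_right [simp]: "reduce (u @ reduce v) = reduce (u @ v)"
  by (simp add: reduce_append reduce_reduced reduced_reduce)

lemma reduce_inv_word_append: "reduce (inv_word w @ w) = []"
proof (induction w)
  case (Cons a w)
  have "reduce (inv_word (a # w) @ a # w) = foldr push (inv_word w) (push (inv_letter a) (push a (reduce w)))"
    by (simp add: reduce_append reduce_Cons)
  also have "\<dots> = reduce (inv_word w @ w)"
    using push_push_inv[OF reduced_reduce, of "inv_letter a" w] by (simp add: reduce_append)
  finally show ?case
    using Cons.IH by simp
qed (simp add: reduce_def)

lemma reduced_inv_word: "reduced w \<Longrightarrow> reduced (inv_word w)"
  unfolding reduced_def inv_word_def successively_map successively_rev
  by (auto elim!: successively_mono)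

lemma set_push: "set (push a w) \<subseteq> insert a (set w)"
  by (cases w) auto

lemma set_reduce: "set (reduce w) \<subseteq> set w"
proof (induction w)
  case (Cons a w)
  then show ?case
    using set_push[of a "reduce w"] by (auto simp: reduce_Cons)
qed (simp add: reduce_def)

lemma set_inv_word: "set (inv_word w) = inv_letter ` set w"
  by (simp add: inv_word_def)

lemma free_group_simps:
  "carrier (free_group n) = {w. reduced w \<and> (\<forall>a \<in> set w. fst a < n)}"
  "u \<otimes>\<^bsub>free_group n\<^esub> v = reduce (u @ v)"
  "\<one>\<^bsub>free_group n\<^esub> = []"
  by (simp_all add: free_group_def)

lemma reduce_in_carrier: "\<forall>a \<in> set w. fst a < n \<Longrightarrow> reduce w \<in> carrier (free_group n)"
  using set_reduce[of w] by (auto simp: free_group_simps reduced_reduce)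

lemma inv_word_in_carrier: "w \<in> carrier (free_group n) \<Longrightarrow> inv_word w \<in> carrier (free_group n)"
  by (auto simp: free_group_simps reduced_inv_word set_inv_word)

lemma gen_in_carrier: "j < n \<Longrightarrow> gen j \<in> carrier (free_group n)"
  by (simp add: free_group_simps)

lemma group_free_group: "group (free_group n)"
proof (rule groupI)
  fix u v assume "u \<in> carrier (free_group n)" "v \<in> carrier (free_group n)"
  then show "u \<otimes>\<^bsub>free_group n\<^esub> v \<in> carrier (free_group n)"
    using reduce_in_carrier[of "u @ v" n] by (auto simp: free_group_simps)
next
  fix u assume "u \<in> carrier (free_group n)"
  then show "\<exists>v\<in>carrier (free_group n). v \<otimes>\<^bsub>free_group n\<^esub> u = \<one>\<^bsub>free_group n\<^esub>"
    using inv_word_in_carrier[of u n] reduce_inv_word_append[of u]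
    by (intro bexI[of _ "inv_word u"]) (auto simp: free_group_simps)
qed (auto simp: free_group_simps reduce_reduced)

interpretation F: group "free_group n" for n
  by (rule group_free_group)

lemma inv_free_group: "w \<in> carrier (free_group n) \<Longrightarrow> inv\<^bsub>free_group n\<^esub> w = inv_word w"
  by (rule F.inv_equality) (auto simp: free_group_simps reduce_inv_word_append reduced_inv_word set_inv_word)

definition subst_letter :: "word list \<Rightarrow> letter \<Rightarrow> word" where
  "subst_letter W a = (if snd a then W ! fst a else inv_word (W ! fst a))"

text \<open>
  A homomorphism is determined by the images of the generators.  The formula before reduction is what
  the composition of two actions produces.
\<close>

lemma hom_eq_reduce_subst:
  assumes g: "g \<in> hom (free_group m') (free_group m)" and w: "w \<in> carrier (free_group m')"
  shows "g w = reduce (concat (map (subst_letter (map (\<lambda>j. g (gen j)) [0..<m'])) w))"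
  using w
proof (induction w)
  case Nil
  have "g \<one>\<^bsub>free_group m'\<^esub> = \<one>\<^bsub>free_group m\<^esub>"
    using g by (rule hom_one) (rule group_free_group)+
  then show ?case by (simp add: free_group_simps reduce_def)
next
  case (Cons a w)
  let ?s = "subst_letter (map (\<lambda>j. g (gen j)) [0..<m'])"
  have w: "w \<in> carrier (free_group m')" and a: "fst a < m'" and red: "reduced (a # w)"
    using Cons.prems reduced_ConsD[of a w] by (auto simp: free_group_simps)
  have gc: "gen (fst a) \<in> carrier (free_group m')"
    using a by (rule gen_in_carrier)
  have ga: "g [a] = ?s a"
  proof (cases "snd a")
    case True
    then have "[a] = gen (fst a)" by (simp add: prod_eq_iff)
    then show ?thesis
      using True a by (simp add: subst_letter_def)
  next
    case False
    then have "[a] = inv\<^bsub>free_group m'\<^esub> (gen (fst a))"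
      using inv_free_group[OF gc] by (simp add: inv_letter_def prod_eq_iff)
    moreover have "g (inv\<^bsub>free_group m'\<^esub> (gen (fst a))) = inv\<^bsub>free_group m\<^esub> (g (gen (fst a)))"
      using group_hom.hom_inv[OF group_hom.intro[OF group_free_group group_free_group
          group_hom_axioms.intro[OF g]] gc] .
    moreover have "\<dots> = inv_word (g (gen (fst a)))"
      using g gc by (intro inv_free_group) (auto simp: hom_def)
    ultimately show ?thesis
      using False a by (simp add: subst_letter_def)
  qed
  have "a # w = [a] \<otimes>\<^bsub>free_group m'\<^esub> w"
    using reduce_reduced[OF red] by (simp add: free_group_simps)
  moreover have "[a] \<in> carrier (free_group m')"
    using a by (simp add: free_group_simps)
  ultimately have "g (a # w) = g [a] \<otimes>\<^bsub>free_group m\<^esub> g w"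
    using g w by (metis hom_mult)
  then show ?case
    using Cons.IH[OF w] ga by (simp add: free_group_simps)
qed


section \<open>Bead equivalence along arcs\<close>

definition leg_seq :: "point list \<Rightarrow> nat list" where
  "leg_seq pts = [h. Leg h \<leftarrow> pts]"

definition bead_seq :: "point list \<Rightarrow> word list" where
  "bead_seq pts = [w. Bead w \<leftarrow> pts]"

definition beads_in :: "nat \<Rightarrow> point list \<Rightarrow> bool" where
  "beads_in n pts \<longleftrightarrow> (\<forall>w. Bead w \<in> set pts \<longrightarrow> w \<in> carrier (free_group n))"

lemma leg_seq_simps [simp]:
  "leg_seq [] = []" "leg_seq (p @ q) = leg_seq p @ leg_seq q"
  "leg_seq (Bead w # p) = leg_seq p" "leg_seq (Leg h # p) = h # leg_seq p"
  by (simp_all add: leg_seq_def)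

lemma bead_seq_simps [simp]:
  "bead_seq [] = []" "bead_seq (p @ q) = bead_seq p @ bead_seq q"
  "bead_seq (Bead w # p) = w # bead_seq p" "bead_seq (Leg h # p) = bead_seq p"
  by (simp_all add: bead_seq_def)

lemma beads_in_simps [simp]:
  "beads_in n []" "beads_in n (p @ q) \<longleftrightarrow> beads_in n p \<and> beads_in n q"
  "beads_in n (Bead w # p) \<longleftrightarrow> w \<in> carrier (free_group n) \<and> beads_in n p"
  "beads_in n (Leg h # p) \<longleftrightarrow> beads_in n p"
  by (auto simp: beads_in_def)

lemma set_leg_seq [simp]: "set (leg_seq p) = {h. Leg h \<in> set p}"
  by (induction p) (auto simp: leg_seq_def split: point.splits)

lemma leg_seq_concat: "leg_seq (concat ps) = concat (map leg_seq ps)"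
  by (induction ps) auto

lemma legs_mset_BDiag: "legs_mset (BDiag A V E) = mset (leg_seq (concat A))"
  by (simp add: legs_mset_def leg_seq_def)

lemma vertex_halves_BDiag:
  "vertex_halves (BDiag A V E) = mset (leg_seq (concat A)) + (\<Sum>(a, b, c) \<in># V. {#a, b, c#})"
  by (simp add: vertex_halves_def legs_mset_BDiag)

lemma edge_halves_BDiag: "edge_halves (BDiag A V E) = (\<Sum>(s, ws, t) \<in># E. {#s, t#})"
  by (simp add: edge_halves_def)

lemma joined_BDiag: "joined (BDiag A V E) = {(s, t). \<exists>ws. (s, ws, t) \<in># E} \<union>
     {(h, h'). \<exists>a b c. (a, b, c) \<in># V \<and> h \<in> {a, b, c} \<and> h' \<in> {a, b, c}}"
  by (simp add: joined_def)

text \<open>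
  The conditions on vertices, edges and connectivity see the arcs only through their legs.
\<close>

lemma beaded_diagram_arcs_cong:
  assumes "beaded_diagram n m (BDiag A V E)"
    and "mset (leg_seq (concat A')) = mset (leg_seq (concat A))"
    and "length A' = m'" and "\<forall>pts \<in> set A'. beads_in n pts"
  shows "beaded_diagram n m' (BDiag A' V E)"
proof -
  let ?D = "BDiag A V E" and ?D' = "BDiag A' V E"
  have eqs: "legs_mset ?D' = legs_mset ?D" "vertex_halves ?D' = vertex_halves ?D" "edge_halves ?D' = edge_halves ?D"
    "joined ?D' = joined ?D"
    using assms(2) by (simp_all add: vertex_halves_BDiag edge_halves_BDiag legs_mset_BDiag joined_BDiag)
  show ?thesis
    using assms(1,3,4) unfolding beaded_diagram_def beads_in_def eqs bdiag.sel by blast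
qed

lemma beaded_diagram_beads_in: "\<lbrakk>beaded_diagram n m D; pts \<in> set (arcs D)\<rbrakk> \<Longrightarrow> beads_in n pts"
  by (auto simp: beaded_diagram_def beads_in_def)

lemma beaded_diagram_length: "beaded_diagram n m D \<Longrightarrow> length (arcs D) = m"
  by (simp add: beaded_diagram_def)

lemma bead_equiv_refl: "(D, D) \<in> bead_equiv n m"
  by (simp add: bead_equiv_def Let_def)

lemma bead_equiv_trans: "\<lbrakk>(D, D') \<in> bead_equiv n m; (D', D'') \<in> bead_equiv n m\<rbrakk> \<Longrightarrow> (D, D'') \<in> bead_equiv n m"
  unfolding bead_equiv_def Let_def by (rule rtrancl_trans)

lemma bead_equiv_sym:
  assumes "(D, D') \<in> bead_equiv n m"
  shows "(D', D) \<in> bead_equiv n m"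
  using assms unfolding bead_equiv_def Let_def by (rule symD[OF sym_rtrancl[OF sym_Un_converse]])

lemma bead_equiv_step:
  "\<lbrakk>bead_move n D D'; beaded_diagram n m D; beaded_diagram n m D'\<rbrakk> \<Longrightarrow> (D, D') \<in> bead_equiv n m"
  by (auto simp: bead_equiv_def Let_def)

lemma bead_equiv_beaded:
  assumes "(D, D') \<in> bead_equiv n m" "beaded_diagram n m D"
  shows "beaded_diagram n m D'"
  using assms unfolding bead_equiv_def Let_def by (induction rule: rtrancl_induct) auto

lemma bead_equiv_induct [consumes 2, case_names refl step sym trans]:
  assumes "(D, D') \<in> bead_equiv n m" "beaded_diagram n m D"
    and "\<And>D. beaded_diagram n m D \<Longrightarrow> P D D"
    and step: "\<And>D D'. \<lbrakk>beaded_diagram n m D; beaded_diagram n m D'; bead_move n D D'\<rbrakk> \<Longrightarrow> P D D'"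
    and sym: "\<And>D D'. P D D' \<Longrightarrow> P D' D"
    and trans: "\<And>D D' D''. \<lbrakk>P D D'; P D' D''\<rbrakk> \<Longrightarrow> P D D''"
  shows "P D D'"
  using assms(1) unfolding bead_equiv_def Let_def
proof (induction rule: rtrancl_induct)
  case base
  then show ?case using assms(2,3) by blast
next
  case (step y z)
  then have "P y z" using assms(4) sym by auto
  then show ?case using step trans by blast
qed

text \<open>
  The part of the bead moves that acts on single arcs, as a congruence for concatenation: what it
  remembers is the order of the legs and the product of the beads between consecutive legs.  In this
  form it passes to copies of arcs, which are obtained by filtering, inverting and concatenating.
\<close>

inductive arc_eq :: "nat \<Rightarrow> point list \<Rightarrow> point list \<Rightarrow> bool" for n where
  arc_refl [intro!, simp]: "arc_eq n p p"
| arc_sym: "arc_eq n p q \<Longrightarrow> arc_eq n q p"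
| arc_trans [trans]: "\<lbrakk>arc_eq n p q; arc_eq n q r\<rbrakk> \<Longrightarrow> arc_eq n p r"
| arc_append: "\<lbrakk>arc_eq n p p'; arc_eq n q q'\<rbrakk> \<Longrightarrow> arc_eq n (p @ q) (p' @ q')"
| arc_merge: "\<lbrakk>w \<in> carrier (free_group n); x \<in> carrier (free_group n)\<rbrakk> \<Longrightarrow>
    arc_eq n [Bead w, Bead x] [Bead (w \<otimes>\<^bsub>free_group n\<^esub> x)]"
| arc_unit: "arc_eq n [Bead \<one>\<^bsub>free_group n\<^esub>] []"

lemma arc_eq_leg_seq: "arc_eq n p q \<Longrightarrow> leg_seq p = leg_seq q"
  by (induction rule: arc_eq.induct) auto

lemma arc_eq_beads_in: "arc_eq n p q \<Longrightarrow> beads_in n p \<longleftrightarrow> beads_in n q"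
  by (induction rule: arc_eq.induct) auto

lemma arc_eq_Cons: "arc_eq n p q \<Longrightarrow> arc_eq n (x # p) (x # q)"
  using arc_eq.arc_append[OF arc_eq.arc_refl, of n p q "[x]"] by simp

lemma arc_eq_concat: "list_all2 (arc_eq n) ps qs \<Longrightarrow> arc_eq n (concat ps) (concat qs)"
  by (induction rule: list_all2_induct) (auto intro: arc_eq.arc_append)

text \<open>
  The congruence may be used inside any arc.  Symmetry is the reason for keeping track of
  beadedness in both directions, through \<open>arc_eq_leg_seq\<close> and \<open>arc_eq_beads_in\<close>.
\<close>

lemma arc_eq_bead_equiv_context:
  assumes "arc_eq n p q" and "beaded_diagram n m (BDiag (A @ (u @ p @ v) # B) V E)"
  shows "(BDiag (A @ (u @ p @ v) # B) V E, BDiag (A @ (u @ q @ v) # B) V E) \<in> bead_equiv n m"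
  using assms
proof (induction arbitrary: u v rule: arc_eq.induct)
  case (arc_refl p)
  show ?case by (rule bead_equiv_refl)
next
  case (arc_sym p q)
  have "beaded_diagram n m (BDiag (A @ (u @ p @ v) # B) V E)"
    using arc_sym.prems beaded_diagram_beads_in[OF arc_sym.prems] beaded_diagram_beads_in[OF arc_sym.prems, of "u @ q @ v"]
      arc_eq_leg_seq[OF arc_sym.hyps] arc_eq_beads_in[OF arc_sym.hyps]
    beaded_diagram_length[OF arc_sym.prems]
    by (auto intro!: beaded_diagram_arcs_cong[OF arc_sym.prems])
  then show ?case
    using arc_sym.IH bead_equiv_sym by blast
next
  case (arc_trans p q r)
  then show ?case
    using bead_equiv_beaded bead_equiv_trans by meson
next
  case (arc_append p p' q q')
  have 1: "(BDiag (A @ (u @ p @ q @ v) # B) V E, BDiag (A @ (u @ p' @ q @ v) # B) V E) \<in> bead_equiv n m"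
    using arc_append.IH(1)[of u "q @ v"] arc_append.prems by simp
  have 2: "beaded_diagram n m (BDiag (A @ ((u @ p') @ q @ v) # B) V E)"
    using bead_equiv_beaded[OF 1] arc_append.prems by simp
  show ?case
    using bead_equiv_trans[OF 1] arc_append.IH(2)[OF 2] by simp
next
  case (arc_merge w x)
  have "bead_move n (BDiag (A @ (u @ Bead w # Bead x # v) # B) V E)
      (BDiag (A @ (u @ Bead (w \<otimes>\<^bsub>free_group n\<^esub> x) # v) # B) V E)"
    by (rule bead_move.merge_arc)
  moreover have "beaded_diagram n m (BDiag (A @ (u @ Bead (w \<otimes>\<^bsub>free_group n\<^esub> x) # v) # B) V E)"
    using arc_merge beaded_diagram_beads_in[OF arc_merge.prems]
      beaded_diagram_beads_in[OF arc_merge.prems, of "u @ [Bead w, Bead x] @ v"]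
      beaded_diagram_length[OF arc_merge.prems]
    by (auto intro!: beaded_diagram_arcs_cong[OF arc_merge.prems])
  ultimately show ?case
    using arc_merge.prems by (auto intro: bead_equiv_step)
next
  case arc_unit
  have "bead_move n (BDiag (A @ (u @ Bead \<one>\<^bsub>free_group n\<^esub> # v) # B) V E) (BDiag (A @ (u @ v) # B) V E)"
    by (rule bead_move.unit_arc)
  moreover have "beaded_diagram n m (BDiag (A @ (u @ v) # B) V E)"
    using arc_unit beaded_diagram_beads_in[OF arc_unit.prems]
      beaded_diagram_beads_in[OF arc_unit.prems, of "u @ [Bead \<one>\<^bsub>free_group n\<^esub>] @ v"]
      beaded_diagram_length[OF arc_unit.prems]
    by (auto intro!: beaded_diagram_arcs_cong[OF arc_unit.prems])
  ultimately show ?case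
    using arc_unit.prems by (auto intro: bead_equiv_step)
qed

lemma arc_eq_bead_equiv:
  assumes "list_all2 (arc_eq n) A A'" and "beaded_diagram n m (BDiag A V E)"
  shows "(BDiag A V E, BDiag A' V E) \<in> bead_equiv n m"
proof -
  have "(BDiag (C @ A) V E, BDiag (C @ A') V E) \<in> bead_equiv n m"
    if "beaded_diagram n m (BDiag (C @ A) V E)" for C
    using assms(1) that
  proof (induction arbitrary: C rule: list_all2_induct)
    case Nil
    then show ?case by (simp add: bead_equiv_refl)
  next
    case (Cons p P q Q)
    have 1: "(BDiag (C @ p # P) V E, BDiag (C @ q # P) V E) \<in> bead_equiv n m"
      using arc_eq_bead_equiv_context[OF Cons.hyps(1), of m C "[]" "[]" P V E] Cons.prems by simp
    have 2: "beaded_diagram n m (BDiag ((C @ [q]) @ P) V E)"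
      using bead_equiv_beaded[OF 1] Cons.prems by simp
    show ?case
      using bead_equiv_trans[OF 1] Cons.IH[OF 2] by simp
  qed
  from this[of "[]"] show ?thesis
    using assms(2) by simp
qed

lemma bead_product_in_carrier:
  "set ws \<subseteq> carrier (free_group n) \<Longrightarrow>
    foldr (\<lambda>u v. u \<otimes>\<^bsub>free_group n\<^esub> v) ws \<one>\<^bsub>free_group n\<^esub> \<in> carrier (free_group n)"
  by (induction ws) (auto intro: F.m_closed)

lemma arc_eq_bead_product:
  assumes "leg_seq p = []" and "beads_in n p"
  shows "arc_eq n p [Bead (foldr (\<lambda>u v. u \<otimes>\<^bsub>free_group n\<^esub> v) (bead_seq p) \<one>\<^bsub>free_group n\<^esub>)]"
  using assms
proof (induction p)
  case Nil
  then show ?case using arc_eq.arc_sym[OF arc_eq.arc_unit] by simp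
next
  case (Cons x p)
  obtain w where x: "x = Bead w"
    using Cons.prems by (cases x) auto
  let ?pr = "foldr (\<lambda>u v. u \<otimes>\<^bsub>free_group n\<^esub> v) (bead_seq p) \<one>\<^bsub>free_group n\<^esub>"
  have "?pr \<in> carrier (free_group n)"
    using Cons.prems by (intro bead_product_in_carrier) (auto simp: x beads_in_def bead_seq_def split: point.splits)
  then have "arc_eq n [Bead w, Bead ?pr] [Bead (w \<otimes>\<^bsub>free_group n\<^esub> ?pr)]"
    using Cons.prems by (intro arc_eq.arc_merge) (auto simp: x)
  moreover have "arc_eq n (x # p) [Bead w, Bead ?pr]"
    using Cons x by (auto intro: arc_eq_Cons)
  ultimately show ?case
    using arc_eq.arc_trans x by auto
qed


section \<open>Linear algebra modulo the relations\<close>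

definition mod_eq :: "nat \<Rightarrow> nat \<Rightarrow> (bdiag \<Rightarrow>\<^sub>0 'k::field) \<Rightarrow> (bdiag \<Rightarrow>\<^sub>0 'k) \<Rightarrow> bool" where
  "mod_eq n m u v \<longleftrightarrow> u - v \<in> relations n m"

lemma relations_subspace: "diagrams.subspace (relations n m)"
  by (simp add: relations_def diagrams.subspace_span)

lemma relations_0: "0 \<in> relations n m"
  and relations_add: "\<lbrakk>u \<in> relations n m; v \<in> relations n m\<rbrakk> \<Longrightarrow> u + v \<in> relations n m"
  and relations_diff: "\<lbrakk>u \<in> relations n m; v \<in> relations n m\<rbrakk> \<Longrightarrow> u - v \<in> relations n m"
  and relations_uminus: "u \<in> relations n m \<Longrightarrow> - u \<in> relations n m"
  and relations_scale: "u \<in> relations n m \<Longrightarrow> scale c u \<in> relations n m"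
  by (simp_all add: relations_def diagrams.span_zero diagrams.span_add diagrams.span_diff diagrams.span_neg
      diagrams.span_scale)

lemma relations_sum: "(\<And>i. i \<in> I \<Longrightarrow> f i \<in> relations n m) \<Longrightarrow> (\<Sum>i\<in>I. f i) \<in> relations n m"
  unfolding relations_def by (rule diagrams.span_sum)

lemma mod_eq_refl [simp]: "mod_eq n m u u"
  by (simp add: mod_eq_def relations_0)

lemma mod_eq_sym: "mod_eq n m u v \<Longrightarrow> mod_eq n m v u"
  using relations_uminus[of "u - v"] by (simp add: mod_eq_def)

lemma mod_eq_trans [trans]: "\<lbrakk>mod_eq n m u v; mod_eq n m v w\<rbrakk> \<Longrightarrow> mod_eq n m u w"
  using relations_add[of "u - v" n m "v - w"] by (simp add: mod_eq_def)

lemma mod_eq_add: "\<lbrakk>mod_eq n m u u'; mod_eq n m v v'\<rbrakk> \<Longrightarrow> mod_eq n m (u + v) (u' + v')"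
  using relations_add[of "u - u'" n m "v - v'"] by (simp add: mod_eq_def algebra_simps)

lemma mod_eq_scale: "mod_eq n m u u' \<Longrightarrow> mod_eq n m (scale c u) (scale c u')"
  using relations_scale[of "u - u'" n m c] by (simp add: mod_eq_def diagrams.scale_right_diff_distrib)

lemma mod_eq_sum:
  "(\<And>i. i \<in> I \<Longrightarrow> mod_eq n m (f i) (g i)) \<Longrightarrow> mod_eq n m (\<Sum>i\<in>I. f i) (\<Sum>i\<in>I. g i)"
  unfolding mod_eq_def sum_subtractf[symmetric] by (rule relations_sum)

lemma bead_equiv_mod_eq:
  "\<lbrakk>(D, D') \<in> bead_equiv n m; beaded_diagram n m D\<rbrakk> \<Longrightarrow> mod_eq n m (dgm D) (dgm D')"
  unfolding mod_eq_def relations_def by (intro diagrams.span_base) auto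

lemma stu_mod_eq:
  "\<lbrakk>stu D D1 D2; beaded_diagram n m D\<rbrakk> \<Longrightarrow> mod_eq n m (dgm D) (dgm D1 - dgm D2)"
  unfolding mod_eq_def relations_def by (intro diagrams.span_base) auto

lemma arc_eq_mod_eq:
  "\<lbrakk>list_all2 (arc_eq n) A A'; beaded_diagram n m (BDiag A V E)\<rbrakk> \<Longrightarrow>
    mod_eq n m (dgm (BDiag A V E)) (dgm (BDiag A' V E))"
  by (simp add: arc_eq_bead_equiv bead_equiv_mod_eq)

definition linear_ext :: "('k::field \<Rightarrow> 'b \<Rightarrow> 'b) \<Rightarrow> (bdiag \<Rightarrow> 'b::ab_group_add) \<Rightarrow> (bdiag \<Rightarrow>\<^sub>0 'k) \<Rightarrow> 'b" where
  "linear_ext s f v = (\<Sum>D \<in> Poly_Mapping.keys v. s (Poly_Mapping.lookup v D) (f D))"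

context
  fixes s :: "'k::field \<Rightarrow> 'b::ab_group_add \<Rightarrow> 'b" and f :: "bdiag \<Rightarrow> 'b"
  assumes s: "vector_space s"
begin

interpretation S: vector_space s by (rule s)

lemma linear_ext_superset:
  "\<lbrakk>finite K; Poly_Mapping.keys v \<subseteq> K\<rbrakk> \<Longrightarrow> linear_ext s f v = (\<Sum>D \<in> K. s (Poly_Mapping.lookup v D) (f D))"
  unfolding linear_ext_def by (rule sum.mono_neutral_left) (auto simp: in_keys_iff)

lemma linear_ext_add: "linear_ext s f (u + v) = linear_ext s f u + linear_ext s f v"
proof -
  let ?K = "Poly_Mapping.keys u \<union> Poly_Mapping.keys v"
  have "linear_ext s f (u + v) = (\<Sum>D \<in> ?K. s (Poly_Mapping.lookup (u + v) D) (f D))"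
    by (rule linear_ext_superset) (auto simp: Poly_Mapping.keys_add)
  then show ?thesis
    by (simp add: lookup_add S.scale_left_distrib sum.distrib linear_ext_superset[of ?K])
qed

lemma linear_ext_scale: "linear_ext s f (scale c v) = s c (linear_ext s f v)"
proof -
  have "linear_ext s f (scale c v) = (\<Sum>D \<in> Poly_Mapping.keys v. s (Poly_Mapping.lookup (scale c v) D) (f D))"
    by (rule linear_ext_superset) (auto simp: in_keys_iff lookup_scale)
  then show ?thesis
    by (simp add: lookup_scale S.scale_sum_right linear_ext_def)
qed

lemma linear_ext_dgm: "linear_ext s f (dgm D) = f D"
  by (simp add: linear_ext_def dgm_def)

lemma linear_ext_zero: "linear_ext s f 0 = 0"
  by (simp add: linear_ext_def)

lemma linear_ext_diff: "linear_ext s f (u - v) = linear_ext s f u - linear_ext s f v"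
  using linear_ext_add[of u "scale (-1) v"] linear_ext_scale[of "-1" v] by simp

lemma linear_ext_sum: "linear_ext s f (\<Sum>i\<in>I. h i) = (\<Sum>i\<in>I. linear_ext s f (h i))"
  by (induction I rule: infinite_finite_induct) (simp_all add: linear_ext_zero linear_ext_add)

text \<open>
  The tool for checking a property of a linear map on diagrams, for example that it kills the
  relations, on generators only.
\<close>

lemma linear_ext_span:
  assumes "v \<in> diagrams.span S" and "\<And>u. u \<in> S \<Longrightarrow> linear_ext s f u \<in> T" and "S.subspace T"
  shows "linear_ext s f v \<in> T"
proof (rule diagrams.span_induct[OF assms(1)])
  show "diagrams.subspace {v. linear_ext s f v \<in> T}"
    using assms(3) by (auto simp: diagrams.subspace_def S.subspace_def linear_ext_zero linear_ext_add linear_ext_scale)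
qed (use assms(2) in auto)

end

lemma act_eq_linear_ext: "act n g m' = linear_ext scale (act_diagram n g m')"
  by (simp add: fun_eq_iff act_def linear_ext_def)

lemma vector_space_scale: "vector_space (scale :: 'k::field \<Rightarrow> _)"
  by unfold_locales

lemmas act_add = linear_ext_add[OF vector_space_scale, of "act_diagram n g m'" for n g m', folded act_eq_linear_ext]
lemmas act_scale = linear_ext_scale[OF vector_space_scale, of "act_diagram n g m'" for n g m', folded act_eq_linear_ext]
lemmas act_dgm = linear_ext_dgm[OF vector_space_scale, of "act_diagram n g m'" for n g m', folded act_eq_linear_ext]


section \<open>The action with labelled copies\<close>

definition invert :: "nat \<Rightarrow> point \<Rightarrow> point" where
  "invert n x = (case x of Bead w \<Rightarrow> Bead (inv\<^bsub>free_group n\<^esub> w) | Leg h \<Rightarrow> Leg h)"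

definition orient :: "nat \<Rightarrow> bool \<Rightarrow> point list \<Rightarrow> point list" where
  "orient n e pts = (if e then pts else rev (map (invert n) pts))"

definition keep :: "(nat \<Rightarrow> 'l) \<Rightarrow> 'l \<Rightarrow> point list \<Rightarrow> point list" where
  "keep \<chi> l = filter (\<lambda>x. case x of Bead w \<Rightarrow> True | Leg h \<Rightarrow> \<chi> h = l)"

definition lcopy :: "nat \<Rightarrow> point list list \<Rightarrow> (nat \<Rightarrow> 'l) \<Rightarrow> 'l \<times> letter \<Rightarrow> point list" where
  "lcopy n A \<chi> = (\<lambda>(l, p, e). orient n e (keep \<chi> l (A ! p)))"

text \<open>
  Here \<open>L\<close> lists, for each new arc, the copies of old arcs of which it is made, as letters carrying
  labels of an arbitrary type.  With free labels, restricting to some of the copies or composing two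
  actions needs no arithmetic of positions: pairs of labels serve for the composition.
\<close>

definition lattach :: "nat \<Rightarrow> ('l \<times> letter) list list \<Rightarrow> (nat \<Rightarrow> 'l) \<Rightarrow> bdiag \<Rightarrow> bdiag" where
  "lattach n L \<chi> D = BDiag (map (\<lambda>xs. concat (map (lcopy n (arcs D) \<chi>) xs)) L) (tris D) (edges D)"

definition places :: "('l \<times> letter) list list \<Rightarrow> bdiag \<Rightarrow> nat \<Rightarrow> 'l set" where
  "places L D h = {l. \<exists>p e. (l, p, e) \<in> set (concat L) \<and> p < length (arcs D) \<and> Leg h \<in> set (arcs D ! p)}"

definition lattachments :: "('l \<times> letter) list list \<Rightarrow> bdiag \<Rightarrow> (nat \<Rightarrow> 'l) set" where
  "lattachments L D = (\<Pi>\<^sub>E h \<in> legs D. places L D h)"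

definition lsign :: "('l \<times> letter) list list \<Rightarrow> 'l \<Rightarrow> 'k::field" where
  "lsign L l = (if \<exists>p. (l, p, False) \<in> set (concat L) then - 1 else 1)"

definition lact :: "nat \<Rightarrow> ('l \<times> letter) list list \<Rightarrow> bdiag \<Rightarrow> bdiag \<Rightarrow>\<^sub>0 'k::field" where
  "lact n L D = (\<Sum>\<chi> \<in> lattachments L D. scale (\<Prod>h \<in> legs D. lsign L (\<chi> h)) (dgm (lattach n L \<chi> D)))"

text \<open>
  Distinct labels make the copy that receives a given leg unique.
\<close>

definition copying :: "nat \<Rightarrow> ('l \<times> letter) list list \<Rightarrow> bool" where
  "copying m L \<longleftrightarrow> distinct (map fst (concat L)) \<and> (\<forall>(l, p, e) \<in> set (concat L). p < m)"


lemma copying_less: "\<lbrakk>copying m L; (l, p, e) \<in> set (concat L)\<rbrakk> \<Longrightarrow> p < m"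
  unfolding copying_def by blast


subsection \<open>Copies of point lists\<close>

lemma invert_simps [simp]: "invert n (Leg h) = Leg h" "invert n (Bead w) = Bead (inv\<^bsub>free_group n\<^esub> w)"
  by (simp_all add: invert_def)

lemma orient_True [simp]: "orient n True p = p"
  by (simp add: orient_def)

lemma orient_False_simps [simp]:
  "orient n False [] = []" "orient n False (p @ q) = orient n False q @ orient n False p"
  "orient n False (x # p) = orient n False p @ [invert n x]"
  by (simp_all add: orient_def)

lemma orient_concat:
  "orient n e (concat (map G xs)) = concat (map (\<lambda>x. orient n e (G x)) (if e then xs else rev xs))"
  by (cases e; induction xs) auto

lemma orient_orient: "beads_in n p \<Longrightarrow> orient n e (orient n e' p) = orient n (e = e') p"
proof -
  assume "beads_in n p"
  then have "map (\<lambda>x. invert n (invert n x)) p = p"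
    by (intro map_idI) (auto simp: beads_in_def invert_def split: point.splits)
  then show ?thesis
    by (auto simp: orient_def rev_map comp_def)
qed

lemma keep_simps [simp]:
  "keep \<chi> l [] = []" "keep \<chi> l (p @ q) = keep \<chi> l p @ keep \<chi> l q"
  "keep \<chi> l (Bead w # p) = Bead w # keep \<chi> l p"
  "keep \<chi> l (Leg h # p) = (if \<chi> h = l then Leg h # keep \<chi> l p else keep \<chi> l p)"
  by (simp_all add: keep_def)

lemma keep_concat: "keep \<chi> l (concat ps) = concat (map (keep \<chi> l) ps)"
  by (induction ps) auto

lemma keep_orient: "keep \<chi> l (orient n e p) = orient n e (keep \<chi> l p)"
proof (cases e)
  case False
  have "keep \<chi> l (orient n False p) = orient n False (keep \<chi> l p)"
  proof (induction p)
    case (Cons x p)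
    then show ?case by (cases x) auto
  qed simp
  then show ?thesis using False by simp
qed simp

lemma keep_keep: "keep \<chi> l (keep \<chi>' l' p) = keep (\<lambda>h. (\<chi> h, \<chi>' h)) (l, l') p"
  unfolding keep_def filter_filter by (rule filter_cong) (auto split: point.splits)

lemma keep_cong: "(\<And>h. Leg h \<in> set p \<Longrightarrow> \<chi> h = l \<longleftrightarrow> \<chi>' h = l') \<Longrightarrow> keep \<chi> l p = keep \<chi>' l' p"
  unfolding keep_def by (rule filter_cong) (auto split: point.splits)

lemma leg_seq_keep [simp]: "leg_seq (keep \<chi> l p) = filter (\<lambda>h. \<chi> h = l) (leg_seq p)"
proof (induction p)
  case (Cons x p)
  then show ?case by (cases x) auto
qed simp

lemma bead_seq_keep [simp]: "bead_seq (keep \<chi> l p) = bead_seq p"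
proof (induction p)
  case (Cons x p)
  then show ?case by (cases x) auto
qed simp

lemma leg_seq_orient [simp]: "leg_seq (orient n e p) = (if e then leg_seq p else rev (leg_seq p))"
proof (cases e)
  case False
  have "leg_seq (orient n False p) = rev (leg_seq p)"
  proof (induction p)
    case (Cons x p)
    then show ?case by (cases x) auto
  qed simp
  then show ?thesis using False by simp
qed simp

lemma beads_in_keep [simp]: "beads_in n (keep \<chi> l p) \<longleftrightarrow> beads_in n p"
  by (auto simp: beads_in_def keep_def)

lemma beads_in_orient: "beads_in n p \<Longrightarrow> beads_in n (orient n e p)"
proof (cases e)
  case False
  assume "beads_in n p"
  then have "beads_in n (orient n False p)"
  proof (induction p)
    case (Cons x p)
    then show ?case by (cases x) auto
  qed simp
  then show ?thesis using False by simp
qed simp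

lemma beads_in_concat: "beads_in n (concat ps) \<longleftrightarrow> (\<forall>p \<in> set ps. beads_in n p)"
  by (auto simp: beads_in_def)

lemma arc_eq_keep: "arc_eq n p q \<Longrightarrow> arc_eq n (keep \<chi> l p) (keep \<chi> l q)"
  by (induction rule: arc_eq.induct) (auto intro: arc_eq.intros)

text \<open>
  Reversal is an anti-automorphism of concatenation, and inversion one of the product of beads.
\<close>

lemma arc_eq_orient: "arc_eq n p q \<Longrightarrow> arc_eq n (orient n e p) (orient n e q)"
proof (cases e)
  case False
  assume "arc_eq n p q"
  then have "arc_eq n (orient n False p) (orient n False q)"
  proof (induction rule: arc_eq.induct)
    case (arc_merge w x)
    then have "arc_eq n [Bead (inv\<^bsub>free_group n\<^esub> x), Bead (inv\<^bsub>free_group n\<^esub> w)]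
      [Bead (inv\<^bsub>free_group n\<^esub> x \<otimes>\<^bsub>free_group n\<^esub> inv\<^bsub>free_group n\<^esub> w)]"
      by (intro arc_eq.arc_merge) auto
    then show ?case
      using arc_merge by (simp add: F.inv_mult_group)
  next
    case arc_unit
    then show ?case using arc_eq.arc_unit by simp
  qed (auto intro: arc_eq.intros)
  then show ?thesis using False by simp
qed simp

lemma arc_eq_cancel:
  assumes "leg_seq p = []" "beads_in n p"
  shows "arc_eq n (p @ orient n False p) []"
  using assms
proof (induction p)
  case (Cons x p)
  obtain w where x: "x = Bead w"
    using Cons.prems by (cases x) auto
  have w: "w \<in> carrier (free_group n)"
    using Cons.prems by (simp add: x)
  have "arc_eq n ([x] @ (p @ orient n False p) @ [invert n x]) ([x] @ [] @ [invert n x])"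
    using Cons by (intro arc_eq.arc_append) (auto simp: x)
  also have "arc_eq n \<dots> [Bead (w \<otimes>\<^bsub>free_group n\<^esub> inv\<^bsub>free_group n\<^esub> w)]"
    using arc_eq.arc_merge[of w n "inv\<^bsub>free_group n\<^esub> w"] w by (simp add: x)
  also have "arc_eq n \<dots> []"
    using w arc_eq.arc_unit by simp
  finally show ?case by simp
qed simp

definition bead_product :: "nat \<Rightarrow> point list \<Rightarrow> word" where
  "bead_product n p = foldr (\<lambda>u v. u \<otimes>\<^bsub>free_group n\<^esub> v) (bead_seq p) \<one>\<^bsub>free_group n\<^esub>"

lemma bead_product_simps [simp]:
  "bead_product n [] = \<one>\<^bsub>free_group n\<^esub>" "bead_product n (Leg h # p) = bead_product n p"
  "bead_product n (Bead w # p) = w \<otimes>\<^bsub>free_group n\<^esub> bead_product n p"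
  "bead_product n (keep \<chi> l p) = bead_product n p"
  by (simp_all add: bead_product_def)

lemma bead_product_closed: "beads_in n p \<Longrightarrow> bead_product n p \<in> carrier (free_group n)"
proof (induction p)
  case (Cons x p)
  then show ?case by (cases x) auto
qed simp

lemma bead_product_append:
  "\<lbrakk>beads_in n p; beads_in n q\<rbrakk> \<Longrightarrow> bead_product n (p @ q) = bead_product n p \<otimes>\<^bsub>free_group n\<^esub> bead_product n q"
proof (induction p)
  case (Cons x p)
  then show ?case by (cases x) (auto simp: bead_product_closed F.m_assoc)
qed (simp add: bead_product_closed)

lemma bead_product_orient_False:
  "beads_in n p \<Longrightarrow> bead_product n (orient n False p) = inv\<^bsub>free_group n\<^esub> (bead_product n p)"
proof (induction p)
  case (Cons x p)
  then show ?case
    by (cases x) (auto simp: bead_product_append beads_in_orient F.inv_mult_group bead_product_closed)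
qed simp

lemma homotopically_trivial_iff:
  "homotopically_trivial n D \<longleftrightarrow> (\<forall>p \<in> set (arcs D). bead_product n p = \<one>\<^bsub>free_group n\<^esub>)"
  by (simp add: homotopically_trivial_def bead_product_def bead_seq_def)


subsection \<open>Attached diagrams\<close>

lemma legs_eq: "legs D = {h. \<exists>p < length (arcs D). Leg h \<in> set (arcs D ! p)}"
proof -
  have "legs D = {h. \<exists>pts \<in> set (arcs D). Leg h \<in> set pts}"
    by (cases D) (auto simp: legs_mset_BDiag)
  also have "\<dots> = {h. \<exists>p < length (arcs D). Leg h \<in> set (arcs D ! p)}"
    by (metis (no_types, opaque_lifting) in_set_conv_nth)
  finally show ?thesis .
qed

lemma Leg_in_legs: "\<lbrakk>p < length (arcs D); Leg h \<in> set (arcs D ! p)\<rbrakk> \<Longrightarrow> h \<in> legs D"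
  by (auto simp: legs_eq)

lemma finite_lattachments: "finite (lattachments L D)"
  unfolding lattachments_def
proof (rule finite_PiE)
  fix h
  have "places L D h \<subseteq> fst ` set (concat L)" by (force simp: places_def)
  then show "finite (places L D h)" using finite_surj[of "set (concat L)"] by auto
qed simp

lemma lattach_cong:
  assumes "copying (length (arcs D)) L" and "\<And>h. h \<in> legs D \<Longrightarrow> \<chi> h = \<chi>' h"
  shows "lattach n L \<chi> D = lattach n L \<chi>' D"
proof -
  have "lcopy n (arcs D) \<chi> x = lcopy n (arcs D) \<chi>' x" if "x \<in> set (concat L)" for x
  proof -
    obtain l p e where x: "x = (l, p, e)" by (cases x) auto
    then have "p < length (arcs D)" using that assms(1) by (auto simp: copying_def)
    then have "keep \<chi> l (arcs D ! p) = keep \<chi>' l (arcs D ! p)"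
      using assms(2) Leg_in_legs by (intro keep_cong) auto
    then show ?thesis by (simp add: x lcopy_def)
  qed
  then have "concat (map (lcopy n (arcs D) \<chi>) xs) = concat (map (lcopy n (arcs D) \<chi>') xs)" if "xs \<in> set L" for xs
    using that by (intro arg_cong[of _ _ concat] map_cong) auto
  then show ?thesis by (auto simp: lattach_def)
qed

lemma lsign_eq:
  assumes "copying m L" and "(l, p, e) \<in> set (concat L)"
  shows "lsign L l = (if e then 1 else - 1)"
proof -
  have "(p', e') = (p, e)" if "(l, p', e') \<in> set (concat L)" for p' e'
    using assms that eq_key_imp_eq_value[of "concat L" l "(p', e')" "(p, e)"] by (simp add: copying_def)
  then show ?thesis using assms(2) by (cases e) (auto simp: lsign_def)
qed

lemma Leg_in_lcopy: "Leg h \<in> set (lcopy n A \<chi> (l, p, e)) \<longleftrightarrow> Leg h \<in> set (A ! p) \<and> \<chi> h = l"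
  using set_leg_seq[of "lcopy n A \<chi> (l, p, e)"] set_leg_seq[of "A ! p"]
  by (auto simp: lcopy_def set_eq_iff split: if_splits)

text \<open>
  Among all copies only the one labelled \<open>\<chi> h\<close> keeps the leg \<open>h\<close>.
\<close>

lemma count_unique_copy:
  assumes "distinct (map fst xs)" and "(\<chi> h, p, e) \<in> set xs"
  shows "count (mset (concat (map (\<lambda>x. leg_seq (lcopy n A \<chi> x)) xs))) h = count (mset (leg_seq (A ! p))) h"
proof -
  have z: "count (mset (concat (map (\<lambda>x. leg_seq (lcopy n A \<chi> x)) ys))) h = 0" if "\<chi> h \<notin> fst ` set ys" for ys
  proof -
    have "h \<notin> set (concat (map (\<lambda>x. leg_seq (lcopy n A \<chi> x)) ys))"
    proof
      assume "h \<in> set (concat (map (\<lambda>x. leg_seq (lcopy n A \<chi> x)) ys))"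
      then obtain x where "x \<in> set ys" "h \<in> set (leg_seq (lcopy n A \<chi> x))" by auto
      moreover from this have "\<chi> h = fst x"
        using Leg_in_lcopy[of h n A \<chi> "fst x" "fst (snd x)" "snd (snd x)"] by simp
      ultimately show False using that by auto
    qed
    then show ?thesis by (rule iffD2[OF count_mset_0_iff])
  qed
  obtain ys zs where xs: "xs = ys @ (\<chi> h, p, e) # zs"
    using assms(2) by (meson split_list)
  have "\<chi> h \<notin> fst ` set ys" "\<chi> h \<notin> fst ` set zs"
    using assms(1) by (auto simp: xs)
  moreover have "count (mset (filter (\<lambda>h'. \<chi> h' = \<chi> h) qs)) h = count (mset qs) h" for qs
    by (simp add: mset_filter)
  ultimately show ?thesis
    by (simp add: xs z) (simp add: lcopy_def)
qed

lemma concat_map_concat: "concat (map (\<lambda>xs. concat (map f xs)) L) = concat (map f (concat L))"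
  by (induction L) auto

lemma leg_seq_lattach:
  "leg_seq (concat (arcs (lattach n L \<chi> D))) = concat (map (\<lambda>x. leg_seq (lcopy n (arcs D) \<chi> x)) (concat L))"
  by (simp add: lattach_def concat_map_concat leg_seq_concat comp_def)

lemma lattach_legs_mset:
  assumes D: "beaded_diagram n m D" and L: "copying m L" and \<chi>: "\<chi> \<in> lattachments L D"
  shows "legs_mset (lattach n L \<chi> D) = legs_mset D"
proof (rule multiset_eqI)
  fix h
  have A: "legs_mset D = mset (leg_seq (concat (arcs D)))"
    by (cases D) (simp add: legs_mset_BDiag)
  have A': "legs_mset (lattach n L \<chi> D) = mset (leg_seq (concat (arcs (lattach n L \<chi> D))))"
    by (simp add: lattach_def legs_mset_BDiag)
  have len: "length (arcs D) = m"
    using D by (rule beaded_diagram_length)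
  show "count (legs_mset (lattach n L \<chi> D)) h = count (legs_mset D) h"
  proof (cases "h \<in> legs D")
    case True
    then obtain p e where p: "(\<chi> h, p, e) \<in> set (concat L)" "p < m" "Leg h \<in> set (arcs D ! p)"
    proof -
      have "\<chi> h \<in> places L D h"
        using \<chi> True by (auto simp: lattachments_def)
      then show ?thesis
        using that by (auto simp only: places_def len mem_Collect_eq)
    qed
    have "count (legs_mset (lattach n L \<chi> D)) h = count (mset (leg_seq (arcs D ! p))) h"
      unfolding A' leg_seq_lattach using L p(1) by (intro count_unique_copy) (simp_all add: copying_def)
    moreover have "count (mset (leg_seq (arcs D ! p))) h \<ge> 1"
      using p(3) by (simp add: Suc_le_eq)
    moreover have "count (legs_mset D) h \<ge> count (mset (leg_seq (arcs D ! p))) h"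
    proof -
      have "arcs D = take p (arcs D) @ arcs D ! p # drop (Suc p) (arcs D)"
        using p(2) len by (simp add: id_take_nth_drop)
      then have "leg_seq (concat (arcs D)) = leg_seq (concat (take p (arcs D))) @ leg_seq (arcs D ! p) @ leg_seq (concat (drop (Suc p) (arcs D)))"
        by (metis concat.simps(2) concat_append leg_seq_simps(2))
      then show ?thesis
        unfolding A by simp
    qed
    moreover have "count (legs_mset D) h \<le> 1"
    proof -
      have "count (vertex_halves D) h \<le> 1" using D unfolding beaded_diagram_def by blast
      then show ?thesis by (simp add: vertex_halves_def)
    qed
    ultimately show ?thesis by linarith
  next
    case False
    have "h \<notin> set (leg_seq (concat (arcs (lattach n L \<chi> D))))"
    proof
      assume "h \<in> set (leg_seq (concat (arcs (lattach n L \<chi> D))))"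
      then obtain l p e where "(l, p, e) \<in> set (concat L)" "Leg h \<in> set (arcs D ! p)"
        unfolding leg_seq_lattach by (fastforce simp: Leg_in_lcopy)
      then show False
        using copying_less[OF L] False Leg_in_legs[of p D h] len by blast
    qed
    then show ?thesis
      using False unfolding A' by (metis count_eq_zero_iff set_mset_mset)
  qed
qed

lemma beads_in_lcopy:
  assumes "beaded_diagram n m D" "copying m L" "x \<in> set (concat L)"
  shows "beads_in n (lcopy n (arcs D) \<chi> x)"
proof -
  obtain l p e where x: "x = (l, p, e)" by (cases x) auto
  then have "p < m" using assms by (auto simp: copying_def)
  then have "beads_in n (arcs D ! p)"
    using assms(1) by (intro beaded_diagram_beads_in) (auto dest: beaded_diagram_length)
  then show ?thesis by (simp add: x lcopy_def beads_in_orient)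
qed

lemma lattach_beaded:
  assumes D: "beaded_diagram n m D" and L: "copying m L" and \<chi>: "\<chi> \<in> lattachments L D"
  shows "beaded_diagram n (length L) (lattach n L \<chi> D)"
proof -
  have "beads_in n pts" if "pts \<in> set (arcs (lattach n L \<chi> D))" for pts
    using that beads_in_lcopy[OF D L] by (fastforce simp: lattach_def beads_in_concat)
  moreover have "mset (leg_seq (concat (arcs (lattach n L \<chi> D)))) = mset (leg_seq (concat (arcs D)))"
    using lattach_legs_mset[OF assms] by (cases D) (simp add: lattach_def legs_mset_BDiag)
  moreover have "lattach n L \<chi> D = BDiag (arcs (lattach n L \<chi> D)) (tris D) (edges D)"
    by (simp add: lattach_def)
  ultimately show ?thesis
    using D beaded_diagram_arcs_cong[of n m "arcs D" "tris D" "edges D" "arcs (lattach n L \<chi> D)" "length L"]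
    by (simp add: lattach_def)
qed

lemma lattach_degree:
  assumes "beaded_diagram n m D" "copying m L" "\<chi> \<in> lattachments L D"
  shows "degree (lattach n L \<chi> D) = degree D"
  using lattach_legs_mset[OF assms] by (simp add: degree_def lattach_def)

text \<open>
  The product of beads along each copy is \<open>1\<close> or its inverse.
\<close>

lemma lattach_homotopically_trivial:
  assumes "beaded_diagram n m D" "copying m L" "homotopically_trivial n D"
  shows "homotopically_trivial n (lattach n L \<chi> D)"
proof -
  have 1: "bead_product n (lcopy n (arcs D) \<chi> x) = \<one>\<^bsub>free_group n\<^esub>" if "x \<in> set (concat L)" for x
  proof -
    obtain l p e where x: "x = (l, p, e)" by (cases x) auto
    then have "p < m" using that assms by (auto simp: copying_def)
    then have p: "arcs D ! p \<in> set (arcs D)"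
      using assms(1) by (auto dest: beaded_diagram_length)
    then have "bead_product n (arcs D ! p) = \<one>\<^bsub>free_group n\<^esub>" "beads_in n (arcs D ! p)"
      using assms(3) beaded_diagram_beads_in[OF assms(1)] by (auto simp: homotopically_trivial_iff)
    then show ?thesis by (cases e) (simp_all add: x lcopy_def bead_product_orient_False)
  qed
  have "bead_product n (concat (map (lcopy n (arcs D) \<chi>) xs)) = \<one>\<^bsub>free_group n\<^esub>" if "set xs \<subseteq> set (concat L)" for xs
    using that
  proof (induction xs)
    case (Cons x xs)
    then have "\<forall>y \<in> set (x # xs). beads_in n (lcopy n (arcs D) \<chi> y)"
      using beads_in_lcopy[OF assms(1,2)] by blast
    then have "beads_in n (concat (map (lcopy n (arcs D) \<chi>) xs))" "beads_in n (lcopy n (arcs D) \<chi> x)"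
      by (auto simp: beads_in_concat)
    then show ?case
      using Cons 1[of x] by (simp add: bead_product_append)
  qed simp
  then show ?thesis
    by (auto simp: homotopically_trivial_iff lattach_def)
qed


subsection \<open>Independence of the labels\<close>

definition copies_of :: "word list \<Rightarrow> ((nat \<times> nat) \<times> letter) list list" where
  "copies_of W = map (\<lambda>j. map (\<lambda>s. ((j, s), W ! j ! s)) [0..<length (W ! j)]) [0..<length W]"

abbreviation gen_images :: "(word \<Rightarrow> word) \<Rightarrow> nat \<Rightarrow> word list" where
  "gen_images g m' \<equiv> map (\<lambda>j. g (gen j)) [0..<m']"

lemma length_copies_of [simp]: "length (copies_of W) = length W"
  by (simp add: copies_of_def)

lemma set_copies_of: "x \<in> set (concat (copies_of W)) \<longleftrightarrow>
    (\<exists>j s. j < length W \<and> s < length (W ! j) \<and> x = ((j, s), W ! j ! s))"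
  by (force simp: copies_of_def)

lemma nth_subset_concat: "p < length L \<Longrightarrow> set (L ! p) \<subseteq> set (concat L)"
  by (metis UN_upper nth_mem set_concat)

lemma distinct_copies_of: "distinct (map fst (concat (copies_of W)))"
proof -
  have *: "distinct (map fst (concat (map (\<lambda>j. map (\<lambda>s. ((j, s), W ! j ! s)) [0..<length (W ! j)]) js)))"
    if "distinct js" for js
    using that
  proof (induction js)
    case (Cons j js)
    have "distinct (map (\<lambda>s. (j, s)) [0..<length (W ! j)])"
      by (simp add: distinct_map inj_on_def)
    then show ?case
      using Cons by (auto simp: comp_def)
  qed simp
  show ?thesis
    unfolding copies_of_def by (rule *) simp
qed

lemma copying_copies_of: "copying m (copies_of W) \<longleftrightarrow> (\<forall>w \<in> set W. \<forall>a \<in> set w. fst a < m)"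
proof -
  have "(\<forall>(l, p, e) \<in> set (concat (copies_of W)). p < m) \<longleftrightarrow> (\<forall>j < length W. \<forall>s < length (W ! j). fst (W ! j ! s) < m)"
    unfolding Ball_def set_copies_of by (force simp: prod_eq_iff)
  then show ?thesis
    by (simp add: copying_def distinct_copies_of all_set_conv_all_nth)
qed

lemma map_snd_copies_of [simp]: "map (map snd) (copies_of W) = W"
  by (auto intro!: nth_equalityI simp: copies_of_def)

lemma prod_sign:
  "finite S \<Longrightarrow> (\<Prod>x\<in>S. if P x then - 1 else 1 :: 'k::field) = (- 1) ^ card {x \<in> S. P x}"
  by (simp add: prod.inter_filter[symmetric])

lemma act_diagram_eq_lact:
  "(act_diagram n g m' D :: bdiag \<Rightarrow>\<^sub>0 'k::field) = lact n (copies_of (gen_images g m')) D"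
proof -
  let ?L = "copies_of (gen_images g m')"
  have mem: "((j, s), p, e) \<in> set (concat ?L) \<longleftrightarrow> j < m' \<and> s < length (g (gen j)) \<and> g (gen j) ! s = (p, e)" for j s p e
    unfolding set_copies_of by auto
  have pl: "places ?L D h = (\<Union>p \<in> {p. p < length (arcs D) \<and> Leg h \<in> set (arcs D ! p)}. copies g m' p)" for h
  proof (rule Set.set_eqI)
    fix l :: "nat \<times> nat"
    obtain j s where l: "l = (j, s)" by (cases l) auto
    show "l \<in> places ?L D h \<longleftrightarrow> l \<in> (\<Union>p \<in> {p. p < length (arcs D) \<and> Leg h \<in> set (arcs D ! p)}. copies g m' p)"
      unfolding l places_def copies_def mem_Collect_eq UN_iff mem by (auto simp: prod_eq_iff)
  qed
  then have at: "attachments g m' D = lattachments ?L D"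
    by (simp add: attachments_def lattachments_def)
  have la: "attach n g m' D \<chi> = lattach n ?L \<chi> D" for \<chi>
    by (auto simp: attach_def lattach_def copies_of_def lcopy_def copy_of_arc_def orient_def keep_def invert_def[abs_def]
        Let_def comp_def split: prod.splits intro!: arg_cong[of _ _ concat])
  have sg: "(- 1) ^ n_reversed g D \<chi> = (\<Prod>h \<in> legs D. lsign ?L (\<chi> h) :: 'k)" if "\<chi> \<in> lattachments ?L D" for \<chi>
  proof -
    have "(\<Prod>h \<in> legs D. lsign ?L (\<chi> h) :: 'k) = (\<Prod>h \<in> legs D. if \<not> snd (g (gen (fst (\<chi> h))) ! snd (\<chi> h)) then - 1 else 1)"
    proof (rule prod.cong[OF refl])
      fix h assume "h \<in> legs D"
      then have "\<chi> h \<in> places ?L D h"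
        using that by (auto simp: lattachments_def)
      then obtain p e where "(\<chi> h, p, e) \<in> set (concat ?L)"
        by (auto simp: places_def simp del: set_concat)
      then have "fst (\<chi> h) < m'" "snd (\<chi> h) < length (g (gen (fst (\<chi> h))))"
        using mem[of "fst (\<chi> h)" "snd (\<chi> h)" p e] by auto
      then show "lsign ?L (\<chi> h) = (if \<not> snd (g (gen (fst (\<chi> h))) ! snd (\<chi> h)) then - 1 else 1 :: 'k)"
        using mem[of "fst (\<chi> h)" "snd (\<chi> h)"] by (simp add: lsign_def prod_eq_iff del: set_concat)
    qed
    then show ?thesis by (simp add: prod_sign n_reversed_def)
  qed
  show ?thesis
    unfolding act_diagram_def lact_def at la by (rule sum.cong) (auto simp: sg)
qed

text \<open>
  An injective change of labels is a bijection between the attachments.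
\<close>

lemma lact_relabel:
  assumes inj: "inj_on f (fst ` set (concat L))" and L: "copying (length (arcs D)) L"
  shows "lact n (map (map (apfst f)) L) D = (lact n L D :: bdiag \<Rightarrow>\<^sub>0 'k::field)"
proof -
  let ?fL = "map (map (apfst f)) L" and ?S = "fst ` set (concat L)"
  have mem: "x \<in> set (concat ?fL) \<longleftrightarrow> (\<exists>l a. (l, a) \<in> set (concat L) \<and> x = (f l, a))" for x
    by (force simp: apfst_def)
  have pl: "places ?fL D h = f ` places L D h" for h
    unfolding places_def set_eq_iff by (auto simp: mem simp del: set_concat)
  have plS: "places L D h \<subseteq> ?S" for h
    by (force simp: places_def simp del: set_concat)
  have sg: "lsign ?fL (f l) = (lsign L l :: 'k)" if "l \<in> ?S" for l
  proof -
    have "(f l, p, False) \<in> set (concat ?fL) \<longleftrightarrow> (l, p, False) \<in> set (concat L)" for p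
      unfolding mem using that inj by (auto simp del: set_concat simp: inj_on_def)
    then show ?thesis by (simp add: lsign_def del: set_concat)
  qed
  have at: "lattach n ?fL (restrict (f \<circ> \<chi>) (legs D)) D = lattach n L \<chi> D" if \<chi>: "\<chi> \<in> lattachments L D" for \<chi>
  proof -
    have "lcopy n (arcs D) (restrict (f \<circ> \<chi>) (legs D)) (apfst f x) = lcopy n (arcs D) \<chi> x" if x: "x \<in> set (concat L)" for x
    proof -
      obtain l p e where le: "x = (l, p, e)" by (cases x) auto
      have "keep (restrict (f \<circ> \<chi>) (legs D)) (f l) (arcs D ! p) = keep \<chi> l (arcs D ! p)"
      proof (rule keep_cong)
        fix h assume h: "Leg h \<in> set (arcs D ! p)"
        have "p < length (arcs D)" using L x by (intro copying_less) (auto simp: le)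
        then have hl: "h \<in> legs D" using h by (rule Leg_in_legs)
        then have "\<chi> h \<in> ?S" using \<chi> plS unfolding lattachments_def by blast
        moreover have "l \<in> ?S" using x le by (metis fst_conv image_eqI)
        ultimately show "(restrict (f \<circ> \<chi>) (legs D) h = f l) = (\<chi> h = l)"
          using hl inj_on_eq_iff[OF inj] by simp
      qed
      then show ?thesis by (simp add: le lcopy_def)
    qed
    then have "concat (map (lcopy n (arcs D) (restrict (f \<circ> \<chi>) (legs D))) (map (apfst f) xs)) = concat (map (lcopy n (arcs D) \<chi>) xs)"
      if "xs \<in> set L" for xs
      unfolding map_map comp_def using that by (intro arg_cong[of _ _ concat] map_cong) auto
    then show ?thesis by (simp add: lattach_def)
  qed
  have "(lact n L D :: bdiag \<Rightarrow>\<^sub>0 'k) = lact n ?fL D"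
    unfolding lact_def
  proof (rule sum.reindex_bij_witness[where i = "\<lambda>\<chi>. restrict (inv_into ?S f \<circ> \<chi>) (legs D)"
        and j = "\<lambda>\<chi>. restrict (f \<circ> \<chi>) (legs D)"])
    fix \<chi> assume \<chi>: "\<chi> \<in> lattachments L D"
    have S: "\<chi> h \<in> ?S" if "h \<in> legs D" for h
      using \<chi> plS that unfolding lattachments_def by blast
    show "restrict (inv_into ?S f \<circ> restrict (f \<circ> \<chi>) (legs D)) (legs D) = \<chi>"
    proof (rule extensionalityI[where A = "legs D"])
      fix h assume "h \<in> legs D"
      then show "restrict (inv_into ?S f \<circ> restrict (f \<circ> \<chi>) (legs D)) (legs D) h = \<chi> h"
        using S inv_into_f_f[OF inj] by (simp del: set_concat)
    qed (use \<chi> in \<open>auto simp: lattachments_def PiE_def\<close>)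
    show "restrict (f \<circ> \<chi>) (legs D) \<in> lattachments ?fL D"
      using \<chi> unfolding lattachments_def pl by (auto simp: PiE_def Pi_def)
    show "scale (\<Prod>h\<in>legs D. lsign ?fL (restrict (f \<circ> \<chi>) (legs D) h)) (dgm (lattach n ?fL (restrict (f \<circ> \<chi>) (legs D)) D))
        = scale (\<Prod>h\<in>legs D. lsign L (\<chi> h)) (dgm (lattach n L \<chi> D) :: bdiag \<Rightarrow>\<^sub>0 'k)"
      unfolding at[OF \<chi>] using S sg by (intro arg_cong[of _ _ "\<lambda>c. scale c _"] prod.cong) auto
  next
    fix \<chi> assume \<chi>: "\<chi> \<in> lattachments ?fL D"
    have S: "\<chi> h \<in> f ` places L D h" if "h \<in> legs D" for h
      using \<chi> that unfolding lattachments_def pl by blast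
    have S': "inv_into ?S f (\<chi> h) \<in> places L D h" "f (inv_into ?S f (\<chi> h)) = \<chi> h" if h: "h \<in> legs D" for h
    proof -
      obtain l where l: "l \<in> places L D h" "\<chi> h = f l" using S[OF h] by auto
      then have "l \<in> ?S" using plS by blast
      then have "inv_into ?S f (\<chi> h) = l" unfolding l(2) by (rule inv_into_f_f[OF inj])
      then show "inv_into ?S f (\<chi> h) \<in> places L D h" "f (inv_into ?S f (\<chi> h)) = \<chi> h" using l by auto
    qed
    show "restrict (inv_into ?S f \<circ> \<chi>) (legs D) \<in> lattachments L D"
      using S' unfolding lattachments_def by (auto simp del: set_concat)
    show "restrict (f \<circ> restrict (inv_into ?S f \<circ> \<chi>) (legs D)) (legs D) = \<chi>"
    proof (rule extensionalityI[where A = "legs D"])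
      fix h assume "h \<in> legs D"
      then show "restrict (f \<circ> restrict (inv_into ?S f \<circ> \<chi>) (legs D)) (legs D) h = \<chi> h"
        using S' by (simp del: set_concat)
    qed (use \<chi> in \<open>auto simp: lattachments_def PiE_def\<close>)
  qed
  then show ?thesis by simp
qed

lemma distinct_concat_nth_inj:
  "\<lbrakk>distinct (concat xss); j < length xss; s < length (xss ! j); j' < length xss; s' < length (xss ! j');
    xss ! j ! s = xss ! j' ! s'\<rbrakk> \<Longrightarrow> j = j' \<and> s = s'"
proof (induction xss arbitrary: j j')
  case (Cons xs xss)
  have disj: "xss ! i ! t \<notin> set xs" if "i < length xss" "t < length (xss ! i)" for i t
    using Cons.prems(1) that by (auto dest!: nth_mem)
  show ?case
  proof (cases j; cases j')
    assume "j = 0" "j' = 0"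
    then show ?thesis using Cons.prems by (simp add: nth_eq_iff_index_eq)
  next
    fix i assume "j = 0" "j' = Suc i"
    then show ?thesis using Cons.prems disj[of i s'] by (metis Suc_less_eq length_Cons nth_Cons_0 nth_Cons_Suc nth_mem)
  next
    fix i assume "j = Suc i" "j' = 0"
    then show ?thesis using Cons.prems disj[of i s] by (metis Suc_less_eq length_Cons nth_Cons_0 nth_Cons_Suc nth_mem)
  next
    fix i i' assume "j = Suc i" "j' = Suc i'"
    then show ?thesis using Cons.prems Cons.IH[of i i'] by simp
  qed
qed simp

text \<open>
  Any labels may be exchanged for the positions of the letters in their words.
\<close>

lemma lact_copies_of:
  assumes L: "copying (length (arcs D)) L"
  shows "lact n L D = lact n (copies_of (map (map snd) L)) D"
proof -
  let ?W = "map (map snd) L"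
  define f where "f = (\<lambda>(j, s). fst (L ! j ! s))"
  have "L = map (map (apfst f)) (copies_of ?W)"
    by (rule nth_equalityI) (auto intro!: nth_equalityI simp: copies_of_def f_def prod_eq_iff)
  moreover have "inj_on f (fst ` set (concat (copies_of ?W)))"
  proof (rule inj_onI)
    fix x y assume "x \<in> fst ` set (concat (copies_of ?W))" "y \<in> fst ` set (concat (copies_of ?W))" and f: "f x = f y"
    then obtain j s j' s' where x: "x = (j, s)" "j < length L" "s < length (L ! j)"
      and y: "y = (j', s')" "j' < length L" "s' < length (L ! j')"
      unfolding image_iff set_copies_of Bex_def by auto
    have "distinct (concat (map (map fst) L))"
      using L by (simp add: copying_def map_concat)
    from distinct_concat_nth_inj[OF this, of j s j' s'] show "x = y"
      using x y f by (simp add: f_def)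
  qed
  moreover have "copying (length (arcs D)) (copies_of ?W)"
    unfolding copying_copies_of using copying_less[OF L] by (auto simp: prod_eq_iff) fastforce
  ultimately show ?thesis
    using lact_relabel[of f "copies_of ?W" D n] by metis
qed


subsection \<open>Composition\<close>

definition block :: "('l \<times> letter) list list \<Rightarrow> 'm \<times> letter \<Rightarrow> (('m \<times> 'l) \<times> letter) list" where
  "block L = (\<lambda>(k, p, e). map (\<lambda>(l, q, e'). ((k, l), q, e = e')) (if e then L ! p else rev (L ! p)))"

definition lcomp :: "('m \<times> letter) list list \<Rightarrow> ('l \<times> letter) list list \<Rightarrow> (('m \<times> 'l) \<times> letter) list list" where
  "lcomp K L = map (\<lambda>xs. concat (map (block L) xs)) K"

lemma concat_lcomp: "concat (lcomp K L) = concat (map (block L) (concat K))"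
  by (simp add: lcomp_def concat_map_concat)

lemma set_block: "((k', l), q, f) \<in> set (block L (k, p, e)) \<longleftrightarrow> k' = k \<and> (\<exists>e'. (l, q, e') \<in> set (L ! p) \<and> f = (e = e'))"
  by (force simp: block_def)

lemma set_lcomp: "((k, l), q, f) \<in> set (concat (lcomp K L)) \<longleftrightarrow>
    (\<exists>p e e'. (k, p, e) \<in> set (concat K) \<and> (l, q, e') \<in> set (L ! p) \<and> f = (e = e'))"
proof -
  have "((k, l), q, f) \<in> set (concat (lcomp K L)) \<longleftrightarrow> (\<exists>x \<in> set (concat K). ((k, l), q, f) \<in> set (block L x))"
    by (simp add: concat_lcomp del: set_concat) auto
  also have "\<dots> \<longleftrightarrow> (\<exists>p e e'. (k, p, e) \<in> set (concat K) \<and> (l, q, e') \<in> set (L ! p) \<and> f = (e = e'))"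
    unfolding Bex_def split_paired_Ex set_block by blast
  finally show ?thesis .
qed

lemma copying_lcomp:
  assumes K: "copying (length L) K" and L: "copying m L"
  shows "copying m (lcomp K L)"
proof -
  have sub: "set (L ! p) \<subseteq> set (concat L)" if "(k, p, e) \<in> set (concat K)" for k p e
    using copying_less[OF K that] by (rule nth_subset_concat)
  have dL: "distinct (map fst (L ! p))" if "p < length L" for p
  proof -
    have "distinct (concat (map (map fst) L))"
      using L by (simp add: copying_def map_concat)
    then show ?thesis
      using that by (auto simp: distinct_concat_iff)
  qed
  have "distinct (map fst (concat (map (block L) xs)))" if "distinct (map fst xs)" "\<forall>(k, p, e) \<in> set xs. p < length L" for xs
    using that
  proof (induction xs)
    case (Cons x xs)
    obtain k p e where x: "x = (k, p, e)" by (cases x) auto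
    have "map fst (block L x) = map (Pair k) (map fst (if e then L ! p else rev (L ! p)))"
      by (auto simp: x block_def)
    moreover have "distinct (map fst (if e then L ! p else rev (L ! p)))"
      using dL[of p] Cons.prems x by (auto simp: rev_map[symmetric])
    ultimately have "distinct (map fst (block L x))"
      by (simp only: distinct_map[of "Pair k"]) (simp add: inj_on_def)
    moreover have "fst ` set (block L x) \<inter> fst ` (\<Union>y \<in> set xs. set (block L y)) = {}"
      using Cons.prems(1) by (auto simp: x set_block) (metis fst_conv image_eqI)
    ultimately show ?case
      using Cons by (auto simp: x)
  qed simp
  moreover have "distinct (map fst (concat K))" "\<forall>(k, p, e) \<in> set (concat K). p < length L"
    using K unfolding copying_def by auto
  ultimately have "distinct (map fst (concat (lcomp K L)))"
    unfolding concat_lcomp by blast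
  moreover have "q < m" if "((k, l), q, f) \<in> set (concat (lcomp K L))" for k l q f
    using that sub copying_less[OF L] unfolding set_lcomp by blast
  ultimately show ?thesis
    unfolding copying_def Ball_def split_paired_All prod.case by blast
qed

text \<open>
  Reversing a concatenation of copies reverses the order of the copies and each copy, and a copy
  reversed twice is not reversed: this is the orientation \<open>e = e'\<close> in \<open>block\<close>.
\<close>

lemma lattach_lattach:
  assumes D: "beaded_diagram n m D" and L: "copying m L" and K: "copying (length L) K"
  shows "lattach n K \<psi> (lattach n L \<chi> D) = lattach n (lcomp K L) (\<lambda>h. (\<psi> h, \<chi> h)) D"
proof -
  have "lcopy n (arcs (lattach n L \<chi> D)) \<psi> x = concat (map (lcopy n (arcs D) (\<lambda>h. (\<psi> h, \<chi> h))) (block L x))"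
    if x: "x \<in> set (concat K)" for x
  proof -
    obtain k p e where kpe: "x = (k, p, e)" by (cases x) auto
    have p: "p < length L" using copying_less[OF K] x kpe by metis
    have y: "orient n e (keep \<psi> k (lcopy n (arcs D) \<chi> y)) = lcopy n (arcs D) (\<lambda>h. (\<psi> h, \<chi> h)) (case y of (l, q, e') \<Rightarrow> ((k, l), q, e = e'))"
      if "y \<in> set (L ! p)" for y
    proof -
      obtain l q e' where lqe: "y = (l, q, e')" by (cases y) auto
      have "q < m" using copying_less[OF L, of l q e'] that nth_subset_concat[OF p] lqe by blast
      then have "beads_in n (arcs D ! q)"
        using beaded_diagram_beads_in[OF D] beaded_diagram_length[OF D] by auto
      then show ?thesis
        by (simp add: lqe lcopy_def keep_orient keep_keep orient_orient)
    qed
    have "arcs (lattach n L \<chi> D) ! p = concat (map (lcopy n (arcs D) \<chi>) (L ! p))"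
      using p by (simp add: lattach_def)
    then have "lcopy n (arcs (lattach n L \<chi> D)) \<psi> x = orient n e (concat (map (\<lambda>y. keep \<psi> k (lcopy n (arcs D) \<chi> y)) (L ! p)))"
      by (simp add: kpe lcopy_def[of n "arcs (lattach n L \<chi> D)"] keep_concat comp_def)
    also have "\<dots> = concat (map (lcopy n (arcs D) (\<lambda>h. (\<psi> h, \<chi> h))) (block L x))"
      unfolding orient_concat kpe block_def using y by (auto simp: comp_def intro!: arg_cong[of _ _ concat])
    finally show ?thesis .
  qed
  then have "concat (map (lcopy n (arcs (lattach n L \<chi> D)) \<psi>) xs) = concat (map (lcopy n (arcs D) (\<lambda>h. (\<psi> h, \<chi> h))) (concat (map (block L) xs)))"
    if "set xs \<subseteq> set (concat K)" for xs
    using that by (induction xs) auto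
  then show ?thesis
    unfolding lattach_def[of n K] lattach_def[of n "lcomp K L"] lcomp_def
    by (auto simp: lattach_def)
qed

lemma places_lcomp:
  assumes D: "beaded_diagram n m D" and L: "copying m L" and K: "copying (length L) K"
  shows "(k, \<chi> h) \<in> places (lcomp K L) D h \<longleftrightarrow> k \<in> places K (lattach n L \<chi> D) h \<and> \<chi> h \<in> places L D h"
proof -
  have len: "length (arcs (lattach n L \<chi> D)) = length L" "length (arcs D) = m"
    using beaded_diagram_length[OF D] by (simp_all add: lattach_def)
  have arc: "Leg h \<in> set (arcs (lattach n L \<chi> D) ! p) \<longleftrightarrow> (\<exists>q e. (\<chi> h, q, e) \<in> set (L ! p) \<and> Leg h \<in> set (arcs D ! q))"
    if "p < length L" for p
  proof -
    have "Leg h \<in> set (arcs (lattach n L \<chi> D) ! p) \<longleftrightarrow> (\<exists>y \<in> set (L ! p). Leg h \<in> set (lcopy n (arcs D) \<chi> y))"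
      using that by (simp add: lattach_def)
    also have "\<dots> \<longleftrightarrow> (\<exists>q e. (\<chi> h, q, e) \<in> set (L ! p) \<and> Leg h \<in> set (arcs D ! q))"
      unfolding Bex_def split_paired_Ex Leg_in_lcopy by blast
    finally show ?thesis .
  qed
  have sub: "set (L ! p) \<subseteq> set (concat L)" if "p < length L" for p
    using that by (rule nth_subset_concat)
  show ?thesis
    unfolding places_def mem_Collect_eq len set_lcomp
    using arc sub copying_less[OF L] copying_less[OF K] by blast
qed

text \<open>
  Attaching a leg first to a copy labelled \<open>l\<close> and then to a copy labelled \<open>k\<close> amounts to attaching it
  to the copy labelled \<open>(k, l)\<close> of the composite, with the product of the two signs.
\<close>

lemma lact_lact:
  assumes D: "beaded_diagram n m D" and L: "copying m L" and K: "copying (length L) K"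
  shows "linear_ext scale (lact n K) (lact n L D) = (lact n (lcomp K L) D :: bdiag \<Rightarrow>\<^sub>0 'k::field)"
proof -
  note le = linear_ext_sum[OF vector_space_scale] linear_ext_scale[OF vector_space_scale]
    linear_ext_dgm[OF vector_space_scale]
  let ?sg = "\<lambda>M \<chi>. \<Prod>h\<in>legs D. lsign M (\<chi> h) :: 'k"
  let ?I = "Sigma (lattachments L D) (\<lambda>\<chi>. lattachments K (lattach n L \<chi> D))"
  have legs: "legs (lattach n L \<chi> D) = legs D" if "\<chi> \<in> lattachments L D" for \<chi>
    using lattach_legs_mset[OF D L that] by simp
  have KL: "copying m (lcomp K L)"
    by (rule copying_lcomp[OF K L])
  have sub: "set (L ! p) \<subseteq> set (concat L)" if "p < length L" for p
    using that by (rule nth_subset_concat)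
  have sg: "lsign (lcomp K L) (k, l) = (lsign K k * lsign L l :: 'k)" if kl: "(k, l) \<in> places (lcomp K L) D h" for k l h
  proof -
    obtain q f where "((k, l), q, f) \<in> set (concat (lcomp K L))"
      using kl unfolding places_def by blast
    moreover from this obtain p e e' where "(k, p, e) \<in> set (concat K)" "(l, q, e') \<in> set (L ! p)" "f = (e = e')"
      unfolding set_lcomp by blast
    moreover from this have "(l, q, e') \<in> set (concat L)"
      using sub copying_less[OF K] by blast
    ultimately show ?thesis
      by (cases e; cases e')
        (simp_all add: lsign_eq[OF KL, of "(k, l)" q f] lsign_eq[OF K, of k p e] lsign_eq[OF L, of l q e'])
  qed
  have "linear_ext scale (lact n K) (lact n L D)
      = (\<Sum>\<chi>\<in>lattachments L D. \<Sum>\<psi>\<in>lattachments K (lattach n L \<chi> D).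
          scale (?sg L \<chi> * ?sg K \<psi>) (dgm (lattach n K \<psi> (lattach n L \<chi> D))))"
    unfolding lact_def[of n L] le
    by (rule sum.cong[OF refl]) (simp add: lact_def diagrams.scale_sum_right legs)
  also have "\<dots> = (\<Sum>(\<chi>, \<psi>)\<in>?I. scale (?sg L \<chi> * ?sg K \<psi>) (dgm (lattach n K \<psi> (lattach n L \<chi> D))))"
    by (rule sum.Sigma) (auto simp: finite_lattachments)
  also have "\<dots> = lact n (lcomp K L) D"
    unfolding lact_def
  proof (rule sum.reindex_bij_witness[where j = "\<lambda>(\<chi>, \<psi>). restrict (\<lambda>h. (\<psi> h, \<chi> h)) (legs D)"
        and i = "\<lambda>\<omega>. (restrict (snd \<circ> \<omega>) (legs D), restrict (fst \<circ> \<omega>) (legs D))"])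
    fix x assume "x \<in> ?I"
    then obtain \<chi> \<psi> where x: "x = (\<chi>, \<psi>)" and \<chi>: "\<chi> \<in> lattachments L D" and \<psi>: "\<psi> \<in> lattachments K (lattach n L \<chi> D)"
      by auto
    let ?\<omega> = "restrict (\<lambda>h. (\<psi> h, \<chi> h)) (legs D)"
    have pl: "(\<psi> h, \<chi> h) \<in> places (lcomp K L) D h" if "h \<in> legs D" for h
      using \<chi> \<psi> that unfolding places_lcomp[OF D L K] lattachments_def legs[OF \<chi>] by blast
    show "(case x of (\<chi>, \<psi>) \<Rightarrow> restrict (\<lambda>h. (\<psi> h, \<chi> h)) (legs D)) \<in> lattachments (lcomp K L) D"
      using pl by (auto simp: x lattachments_def)
    have "restrict (snd \<circ> ?\<omega>) (legs D) = \<chi>" "restrict (fst \<circ> ?\<omega>) (legs D) = \<psi>"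
      using \<chi> \<psi> unfolding lattachments_def legs[OF \<chi>]
      by (auto simp: PiE_def intro!: extensionalityI[where A = "legs D"])
    then show "(restrict (snd \<circ> (case x of (\<chi>, \<psi>) \<Rightarrow> restrict (\<lambda>h. (\<psi> h, \<chi> h)) (legs D))) (legs D),
        restrict (fst \<circ> (case x of (\<chi>, \<psi>) \<Rightarrow> restrict (\<lambda>h. (\<psi> h, \<chi> h)) (legs D))) (legs D)) = x"
      by (simp add: x)
    have "lattach n (lcomp K L) ?\<omega> D = lattach n (lcomp K L) (\<lambda>h. (\<psi> h, \<chi> h)) D"
      using KL by (intro lattach_cong) (simp_all add: beaded_diagram_length[OF D])
    moreover have "?sg (lcomp K L) ?\<omega> = ?sg L \<chi> * ?sg K \<psi>"
      unfolding prod.distrib[symmetric] using sg[OF pl] by (intro prod.cong) (auto simp: mult.commute)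
    ultimately show "scale (?sg (lcomp K L) (case x of (\<chi>, \<psi>) \<Rightarrow> restrict (\<lambda>h. (\<psi> h, \<chi> h)) (legs D)))
        (dgm (lattach n (lcomp K L) (case x of (\<chi>, \<psi>) \<Rightarrow> restrict (\<lambda>h. (\<psi> h, \<chi> h)) (legs D)) D))
      = (case x of (\<chi>, \<psi>) \<Rightarrow> scale (?sg L \<chi> * ?sg K \<psi>) (dgm (lattach n K \<psi> (lattach n L \<chi> D))))"
      by (simp add: x lattach_lattach[OF D L K])
  next
    fix \<omega> assume \<omega>: "\<omega> \<in> lattachments (lcomp K L) D"
    let ?\<chi> = "restrict (snd \<circ> \<omega>) (legs D)" and ?\<psi> = "restrict (fst \<circ> \<omega>) (legs D)"
    have pl: "(?\<psi> h, ?\<chi> h) \<in> places (lcomp K L) D h" if "h \<in> legs D" for h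
      using \<omega> that unfolding lattachments_def by auto
    have \<chi>: "?\<chi> \<in> lattachments L D"
      using pl unfolding places_lcomp[OF D L K] by (auto simp: lattachments_def)
    moreover have "?\<psi> \<in> lattachments K (lattach n L ?\<chi> D)"
      using pl unfolding places_lcomp[OF D L K] lattachments_def legs[OF \<chi>] by auto
    ultimately show "(?\<chi>, ?\<psi>) \<in> ?I"
      by simp
    show "(case (?\<chi>, ?\<psi>) of (\<chi>, \<psi>) \<Rightarrow> restrict (\<lambda>h. (\<psi> h, \<chi> h)) (legs D)) = \<omega>"
      using \<omega> by (auto simp: lattachments_def PiE_def intro!: extensionalityI[where A = "legs D"])
  qed
  finally show ?thesis .
qed


section \<open>The action is compatible with the relations\<close>

subsection \<open>Beads on edges\<close>

lemma beaded_diagram_edges_cong: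
  assumes "beaded_diagram n m (BDiag A V E)"
    and "edge_halves (BDiag A V E') = edge_halves (BDiag A V E)"
    and "{(s, t). \<exists>ws. (s, ws, t) \<in># E'} = {(s, t). \<exists>ws. (s, ws, t) \<in># E}"
    and "\<forall>(s, ws, t) \<in># E'. set ws \<subseteq> carrier (free_group n)"
  shows "beaded_diagram n m (BDiag A V E')"
proof -
  let ?D = "BDiag A V E" and ?D' = "BDiag A V E'"
  have eqs: "legs_mset ?D' = legs_mset ?D" "vertex_halves ?D' = vertex_halves ?D"
    "joined ?D' = joined ?D" "edge_halves ?D' = edge_halves ?D"
    using assms(2,3) by (simp_all add: vertex_halves_BDiag legs_mset_BDiag joined_BDiag)
  show ?thesis
    using assms(1,4) unfolding beaded_diagram_def eqs bdiag.sel by blast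
qed

lemma beaded_diagram_image_edges:
  assumes D: "beaded_diagram n m (BDiag A V E)"
    and f: "\<And>s ws t. \<lbrakk>(s, ws, t) \<in># E; set ws \<subseteq> carrier (free_group n)\<rbrakk> \<Longrightarrow>
      \<exists>ws'. f (s, ws, t) = (s, ws', t) \<and> set ws' \<subseteq> carrier (free_group n)"
  shows "beaded_diagram n m (BDiag A V (image_mset f E))"
proof (rule beaded_diagram_edges_cong[OF D])
  have beads: "set ws \<subseteq> carrier (free_group n)" if "(s, ws, t) \<in># E" for s ws t
    using D that by (auto simp: beaded_diagram_def)
  have f': "\<exists>ws'. f (s, ws, t) = (s, ws', t) \<and> set ws' \<subseteq> carrier (free_group n)" if "(s, ws, t) \<in># E" for s ws t
    using f[OF that beads[OF that]] .
  show "edge_halves (BDiag A V (image_mset f E)) = edge_halves (BDiag A V E)"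
    unfolding edge_halves_BDiag image_mset.compositionality comp_def
    by (intro arg_cong[of _ _ sum_mset] image_mset_cong) (use f' in fastforce)
  show "\<forall>(s, ws, t) \<in># image_mset f E. set ws \<subseteq> carrier (free_group n)"
    using f' by fastforce
  have "(\<exists>ws. (s, ws, t) \<in># image_mset f E) \<longleftrightarrow> (\<exists>ws. (s, ws, t) \<in># E)" for s t
  proof
    assume "\<exists>ws. (s, ws, t) \<in># image_mset f E"
    then obtain ws s' ws' t' where e: "(s', ws', t') \<in># E" "(s, ws, t) = f (s', ws', t')" by auto
    from f'[OF e(1)] e show "\<exists>ws. (s, ws, t) \<in># E" by auto
  next
    assume "\<exists>ws. (s, ws, t) \<in># E"
    then obtain ws where e: "(s, ws, t) \<in># E" ..
    then have "f (s, ws, t) \<in># image_mset f E" by simp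
    then show "\<exists>ws. (s, ws, t) \<in># image_mset f E" using f'[OF e] by metis
  qed
  then show "{(s, t). \<exists>ws. (s, ws, t) \<in># image_mset f E} = {(s, t). \<exists>ws. (s, ws, t) \<in># E}"
    by simp
qed

text \<open>
  A normal form for the beads on one edge.
\<close>

definition merge_beads :: "nat \<Rightarrow> nat \<times> word list \<times> nat \<Rightarrow> nat \<times> word list \<times> nat" where
  "merge_beads n = (\<lambda>(s, ws, t). (s, [bead_product n (map Bead ws)], t))"

lemma bead_product_words_closed:
  "set ws \<subseteq> carrier (free_group n) \<Longrightarrow> bead_product n (map Bead ws) \<in> carrier (free_group n)"
  by (rule bead_product_closed) (auto simp: beads_in_def)

lemma beaded_diagram_replace_edge:
  assumes "beaded_diagram n m (BDiag A V (add_mset (s, ws, t) E))" and "set ws' \<subseteq> carrier (free_group n)"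
  shows "beaded_diagram n m (BDiag A V (add_mset (s, ws', t) E))"
  by (rule beaded_diagram_edges_cong[OF assms(1)])
    (use assms in \<open>auto simp: edge_halves_BDiag beaded_diagram_def\<close>)

lemma edge_merge_beads:
  assumes "beaded_diagram n m (BDiag A V (add_mset (s, us @ ws, t) E))"
  shows "(BDiag A V (add_mset (s, us @ ws, t) E),
    BDiag A V (add_mset (s, us @ [bead_product n (map Bead ws)], t) E)) \<in> bead_equiv n m"
  using assms
proof (induction ws arbitrary: us)
  case Nil
  have "bead_move n (BDiag A V (add_mset (s, us @ \<one>\<^bsub>free_group n\<^esub> # [], t) E)) (BDiag A V (add_mset (s, us @ [], t) E))"
    by (rule bead_move.unit_edge)
  moreover have "beaded_diagram n m (BDiag A V (add_mset (s, us @ \<one>\<^bsub>free_group n\<^esub> # [], t) E))"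
    using Nil by (intro beaded_diagram_replace_edge[OF Nil]) (auto simp: beaded_diagram_def)
  ultimately show ?case
    using Nil by (simp add: bead_equiv_step bead_equiv_sym)
next
  case (Cons x ws)
  let ?pr = "bead_product n (map Bead ws)"
  have c: "set (us @ x # ws) \<subseteq> carrier (free_group n)"
    using Cons.prems by (auto simp: beaded_diagram_def)
  then have pr: "?pr \<in> carrier (free_group n)"
    by (intro bead_product_words_closed) auto
  have 1: "(BDiag A V (add_mset (s, us @ x # ws, t) E), BDiag A V (add_mset (s, us @ x # [?pr], t) E)) \<in> bead_equiv n m"
    using Cons.IH[of "us @ [x]"] Cons.prems by simp
  have "bead_move n (BDiag A V (add_mset (s, us @ x # ?pr # [], t) E)) (BDiag A V (add_mset (s, us @ (x \<otimes>\<^bsub>free_group n\<^esub> ?pr) # [], t) E))"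
    by (rule bead_move.merge_edge)
  moreover have "beaded_diagram n m (BDiag A V (add_mset (s, us @ x # ?pr # [], t) E))"
    using c pr by (intro beaded_diagram_replace_edge[OF Cons.prems]) auto
  moreover have "beaded_diagram n m (BDiag A V (add_mset (s, us @ (x \<otimes>\<^bsub>free_group n\<^esub> ?pr) # [], t) E))"
    using c pr by (intro beaded_diagram_replace_edge[OF Cons.prems]) auto
  ultimately have "(BDiag A V (add_mset (s, us @ x # ?pr # [], t) E), BDiag A V (add_mset (s, us @ [x \<otimes>\<^bsub>free_group n\<^esub> ?pr], t) E)) \<in> bead_equiv n m"
    using bead_equiv_step by simp
  then show ?case
    using bead_equiv_trans[OF 1] by simp
qed

lemma edges_merge_beads:
  assumes "beaded_diagram n m (BDiag A V E)"
  shows "(BDiag A V E, BDiag A V (image_mset (merge_beads n) E)) \<in> bead_equiv n m"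
proof -
  have "(BDiag A V (E + E'), BDiag A V (image_mset (merge_beads n) E + E')) \<in> bead_equiv n m"
    if "beaded_diagram n m (BDiag A V (E + E'))" for E'
    using that
  proof (induction E arbitrary: E')
    case empty
    then show ?case by (simp add: bead_equiv_refl)
  next
    case (add e E)
    obtain s ws t where e: "e = (s, ws, t)" by (cases e) auto
    have 1: "(BDiag A V (add_mset (s, ws, t) (E + E')), BDiag A V (add_mset (merge_beads n e) (E + E'))) \<in> bead_equiv n m"
      using edge_merge_beads[of n m A V s "[]" ws t "E + E'"] add.prems by (simp add: e merge_beads_def)
    have 2: "beaded_diagram n m (BDiag A V (E + add_mset (merge_beads n e) E'))"
      using bead_equiv_beaded[OF 1] add.prems by (simp add: e)
    show ?case
      using bead_equiv_trans[OF 1] add.IH[OF 2] by (simp add: e)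
  qed
  from this[of "{#}"] show ?thesis using assms by simp
qed

lemma edges_bead_equiv:
  assumes "beaded_diagram n m (BDiag A V E)" "beaded_diagram n m (BDiag A V E')"
    and "image_mset (merge_beads n) E = image_mset (merge_beads n) E'"
  shows "(BDiag A V E, BDiag A V E') \<in> bead_equiv n m"
  using edges_merge_beads[OF assms(1)] edges_merge_beads[OF assms(2)] assms(3)
  by (metis bead_equiv_sym bead_equiv_trans)

lemma emit_beads:
  assumes "set ws \<subseteq> carrier (free_group n)" "w \<in> carrier (free_group n)"
  shows "\<exists>ws'. emit n H w (s, ws, t) = (s, ws', t) \<and> set ws' \<subseteq> carrier (free_group n)"
  using assms by (auto simp: emit_def)

lemma beaded_diagram_emit:
  assumes "beaded_diagram n m (BDiag A V E)" "w \<in> carrier (free_group n)"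
  shows "beaded_diagram n m (BDiag A V (image_mset (emit n H w) E))"
  using assms emit_beads by (intro beaded_diagram_image_edges) auto

text \<open>
  The two beads emitted at each half-edge in \<open>H\<close> are next to each other and inverse to each other.
\<close>

lemma merge_beads_emit_emit:
  assumes "set ws \<subseteq> carrier (free_group n)" "w \<in> carrier (free_group n)"
  shows "merge_beads n (emit n H (inv\<^bsub>free_group n\<^esub> w) (emit n H w (s, ws, t))) = merge_beads n (s, ws, t)"
proof -
  let ?pr = "bead_product n"
  have ws: "beads_in n (map Bead ws)" using assms(1) by (auto simp: beads_in_def)
  note closed = bead_product_closed[OF ws] assms(2)
  have 1: "?pr (Bead (inv\<^bsub>free_group n\<^esub> w) # Bead w # q) = ?pr q" if "beads_in n q" for q
    using bead_product_closed[OF that] assms(2) by (simp add: F.m_assoc[symmetric])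
  have 2: "?pr (q @ [Bead (inv\<^bsub>free_group n\<^esub> w), Bead w]) = ?pr q" if "beads_in n q" for q
    using bead_product_closed[OF that] assms(2) that by (simp add: bead_product_append)
  show ?thesis
    using assms ws 1[of "map Bead ws"] 1[of "map Bead ws @ [Bead (inv\<^bsub>free_group n\<^esub> w), Bead w]"] 2[of "map Bead ws"]
    by (auto simp: emit_def merge_beads_def)
qed


subsection \<open>Bead moves\<close>

lemma lact_mod_eq:
  assumes "legs D' = legs D" and "\<And>h. h \<in> legs D \<Longrightarrow> places L D' h = places L D h"
    and "\<And>\<chi>. \<chi> \<in> lattachments L D \<Longrightarrow> mod_eq n m' (dgm (lattach n L \<chi> D)) (dgm (lattach n L \<chi> D') :: bdiag \<Rightarrow>\<^sub>0 'k::field)"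
  shows "mod_eq n m' (lact n L D) (lact n L D' :: bdiag \<Rightarrow>\<^sub>0 'k)"
proof -
  have "lattachments L D' = lattachments L D"
    using assms(1,2) unfolding lattachments_def by (auto intro!: PiE_cong)
  then show ?thesis
    unfolding lact_def by (auto intro!: mod_eq_sum mod_eq_scale assms(3) simp: assms(1))
qed

lemma lattach_BDiag: "lattach n L \<chi> (BDiag A V E) = BDiag (map (\<lambda>xs. concat (map (lcopy n A \<chi>) xs)) L) V E"
  by (simp add: lattach_def)

text \<open>
  Moves that concern trivalent vertices and edges commute with every change of the arcs.
\<close>

lemma lact_same_arcs:
  assumes D: "beaded_diagram n m (BDiag A V E)" "beaded_diagram n m (BDiag A V' E')" and L: "copying m L"
    and move: "\<And>A. bead_move n (BDiag A V E) (BDiag A V' E')"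
  shows "mod_eq n (length L) (lact n L (BDiag A V E)) (lact n L (BDiag A V' E') :: bdiag \<Rightarrow>\<^sub>0 'k::field)"
proof (rule lact_mod_eq)
  show legs: "legs (BDiag A V' E') = legs (BDiag A V E)"
    by (simp add: legs_mset_BDiag)
  show pl: "places L (BDiag A V' E') h = places L (BDiag A V E) h" for h
    by (simp add: places_def)
  fix \<chi> assume \<chi>: "\<chi> \<in> lattachments L (BDiag A V E)"
  then have \<chi>': "\<chi> \<in> lattachments L (BDiag A V' E')"
    by (simp add: lattachments_def legs pl)
  show "mod_eq n (length L) (dgm (lattach n L \<chi> (BDiag A V E))) (dgm (lattach n L \<chi> (BDiag A V' E')) :: bdiag \<Rightarrow>\<^sub>0 'k)"
    using lattach_beaded[OF D(1) L \<chi>] lattach_beaded[OF D(2) L \<chi>'] move unfolding lattach_BDiag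
    by (intro bead_equiv_mod_eq bead_equiv_step)
qed

lemma lact_arc_eq:
  assumes D: "beaded_diagram n m (BDiag A V E)" and L: "copying m L" and A: "list_all2 (arc_eq n) A A'"
  shows "mod_eq n (length L) (lact n L (BDiag A V E)) (lact n L (BDiag A' V E) :: bdiag \<Rightarrow>\<^sub>0 'k::field)"
proof (rule lact_mod_eq)
  have len: "length A' = length A" "length A = m"
    using A D by (auto dest: list_all2_lengthD beaded_diagram_length)
  have arc: "leg_seq (A ! p) = leg_seq (A' ! p)" if "p < length A" for p
    using A that arc_eq_leg_seq by (auto simp: list_all2_conv_all_nth)
  then have "map leg_seq A = map leg_seq A'"
    by (auto intro: nth_equalityI simp: len)
  then show legs: "legs (BDiag A' V E) = legs (BDiag A V E)"
    by (simp only: legs_mset_BDiag leg_seq_concat)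
  have "Leg h \<in> set (A' ! p) \<longleftrightarrow> Leg h \<in> set (A ! p)" if "p < length A" for p h
    using arg_cong[OF arc[OF that], of set] unfolding set_leg_seq set_eq_iff by simp
  then show pl: "places L (BDiag A' V E) h = places L (BDiag A V E) h" for h
    unfolding places_def bdiag.sel len(1) by blast
  fix \<chi> assume \<chi>: "\<chi> \<in> lattachments L (BDiag A V E)"
  have "arc_eq n (concat (map (lcopy n A \<chi>) xs)) (concat (map (lcopy n A' \<chi>) xs))" if "xs \<in> set L" for xs
  proof (intro arc_eq_concat)
    have "arc_eq n (lcopy n A \<chi> x) (lcopy n A' \<chi> x)" if "x \<in> set xs" for x
    proof -
      obtain l p e where x: "x = (l, p, e)" by (cases x) auto
      have "p < m" using copying_less[OF L, of l p e] that x \<open>xs \<in> set L\<close> by auto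
      then show ?thesis
        using A by (auto simp: x lcopy_def list_all2_conv_all_nth len intro!: arc_eq_orient arc_eq_keep)
    qed
    then show "list_all2 (arc_eq n) (map (lcopy n A \<chi>) xs) (map (lcopy n A' \<chi>) xs)"
      by (simp add: list_all2_conv_all_nth)
  qed
  then have "list_all2 (arc_eq n) (map (\<lambda>xs. concat (map (lcopy n A \<chi>) xs)) L) (map (\<lambda>xs. concat (map (lcopy n A' \<chi>) xs)) L)"
    by (simp add: list_all2_conv_all_nth)
  then show "mod_eq n (length L) (dgm (lattach n L \<chi> (BDiag A V E))) (dgm (lattach n L \<chi> (BDiag A' V E)) :: bdiag \<Rightarrow>\<^sub>0 'k)"
    using lattach_beaded[OF D L \<chi>] unfolding lattach_BDiag by (rule arc_eq_mod_eq)
qed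

lemma distinct_leg_seq:
  assumes "beaded_diagram n m D"
  shows "distinct (leg_seq (concat (arcs D)))"
proof -
  have "count (vertex_halves D) h \<le> 1" for h
    using assms unfolding beaded_diagram_def by blast
  then have "count (mset (leg_seq (concat (arcs D)))) h \<le> 1" for h
    by (cases D) (auto simp: vertex_halves_BDiag dest: spec[of _ h] add_leD1)
  then have "count (mset (leg_seq (concat (arcs D)))) h = (if h \<in> set (leg_seq (concat (arcs D))) then 1 else 0)" for h
    by (metis count_mset_0_iff le_neq_implies_less less_one)
  then show ?thesis
    unfolding distinct_count_atmost_1 by blast
qed

lemma Leg_unique_arc:
  assumes "beaded_diagram n m D" "p < m" "p' < m" "Leg h \<in> set (arcs D ! p)" "Leg h \<in> set (arcs D ! p')"
  shows "p = p'"
proof -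
  have d: "distinct (concat (map leg_seq (arcs D)))"
    using distinct_leg_seq[OF assms(1)] by (simp add: leg_seq_concat)
  have len: "length (arcs D) = m" using assms(1) by (rule beaded_diagram_length)
  obtain s s' where "s < length (leg_seq (arcs D ! p))" "leg_seq (arcs D ! p) ! s = h"
    "s' < length (leg_seq (arcs D ! p'))" "leg_seq (arcs D ! p') ! s' = h"
    using assms(4,5) set_leg_seq by (metis in_set_conv_nth mem_Collect_eq)
  then show ?thesis
    using distinct_concat_nth_inj[OF d, of p s p' s'] assms(2,3) len by auto
qed

text \<open>
  The copy with a given label can be singled out, and the rest of the attached arcs depends only on
  the other copies.  This reduces a move at one leg to a move in a single copy.
\<close>

lemma lattach_context:
  fixes L :: "('l \<times> letter) list list"
  assumes L: "copying m L" and x: "(l, i, e) \<in> set (concat L)"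
  shows "\<exists>X P Q Y. (\<forall>F. map (\<lambda>xs. concat (map F xs)) L = X F @ (P F @ F (l, i, e) @ Q F) # Y F) \<and>
    (\<forall>F F' :: _ \<Rightarrow> point list. (\<forall>x \<in> set (concat L). fst x \<noteq> l \<longrightarrow> F x = F' x) \<longrightarrow>
      X F = X F' \<and> P F = P F' \<and> Q F = Q F' \<and> Y F = Y F')"
proof -
  obtain xs where "xs \<in> set L" "(l, i, e) \<in> set xs" using x by auto
  then obtain LA LB l1 l2 where LL: "L = LA @ (l1 @ (l, i, e) # l2) # LB"
    by (metis split_list)
  have "distinct (map fst (concat L))" using L by (simp add: copying_def)
  then have l: "l \<notin> fst ` set (concat LA)" "l \<notin> fst ` set (concat LB)" "l \<notin> fst ` set l1" "l \<notin> fst ` set l2"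
    by (auto simp: LL)
  show ?thesis
  proof (rule exI[of _ "\<lambda>F. map (\<lambda>xs. concat (map F xs)) LA"], rule exI[of _ "\<lambda>F. concat (map F l1)"],
      rule exI[of _ "\<lambda>F. concat (map F l2)"], rule exI[of _ "\<lambda>F. map (\<lambda>xs. concat (map F xs)) LB"],
      intro conjI allI impI)
    fix F F' :: "'l \<times> letter \<Rightarrow> point list"
    assume *: "\<forall>x \<in> set (concat L). fst x \<noteq> l \<longrightarrow> F x = F' x"
    have **: "F x = F' x" if "xs \<in> set LA \<union> set LB \<union> {l1, l2}" "x \<in> set xs" for x xs
    proof -
      have "x \<in> set (concat L)" using that by (auto simp: LL)
      moreover have "fst x \<noteq> l" using that l by auto
      ultimately show ?thesis using * by blast
    qed
    have c: "concat (map F xs) = concat (map F' xs)" if "xs \<in> set LA \<union> set LB \<union> {l1, l2}" for xs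
      using **[OF that] by (intro arg_cong[of _ _ concat] map_cong refl)
    show "map (\<lambda>xs. concat (map F xs)) LA = map (\<lambda>xs. concat (map F' xs)) LA"
      "concat (map F l1) = concat (map F' l1)" "concat (map F l2) = concat (map F' l2)"
      "map (\<lambda>xs. concat (map F xs)) LB = map (\<lambda>xs. concat (map F' xs)) LB"
      using c by (auto intro: map_cong)
  qed (simp add: LL)
qed

lemma places_eq:
  assumes D: "beaded_diagram n m D" and i: "i < m" "Leg h \<in> set (arcs D ! i)"
  shows "places L D h = {l. \<exists>e. (l, i, e) \<in> set (concat L)}"
proof -
  have "p < length (arcs D) \<and> Leg h \<in> set (arcs D ! p) \<longleftrightarrow> p = i" for p
    using Leg_unique_arc[OF D _ i(1) _ i(2), of p] i beaded_diagram_length[OF D] by auto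
  then show ?thesis unfolding places_def by simp
qed

text \<open>
  Only the copy carrying \<open>v\<close> sees the order of the bead and the leg.  On a reversed copy the inverse
  bead slides across \<open>v\<close> in the other direction, and the bead that it emits on the edge
  cancels the bead \<open>w\<close> that is already there.
\<close>

lemma lact_slide_univalent:
  assumes D: "beaded_diagram n m (BDiag (A @ (p @ Bead w # Leg v # q) # B) V E)"
    and D': "beaded_diagram n m (BDiag (A @ (p @ Leg v # Bead w # q) # B) V (image_mset (emit n {v} w) E))"
    and L: "copying m L"
  shows "mod_eq n (length L) (lact n L (BDiag (A @ (p @ Bead w # Leg v # q) # B) V E))
    (lact n L (BDiag (A @ (p @ Leg v # Bead w # q) # B) V (image_mset (emit n {v} w) E)) :: bdiag \<Rightarrow>\<^sub>0 'k::field)"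
    (is "mod_eq n _ (lact n L ?D) (lact n L ?D')")
proof (rule lact_mod_eq)
  let ?A = "A @ (p @ Bead w # Leg v # q) # B" and ?A' = "A @ (p @ Leg v # Bead w # q) # B"
  let ?i = "length A"
  have w: "w \<in> carrier (free_group n)"
    using beaded_diagram_beads_in[OF D, of "p @ Bead w # Leg v # q"] by simp
  show legs: "legs ?D' = legs ?D"
    by (auto simp: legs_mset_BDiag)
  have set: "Leg h \<in> set (?A' ! j) \<longleftrightarrow> Leg h \<in> set (?A ! j)" for h j
    by (auto simp: nth_append nth_Cons split: nat.splits)
  then show pl: "places L ?D' h = places L ?D h" for h
    by (simp add: places_def)
  fix \<chi> assume \<chi>: "\<chi> \<in> lattachments L ?D"
  then have \<chi>': "\<chi> \<in> lattachments L ?D'"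
    unfolding lattachments_def legs pl .
  have "\<chi> v \<in> places L ?D v"
    using \<chi> by (auto simp: lattachments_def legs_mset_BDiag)
  moreover have "?i < m" "Leg v \<in> set (arcs ?D ! ?i)"
    using beaded_diagram_length[OF D] by auto
  ultimately obtain e where e: "(\<chi> v, ?i, e) \<in> set (concat L)"
    unfolding places_eq[OF D \<open>?i < m\<close> \<open>Leg v \<in> set (arcs ?D ! ?i)\<close>] by auto
  obtain X P Q Y where X: "\<forall>F :: _ \<Rightarrow> point list. map (\<lambda>xs. concat (map F xs)) L = X F @ (P F @ F (\<chi> v, ?i, e) @ Q F) # Y F"
    and XX: "\<forall>F F'. (\<forall>x \<in> set (concat L). fst x \<noteq> \<chi> v \<longrightarrow> F x = F' x) \<longrightarrow> X F = X F' \<and> P F = P F' \<and> Q F = Q F' \<and> Y F = Y F'"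
    using lattach_context[OF L e] by (elim exE conjE) (rule that)
  have same: "lcopy n ?A \<chi> x = lcopy n ?A' \<chi> x" if "fst x \<noteq> \<chi> v" for x
  proof -
    obtain l j f where x: "x = (l, j, f)" by (cases x) auto
    have "keep \<chi> l (?A ! j) = keep \<chi> l (?A' ! j)"
      using that by (auto simp: x nth_append nth_Cons split: nat.splits)
    then show ?thesis by (simp add: x lcopy_def)
  qed
  let ?F = "lcopy n ?A \<chi>" and ?F' = "lcopy n ?A' \<chi>"
  have XF: "X ?F' = X ?F" "P ?F' = P ?F" "Q ?F' = Q ?F" "Y ?F' = Y ?F"
    using XX[rule_format, of ?F ?F'] same by auto
  let ?p = "keep \<chi> (\<chi> v) p" and ?q = "keep \<chi> (\<chi> v) q"
  have att: "lattach n L \<chi> ?D = BDiag (X ?F @ (P ?F @ orient n e (?p @ Bead w # Leg v # ?q) @ Q ?F) # Y ?F) V E"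
    and att': "lattach n L \<chi> ?D' = BDiag (X ?F @ (P ?F @ orient n e (?p @ Leg v # Bead w # ?q) @ Q ?F) # Y ?F) V (image_mset (emit n {v} w) E)"
    unfolding lattach_BDiag X[rule_format] XF by (simp_all add: lcopy_def)
  have b: "beaded_diagram n (length L) (lattach n L \<chi> ?D)" "beaded_diagram n (length L) (lattach n L \<chi> ?D')"
    using lattach_beaded[OF D L \<chi>] lattach_beaded[OF D' L \<chi>'] .
  have "(lattach n L \<chi> ?D, lattach n L \<chi> ?D') \<in> bead_equiv n (length L)"
  proof (cases e)
    case True
    have "bead_move n (lattach n L \<chi> ?D) (lattach n L \<chi> ?D')"
      using bead_move.slide_univalent[of n "X ?F" "P ?F @ ?p" w v "?q @ Q ?F" "Y ?F" V E] by (simp add: att att' True)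
    then show ?thesis using b by (rule bead_equiv_step)
  next
    case False
    let ?w' = "inv\<^bsub>free_group n\<^esub> w"
    let ?p' = "P ?F @ orient n False ?q" and ?q' = "orient n False ?p @ Q ?F"
    let ?T = "BDiag (X ?F @ (?p' @ Leg v # Bead ?w' # ?q') # Y ?F) V (image_mset (emit n {v} ?w') (image_mset (emit n {v} w) E))"
    have att2: "lattach n L \<chi> ?D = BDiag (X ?F @ (?p' @ Leg v # Bead ?w' # ?q') # Y ?F) V E"
      by (simp add: att False)
    have att2': "lattach n L \<chi> ?D' = BDiag (X ?F @ (?p' @ Bead ?w' # Leg v # ?q') # Y ?F) V (image_mset (emit n {v} w) E)"
      by (simp add: att' False)
    have T: "beaded_diagram n (length L) ?T"
      using b(1) w unfolding att2 by (intro beaded_diagram_emit) auto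
    have "bead_move n (lattach n L \<chi> ?D') ?T"
      unfolding att2' by (rule bead_move.slide_univalent)
    then have "(lattach n L \<chi> ?D', ?T) \<in> bead_equiv n (length L)"
      using b(2) T by (rule bead_equiv_step)
    moreover have "(?T, lattach n L \<chi> ?D) \<in> bead_equiv n (length L)"
      unfolding att2
    proof (rule edges_bead_equiv[OF T])
      have beads: "\<forall>(s, ws, t) \<in># E. set ws \<subseteq> carrier (free_group n)"
        using D by (simp add: beaded_diagram_def)
      show "image_mset (merge_beads n) (image_mset (emit n {v} ?w') (image_mset (emit n {v} w) E)) = image_mset (merge_beads n) E"
        unfolding image_mset.compositionality comp_def
      proof (rule image_mset_cong)
        fix x assume x: "x \<in># E"
        obtain s ws t where swt: "x = (s, ws, t)" by (cases x) auto
        show "merge_beads n (emit n {v} ?w' (emit n {v} w x)) = merge_beads n x"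
          unfolding swt using beads x swt w by (intro merge_beads_emit_emit) auto
      qed
    qed (use b(1) att2 in simp)
    ultimately show ?thesis
      using bead_equiv_sym bead_equiv_trans by blast
  qed
  then show "mod_eq n (length L) (dgm (lattach n L \<chi> ?D)) (dgm (lattach n L \<chi> ?D') :: bdiag \<Rightarrow>\<^sub>0 'k)"
    using b(1) by (rule bead_equiv_mod_eq)
qed


subsection \<open>Isomorphisms\<close>

definition rename_point :: "(nat \<Rightarrow> nat) \<Rightarrow> point \<Rightarrow> point" where
  "rename_point f = (\<lambda>x. case x of Bead w \<Rightarrow> Bead w | Leg h \<Rightarrow> Leg (f h))"

lemma rename_point_simps [simp]: "rename_point f (Leg h) = Leg (f h)" "rename_point f (Bead w) = Bead w"
  by (simp_all add: rename_point_def)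

lemma rename_eq: "rename f D = BDiag (map (map (rename_point f)) (arcs D))
    (image_mset (\<lambda>(a, b, c). (f a, f b, f c)) (tris D)) (image_mset (\<lambda>(s, ws, t). (f s, ws, f t)) (edges D))"
  by (simp add: rename_def rename_point_def)

lemma keep_rename: "keep \<chi> l (map (rename_point f) p) = map (rename_point f) (keep (\<chi> \<circ> f) l p)"
proof (induction p)
  case (Cons x p)
  then show ?case by (cases x) auto
qed simp

lemma orient_rename: "orient n e (map (rename_point f) p) = map (rename_point f) (orient n e p)"
proof -
  have "invert n (rename_point f x) = rename_point f (invert n x)" for x
    by (cases x) auto
  then show ?thesis by (simp add: orient_def rev_map comp_def)
qed

lemma lattach_rename:
  assumes "copying (length (arcs D)) L"
  shows "lattach n L \<chi> (rename f D) = rename f (lattach n L (\<chi> \<circ> f) D)"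
proof -
  have "lcopy n (map (map (rename_point f)) (arcs D)) \<chi> x = map (rename_point f) (lcopy n (arcs D) (\<chi> \<circ> f) x)"
    if "x \<in> set (concat L)" for x
  proof -
    obtain l p e where x: "x = (l, p, e)" by (cases x) auto
    then have "p < length (arcs D)" using that copying_less[OF assms] by metis
    then show ?thesis by (simp add: x lcopy_def keep_rename orient_rename)
  qed
  then have "concat (map (lcopy n (map (map (rename_point f)) (arcs D)) \<chi>) xs)
      = map (rename_point f) (concat (map (lcopy n (arcs D) (\<chi> \<circ> f)) xs))" if "set xs \<subseteq> set (concat L)" for xs
    using that by (induction xs) auto
  then show ?thesis
    by (auto simp: rename_eq lattach_def)
qed

lemma Leg_map_rename: "Leg h \<in> set (map (rename_point f) p) \<longleftrightarrow> (\<exists>h'. Leg h' \<in> set p \<and> h = f h')"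
  by (induction p) (auto simp: rename_point_def split: point.splits)

lemma legs_rename: "legs (rename f D) = f ` legs D"
proof -
  have "legs (rename f D) = {h. \<exists>p < length (arcs D). Leg h \<in> set (map (rename_point f) (arcs D ! p))}"
    unfolding legs_eq[of "rename f D"] by (auto simp: rename_eq)
  then show ?thesis
    unfolding Leg_map_rename legs_eq[of D] by blast
qed

lemma legs_subset_halves: "legs D \<subseteq> halves D"
  by (auto simp: vertex_halves_def)

text \<open>
  A renaming acts on attachments by precomposition.
\<close>

lemma lact_rename:
  assumes D: "beaded_diagram n m D" "beaded_diagram n m (rename f D)" and L: "copying m L" and inj: "inj_on f (halves D)"
  shows "mod_eq n (length L) (lact n L D) (lact n L (rename f D) :: bdiag \<Rightarrow>\<^sub>0 'k::field)"
proof -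
  have injl: "inj_on f (legs D)" using inj legs_subset_halves by (rule inj_on_subset)
  have L': "copying (length (arcs D)) L" using L beaded_diagram_length[OF D(1)] by simp
  let ?g = "inv_into (legs D) f"
  have g: "?g (f h) = h" if "h \<in> legs D" for h
    using inv_into_f_f[OF injl that] .
  have pl: "places L (rename f D) (f h) = places L D h" if h: "h \<in> legs D" for h
  proof -
    have "p < length (arcs (rename f D)) \<and> Leg (f h) \<in> set (arcs (rename f D) ! p) \<longleftrightarrow>
      p < length (arcs D) \<and> Leg h \<in> set (arcs D ! p)" for p
    proof -
      have "Leg (f h) \<in> set (map (rename_point f) (arcs D ! p)) \<longleftrightarrow> Leg h \<in> set (arcs D ! p)" if p: "p < length (arcs D)"
        unfolding Leg_map_rename using inj_onD[OF injl _ h Leg_in_legs[OF p]] by metis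
      then show ?thesis by (auto simp: rename_eq)
    qed
    then show ?thesis by (simp add: places_def)
  qed
  let ?j = "\<lambda>\<chi>. restrict (\<chi> \<circ> ?g) (f ` legs D)"
  have j: "?j \<chi> \<in> lattachments L (rename f D)" if "\<chi> \<in> lattachments L D" for \<chi>
    using that pl g unfolding lattachments_def legs_rename by fastforce
  have sum: "(lact n L (rename f D) :: bdiag \<Rightarrow>\<^sub>0 'k) = (\<Sum>\<chi>\<in>lattachments L D.
      scale (\<Prod>h\<in>legs D. lsign L (\<chi> h)) (dgm (lattach n L (?j \<chi>) (rename f D))))"
    unfolding lact_def
  proof (rule sum.reindex_bij_witness[where j = "\<lambda>\<chi>. restrict (\<chi> \<circ> f) (legs D)" and i = ?j])
    fix \<chi> assume \<chi>: "\<chi> \<in> lattachments L (rename f D)"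
    show "?j (restrict (\<chi> \<circ> f) (legs D)) = \<chi>"
    proof (rule extensionalityI[where A = "f ` legs D"])
      fix h assume "h \<in> f ` legs D"
      then show "?j (restrict (\<chi> \<circ> f) (legs D)) h = \<chi> h" using g by auto
    qed (use \<chi> in \<open>auto simp: lattachments_def legs_rename PiE_def\<close>)
    then show "scale (\<Prod>h\<in>legs D. lsign L (restrict (\<chi> \<circ> f) (legs D) h)) (dgm (lattach n L (?j (restrict (\<chi> \<circ> f) (legs D))) (rename f D)))
      = scale (\<Prod>h\<in>legs (rename f D). lsign L (\<chi> h)) (dgm (lattach n L \<chi> (rename f D)))"
      unfolding legs_rename prod.reindex[OF injl] by simp
    show "restrict (\<chi> \<circ> f) (legs D) \<in> lattachments L D"
      using \<chi> pl unfolding lattachments_def legs_rename by fastforce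
  next
    fix \<chi> assume \<chi>: "\<chi> \<in> lattachments L D"
    show "restrict (?j \<chi> \<circ> f) (legs D) = \<chi>"
    proof (rule extensionalityI[where A = "legs D"])
      fix h assume "h \<in> legs D"
      then show "restrict (?j \<chi> \<circ> f) (legs D) h = \<chi> h" using g by auto
    qed (use \<chi> in \<open>auto simp: lattachments_def PiE_def\<close>)
    show "?j \<chi> \<in> lattachments L (rename f D)" using j[OF \<chi>] .
  qed
  have "mod_eq n (length L) (dgm (lattach n L \<chi> D)) (dgm (lattach n L (?j \<chi>) (rename f D)) :: bdiag \<Rightarrow>\<^sub>0 'k)"
    if \<chi>: "\<chi> \<in> lattachments L D" for \<chi>
  proof -
    have eq: "lattach n L (?j \<chi>) (rename f D) = rename f (lattach n L \<chi> D)"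
      unfolding lattach_rename[OF L'] using g by (intro arg_cong[of _ _ "rename f"] lattach_cong[OF L']) simp
    have "halves (lattach n L \<chi> D) = halves D"
      using lattach_legs_mset[OF D(1) L \<chi>] by (simp add: vertex_halves_def) (simp add: lattach_def)
    then have "bead_move n (lattach n L \<chi> D) (rename f (lattach n L \<chi> D))"
      using inj by (intro bead_move.isomorphism) simp
    moreover have "beaded_diagram n (length L) (rename f (lattach n L \<chi> D))"
      using lattach_beaded[OF D(2) L j[OF \<chi>]] unfolding eq .
    ultimately show ?thesis
      unfolding eq using lattach_beaded[OF D(1) L \<chi>] by (intro bead_equiv_mod_eq bead_equiv_step)
  qed
  then show ?thesis
    unfolding sum unfolding lact_def by (intro mod_eq_sum mod_eq_scale)
qed

lemma lact_bead_move:
  assumes move: "bead_move n D D'" and D: "beaded_diagram n m D" "beaded_diagram n m D'" and L: "copying m L"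
  shows "mod_eq n (length L) (lact n L D) (lact n L D' :: bdiag \<Rightarrow>\<^sub>0 'k::field)"
  using move D
proof cases
  case (isomorphism f)
  then show ?thesis using lact_rename[OF _ _ L] D by auto
next
  case (cyclic A a b c V E)
  show ?thesis
    using D unfolding cyclic by (intro lact_same_arcs[OF _ _ L] bead_move.cyclic)
next
  case (merge_arc A p w x q B V E)
  have "beads_in n (p @ Bead w # Bead x # q)"
    using D(1) by (rule beaded_diagram_beads_in) (simp add: merge_arc)
  then have "arc_eq n (p @ [Bead w, Bead x] @ q) (p @ [Bead (w \<otimes>\<^bsub>free_group n\<^esub> x)] @ q)"
    by (intro arc_eq.arc_append arc_eq.arc_refl arc_eq.arc_merge) auto
  then have "list_all2 (arc_eq n) (A @ (p @ Bead w # Bead x # q) # B) (A @ (p @ Bead (w \<otimes>\<^bsub>free_group n\<^esub> x) # q) # B)"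
    by (intro list_all2_appendI list.rel_intros) (auto simp: list_all2_same)
  with D(1) show ?thesis unfolding merge_arc by (intro lact_arc_eq[OF _ L])
next
  case (merge_edge A V s us w x vs t E)
  show ?thesis
    using D unfolding merge_edge by (intro lact_same_arcs[OF _ _ L] bead_move.merge_edge)
next
  case (unit_arc A p q B V E)
  have "arc_eq n (p @ [Bead \<one>\<^bsub>free_group n\<^esub>] @ q) (p @ [] @ q)"
    by (intro arc_eq.arc_append arc_eq.arc_refl arc_eq.arc_unit)
  then have "list_all2 (arc_eq n) (A @ (p @ Bead \<one>\<^bsub>free_group n\<^esub> # q) # B) (A @ (p @ q) # B)"
    by (intro list_all2_appendI list.rel_intros) (auto simp: list_all2_same)
  with D(1) show ?thesis unfolding unit_arc by (intro lact_arc_eq[OF _ L])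
next
  case (unit_edge A V s us vs t E)
  show ?thesis
    using D unfolding unit_edge by (intro lact_same_arcs[OF _ _ L] bead_move.unit_edge)
next
  case (reverse A V s w t E)
  show ?thesis
    using D unfolding reverse by (intro lact_same_arcs[OF _ _ L] bead_move.reverse)
next
  case (slide_univalent A p w v q B V E)
  show ?thesis
    using D unfolding slide_univalent by (intro lact_slide_univalent[OF _ _ L])
next
  case (slide_trivalent A a b c V s us w E)
  show ?thesis
    using D unfolding slide_trivalent by (intro lact_same_arcs[OF _ _ L] bead_move.slide_trivalent)
qed

lemma lact_bead_equiv:
  assumes "(D, D') \<in> bead_equiv n m" "beaded_diagram n m D" "copying m L"
  shows "mod_eq n (length L) (lact n L D) (lact n L D' :: bdiag \<Rightarrow>\<^sub>0 'k::field)"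
  using assms(1,2)
  by (induction rule: bead_equiv_induct) (auto intro: lact_bead_move assms(3) mod_eq_sym mod_eq_trans)


subsection \<open>The STU relation\<close>

lemma sum_PiE_insert:
  assumes "x \<notin> S"
  shows "(\<Sum>f\<in>Pi\<^sub>E (insert x S) T. F f) = (\<Sum>y\<in>T x. \<Sum>f\<in>Pi\<^sub>E S T. F (f(x := y)))"
  unfolding PiE_insert_eq sum.reindex[OF inj_combinator[OF assms]]
  by (simp add: sum.cartesian_product split_def comp_def)

lemma Leg_nth_only:
  assumes "\<forall>ys \<in> set A \<union> set B. Leg a \<notin> set ys" "Leg a \<in> set y"
  shows "j < length (A @ y # B) \<and> Leg a \<in> set ((A @ y # B) ! j) \<longleftrightarrow> j = length A"
proof
  assume j: "j < length (A @ y # B) \<and> Leg a \<in> set ((A @ y # B) ! j)"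
  show "j = length A"
  proof (rule ccontr)
    assume "j \<noteq> length A"
    then have "(A @ y # B) ! j \<in> set A \<union> set B"
      using j by (auto simp: nth_append nth_Cons split: nat.splits)
    then show False using assms(1) j by blast
  qed
qed (use assms(2) in simp)

lemma places_nth_only:
  assumes "\<forall>ys \<in> set A \<union> set B. Leg a \<notin> set ys" "Leg a \<in> set y"
  shows "places L (BDiag (A @ y # B) V E) a = {l. \<exists>e. (l, length A, e) \<in> set (concat L)}"
  unfolding places_def bdiag.sel Leg_nth_only[OF assms] by blast

lemma finite_places: "finite (places L D h)"
proof -
  have "places L D h \<subseteq> fst ` set (concat L)" by (force simp: places_def)
  then show ?thesis using finite_surj[of "set (concat L)"] by auto
qed

lemma stuI: "stu (BDiag (A @ (p @ Leg h # q) # B) (add_mset (x, b, a) V) (add_mset (h, [], x) E))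
    (BDiag (A @ (p @ Leg a # Leg b # q) # B) V E) (BDiag (A @ (p @ Leg b # Leg a # q) # B) V E)"
  unfolding stu_def by blast

text \<open>
  If \<open>a\<close> and \<open>b\<close> are attached to different copies, their order on the old arc is lost and the two
  terms on the right cancel.  The attachments of both to one copy correspond to the attachments of \<open>h\<close> to
  it; on a reversed copy \<open>a\<close> and \<open>b\<close> change places, which makes up for the sign of \<open>h\<close>, while the
  signs of \<open>a\<close> and \<open>b\<close> cancel each other.
\<close>

lemma lact_stu:
  fixes p q :: "point list" and a b h x :: nat
  defines "D \<equiv> \<lambda>A B V E. BDiag (A @ (p @ Leg h # q) # B) (add_mset (x, b, a) V) (add_mset (h, [], x) E)"
    and "D1 \<equiv> \<lambda>A B V E. BDiag (A @ (p @ Leg a # Leg b # q) # B) V E"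
    and "D2 \<equiv> \<lambda>A B V E. BDiag (A @ (p @ Leg b # Leg a # q) # B) V E"
  assumes D: "beaded_diagram n m (D A B V E)" and L: "copying m L"
  shows "mod_eq n (length L) (lact n L (D A B V E)) (lact n L (D1 A B V E) - lact n L (D2 A B V E) :: bdiag \<Rightarrow>\<^sub>0 'k::field)"
proof -
  let ?i = "length A"
  let ?AD = "A @ (p @ Leg h # q) # B" and ?A1 = "A @ (p @ Leg a # Leg b # q) # B" and ?A2 = "A @ (p @ Leg b # Leg a # q) # B"
  define R where "R = set (leg_seq (concat A)) \<union> set (leg_seq p) \<union> set (leg_seq q) \<union> set (leg_seq (concat B))"
  have cnt: "count (vertex_halves (D A B V E)) y \<le> 1" for y
    using D unfolding beaded_diagram_def by blast
  have VH: "vertex_halves (D A B V E) = mset (leg_seq (concat ?AD)) + {#x, b, a#} + (\<Sum>(a, b, c) \<in># V. {#a, b, c#})"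
    by (simp add: D_def vertex_halves_BDiag)
  have fresh: "h \<notin> R" "a \<notin> R" "b \<notin> R" "a \<noteq> b"
  proof -
    have notleg: "y \<notin> set (leg_seq (concat ?AD))" if "y \<in># {#x, b, a#}" for y
    proof
      assume "y \<in> set (leg_seq (concat ?AD))"
      then have "count (mset (leg_seq (concat ?AD))) y \<ge> 1"
        by (simp only: Suc_le_eq One_nat_def count_greater_zero_iff set_mset_mset)
      moreover have "count {#x, b, a#} y \<ge> 1"
        using that by (simp only: Suc_le_eq One_nat_def count_greater_zero_iff)
      ultimately show False using cnt[of y] unfolding VH count_union by linarith
    qed
    have "R \<subseteq> set (leg_seq (concat ?AD))" by (auto simp: R_def)
    then show "a \<notin> R" "b \<notin> R" using notleg by auto
    show "a \<noteq> b" using cnt[of a] unfolding VH by (auto split: if_splits)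
    show "h \<notin> R" using distinct_leg_seq[OF D] by (auto simp: R_def D_def)
  qed
  have legsD: "legs (D A B V E) = insert h R" and legs1: "legs (D1 A B V E) = insert a (insert b R)"
    and legs2: "legs (D2 A B V E) = insert a (insert b R)"
    by (auto simp: D_def D1_def D2_def legs_mset_BDiag R_def)
  define Pl where "Pl = {l. \<exists>e. (l, ?i, e) \<in> set (concat L)}"
  have only: "\<forall>ys \<in> set A \<union> set B. Leg y \<notin> set ys" if "y \<notin> R" for y
    using that by (auto simp: R_def)
  have plD: "places L (D A B V E) h = Pl"
    unfolding D_def Pl_def by (rule places_nth_only[OF only[OF fresh(1)]]) simp
  have pla: "places L (D1 A B V E) y = Pl" "places L (D2 A B V E) y = Pl" if "y \<in> {a, b}" for y
    unfolding D1_def D2_def Pl_def using that fresh by (auto intro!: places_nth_only only simp del: set_concat)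
  define T where "T = places L (D A B V E)"
  have plR: "places L (D1 A B V E) r = T r" "places L (D2 A B V E) r = T r" if "r \<in> R" for r
  proof -
    have "r \<noteq> h" "r \<noteq> a" "r \<noteq> b" using that fresh by auto
    then have "Leg r \<in> set (?A1 ! j) \<longleftrightarrow> Leg r \<in> set (?AD ! j)" "Leg r \<in> set (?A2 ! j) \<longleftrightarrow> Leg r \<in> set (?AD ! j)" for j
      by (auto simp: nth_append nth_Cons split: nat.splits)
    then show "places L (D1 A B V E) r = T r" "places L (D2 A B V E) r = T r"
      unfolding places_def T_def D_def D1_def D2_def by auto
  qed
  define PR where "PR = Pi\<^sub>E R T"
  define c where "c = (\<lambda>\<chi>. \<Prod>r\<in>R. lsign L (\<chi> r) :: 'k)"
  have finR: "finite R" unfolding R_def by (intro finite_UnI finite_set)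
  let ?sg = "lsign L :: _ \<Rightarrow> 'k"
  have c_upd: "c (\<chi>(y := l)) = c \<chi>" if "y \<notin> R" for \<chi> y l
    unfolding c_def using that by (intro prod.cong) auto
  have sD: "(lact n L (D A B V E) :: bdiag \<Rightarrow>\<^sub>0 'k) = (\<Sum>l\<in>Pl. \<Sum>\<chi>\<in>PR.
      scale (?sg l * c \<chi>) (dgm (lattach n L (\<chi>(h := l)) (D A B V E))))"
  proof -
    have pr: "(\<Prod>y\<in>insert h R. ?sg (\<chi> y)) = ?sg (\<chi> h) * c \<chi>" for \<chi>
      using finR fresh(1) by (simp add: c_def)
    show ?thesis
      unfolding lact_def lattachments_def legsD sum_PiE_insert[OF fresh(1)] plD PR_def T_def pr
      by (simp add: c_upd fresh)
  qed
  have s12: "(lact n L D' :: bdiag \<Rightarrow>\<^sub>0 'k) = (\<Sum>l\<in>Pl. \<Sum>l'\<in>Pl. \<Sum>\<chi>\<in>PR.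
      scale (?sg l * ?sg l' * c \<chi>) (dgm (lattach n L (\<chi>(b := l', a := l)) D')))"
    if D': "D' = D1 A B V E \<or> D' = D2 A B V E" for D'
  proof -
    have legs': "legs D' = insert a (insert b R)" using D' legs1 legs2 by auto
    have la: "lattachments L D' = Pi\<^sub>E (insert a (insert b R)) (T(a := Pl, b := Pl))"
      unfolding lattachments_def legs'
    proof (rule PiE_cong)
      fix y assume "y \<in> insert a (insert b R)"
      then show "places L D' y = (T(a := Pl, b := Pl)) y"
        using D' pla[of y] plR[of y] fresh by auto
    qed
    have ab: "a \<notin> insert b R" using fresh by simp
    have pr: "(\<Prod>y\<in>insert a (insert b R). ?sg (\<chi> y)) = ?sg (\<chi> a) * ?sg (\<chi> b) * c \<chi>" for \<chi>
      using finR fresh by (simp add: c_def)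
    have PR: "Pi\<^sub>E R (T(a := Pl, b := Pl)) = PR"
      unfolding PR_def using fresh by (intro PiE_cong) auto
    show ?thesis
      unfolding lact_def la sum_PiE_insert[OF ab] sum_PiE_insert[OF fresh(3)] legs' pr PR
      using fresh by (simp add: c_upd)
  qed
  define G where "G = (\<lambda>\<chi> l l'. dgm (lattach n L (\<chi>(b := l', a := l)) (D1 A B V E)) - dgm (lattach n L (\<chi>(b := l', a := l)) (D2 A B V E)) :: bdiag \<Rightarrow>\<^sub>0 'k)"
  have G0: "G \<chi> l l' = 0" if "l \<noteq> l'" for \<chi> l l'
  proof -
    have "lcopy n ?A1 (\<chi>(b := l', a := l)) y = lcopy n ?A2 (\<chi>(b := l', a := l)) y" for y
      using that fresh by (cases y) (auto simp: lcopy_def nth_append nth_Cons split: nat.splits)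
    then have "lcopy n ?A1 (\<chi>(b := l', a := l)) = lcopy n ?A2 (\<chi>(b := l', a := l))"
      by (rule ext)
    then show ?thesis
      unfolding G_def D1_def D2_def lattach_BDiag by simp
  qed
  have "lact n L (D1 A B V E) - lact n L (D2 A B V E) = (\<Sum>l\<in>Pl. \<Sum>l'\<in>Pl. \<Sum>\<chi>\<in>PR. scale (?sg l * ?sg l' * c \<chi>) (G \<chi> l l'))"
    by (simp add: s12 G_def diagrams.scale_right_diff_distrib sum_subtractf)
  also have "\<dots> = (\<Sum>l\<in>Pl. \<Sum>l'\<in>Pl. if l' = l then \<Sum>\<chi>\<in>PR. scale (?sg l * ?sg l * c \<chi>) (G \<chi> l l) else 0)"
    using G0 by (intro sum.cong refl) auto
  also have "\<dots> = (\<Sum>l\<in>Pl. \<Sum>\<chi>\<in>PR. scale (?sg l * ?sg l * c \<chi>) (G \<chi> l l))"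
    using finite_places[of L "D A B V E" h] by (intro sum.cong refl) (simp add: plD)
  finally have diff: "lact n L (D1 A B V E) - lact n L (D2 A B V E) = (\<Sum>l\<in>Pl. \<Sum>\<chi>\<in>PR. scale (?sg l * ?sg l * c \<chi>) (G \<chi> l l))" .
  have "mod_eq n (length L) (scale (?sg l * c \<chi>) (dgm (lattach n L (\<chi>(h := l)) (D A B V E)))) (scale (?sg l * ?sg l * c \<chi>) (G \<chi> l l))"
    if l: "l \<in> Pl" and \<chi>: "\<chi> \<in> PR" for l \<chi>
  proof -
    let ?\<chi> = "\<chi>(h := l)" and ?\<chi>' = "\<chi>(b := l, a := l)"
    obtain e where e: "(l, ?i, e) \<in> set (concat L)" using l by (auto simp: Pl_def)
    obtain X P Q Y where X: "\<forall>F :: _ \<Rightarrow> point list. map (\<lambda>xs. concat (map F xs)) L = X F @ (P F @ F (l, ?i, e) @ Q F) # Y F"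
      and XX: "\<forall>F F'. (\<forall>x \<in> set (concat L). fst x \<noteq> l \<longrightarrow> F x = F' x) \<longrightarrow> X F = X F' \<and> P F = P F' \<and> Q F = Q F' \<and> Y F = Y F'"
      using lattach_context[OF L e] by (elim exE conjE) (rule that)
    let ?F = "lcopy n ?AD ?\<chi>" and ?F1 = "lcopy n ?A1 ?\<chi>'" and ?F2 = "lcopy n ?A2 ?\<chi>'"
    have kp: "keep ?\<chi>' l' ys = keep ?\<chi> l' ys" if "set (leg_seq ys) \<subseteq> R" for ys l'
      using that fresh by (intro keep_cong) auto
    have Rs: "set (leg_seq p) \<subseteq> R" "set (leg_seq q) \<subseteq> R" "ys \<in> set A \<union> set B \<Longrightarrow> set (leg_seq ys) \<subseteq> R" for ys
      by (auto simp: R_def)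
    have len: "length A + length B < m"
      using beaded_diagram_length[OF D] by (simp add: D_def)
    have same: "?F1 y = ?F y \<and> ?F2 y = ?F y" if y: "y \<in> set (concat L)" "fst y \<noteq> l" for y
    proof -
      obtain l' j f where y': "y = (l', j, f)" by (cases y) auto
      have l': "l' \<noteq> l" using y y' by simp
      have "j < m" using copying_less[OF L] y y' by metis
      then have j: "j < length ?AD" using beaded_diagram_length[OF D] by (simp add: D_def)
      have "keep ?\<chi>' l' (?A1 ! j) = keep ?\<chi> l' (?AD ! j) \<and> keep ?\<chi>' l' (?A2 ! j) = keep ?\<chi> l' (?AD ! j)"
      proof (cases "j = ?i")
        case True
        then show ?thesis using l' fresh kp[OF Rs(1)] kp[OF Rs(2)] by (auto simp: nth_append)
      next
        case False
        then have "?AD ! j \<in> set A \<union> set B" "?A1 ! j = ?AD ! j" "?A2 ! j = ?AD ! j"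
          using j by (auto simp: nth_append nth_Cons split: nat.splits)
        then show ?thesis using kp[OF Rs(3)] by metis
      qed
      then show ?thesis by (simp add: y' lcopy_def)
    qed
    have XF1: "X ?F1 = X ?F" "P ?F1 = P ?F" "Q ?F1 = Q ?F" "Y ?F1 = Y ?F"
      using XX[rule_format, of ?F1 ?F] same by auto
    have XF2: "X ?F2 = X ?F" "P ?F2 = P ?F" "Q ?F2 = Q ?F" "Y ?F2 = Y ?F"
      using XX[rule_format, of ?F2 ?F] same by auto
    let ?p = "keep ?\<chi> l p" and ?q = "keep ?\<chi> l q"
    have att: "lattach n L ?\<chi> (D A B V E) = BDiag (X ?F @ (P ?F @ orient n e (?p @ Leg h # ?q) @ Q ?F) # Y ?F) (add_mset (x, b, a) V) (add_mset (h, [], x) E)"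
      unfolding D_def lattach_BDiag X[rule_format] by (simp add: lcopy_def)
    have att1: "lattach n L ?\<chi>' (D1 A B V E) = BDiag (X ?F @ (P ?F @ orient n e (?p @ Leg a # Leg b # ?q) @ Q ?F) # Y ?F) V E"
      unfolding D1_def lattach_BDiag X[rule_format] XF1 using kp[OF Rs(1)] kp[OF Rs(2)] by (simp add: lcopy_def)
    have att2: "lattach n L ?\<chi>' (D2 A B V E) = BDiag (X ?F @ (P ?F @ orient n e (?p @ Leg b # Leg a # ?q) @ Q ?F) # Y ?F) V E"
      unfolding D2_def lattach_BDiag X[rule_format] XF2 using kp[OF Rs(1)] kp[OF Rs(2)] by (simp add: lcopy_def)
    have "?\<chi> \<in> lattachments L (D A B V E)"
      using \<chi> l unfolding lattachments_def legsD PR_def T_def by (intro PiE_fun_upd) (simp_all add: plD)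
    then have b: "beaded_diagram n (length L) (lattach n L ?\<chi> (D A B V E))"
      by (rule lattach_beaded[OF D L])
    have sgl: "?sg l = (if e then 1 else - 1)" by (rule lsign_eq[OF L e])
    have key: "mod_eq n (length L) (scale (?sg l) (dgm (lattach n L ?\<chi> (D A B V E)))) (G \<chi> l l)"
    proof (cases e)
      case True
      then have "stu (lattach n L ?\<chi> (D A B V E)) (lattach n L ?\<chi>' (D1 A B V E)) (lattach n L ?\<chi>' (D2 A B V E))"
        using stuI[of "X ?F" "P ?F @ ?p" h "?q @ Q ?F" "Y ?F" x b a V E] by (simp add: att att1 att2)
      then show ?thesis
        using stu_mod_eq b True sgl by (auto simp: G_def)
    next
      case False
      then have "stu (lattach n L ?\<chi> (D A B V E)) (lattach n L ?\<chi>' (D2 A B V E)) (lattach n L ?\<chi>' (D1 A B V E))"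
        using stuI[of "X ?F" "P ?F @ orient n False ?q" h "orient n False ?p @ Q ?F" "Y ?F" x b a V E]
        by (simp add: att att1 att2)
      then have "mod_eq n (length L) (scale (- 1) (dgm (lattach n L ?\<chi> (D A B V E)))) (scale (- 1 :: 'k) (- G \<chi> l l))"
        using stu_mod_eq b by (intro mod_eq_scale) (auto simp: G_def)
      then show ?thesis
        using False sgl by simp
    qed
    have "mod_eq n (length L) (scale (c \<chi>) (scale (?sg l) (dgm (lattach n L ?\<chi> (D A B V E))))) (scale (c \<chi>) (G \<chi> l l))"
      using key by (rule mod_eq_scale)
    moreover have "?sg l * ?sg l = 1" using sgl by auto
    ultimately show ?thesis by (simp add: mult.commute)
  qed
  then show ?thesis
    unfolding sD diff by (intro mod_eq_sum)
qed

lemma lact_relations: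
  assumes u: "u \<in> relations n m" and L: "copying m L"
  shows "linear_ext scale (lact n L) u \<in> (relations n (length L) :: (bdiag \<Rightarrow>\<^sub>0 'k::field) set)"
  using u unfolding relations_def[of n m]
proof (rule linear_ext_span[OF vector_space_scale _ _ relations_subspace])
  note le = linear_ext_diff[OF vector_space_scale] linear_ext_dgm[OF vector_space_scale]
  fix u :: "bdiag \<Rightarrow>\<^sub>0 'k"
  assume "u \<in> {dgm D - dgm D' | D D'. beaded_diagram n m D \<and> (D, D') \<in> bead_equiv n m} \<union>
     {dgm D - (dgm D1 - dgm D2) | D D1 D2. beaded_diagram n m D \<and> stu D D1 D2}"
  then consider D D' where "u = dgm D - dgm D'" "beaded_diagram n m D" "(D, D') \<in> bead_equiv n m"
    | D D1 D2 where "u = dgm D - (dgm D1 - dgm D2)" "beaded_diagram n m D" "stu D D1 D2"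
    by blast
  then show "linear_ext scale (lact n L) u \<in> relations n (length L)"
  proof cases
    case 1
    then show ?thesis using lact_bead_equiv[OF _ _ L] by (simp add: le mod_eq_def)
  next
    case 2
    then have "mod_eq n (length L) (lact n L D) (lact n L D1 - lact n L D2 :: bdiag \<Rightarrow>\<^sub>0 'k)"
      using lact_stu[OF _ L] unfolding stu_def by blast
    then show ?thesis using 2 by (simp add: le mod_eq_def)
  qed
qed


section \<open>Invariance under free reduction\<close>

text \<open>
  The attachments that use one of the two adjacent copies with opposite orientations are paired off by
  moving one leg to the other copy; as the pairing is an involution that reverses signs, twice their sum is
  a relation.
\<close>

lemma lact_cancel:
  fixes l1 l2 :: 'l
  assumes D: "beaded_diagram n m D" and L: "copying m (LA @ (u @ (l1, i, e) # (l2, i, \<not> e) # v) # LB)"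
  shows "mod_eq n (length (LA @ (u @ v) # LB)) (lact n (LA @ (u @ (l1, i, e) # (l2, i, \<not> e) # v) # LB) D)
    (lact n (LA @ (u @ v) # LB) D :: bdiag \<Rightarrow>\<^sub>0 'k::field_char_0)"
proof -
  let ?L = "LA @ (u @ (l1, i, e) # (l2, i, \<not> e) # v) # LB" and ?L' = "LA @ (u @ v) # LB"
  let ?A = "arcs D"
  define Q where "Q = orient n e (?A ! i)"
  have setL: "set (concat ?L) = insert (l1, i, e) (insert (l2, i, \<not> e) (set (concat ?L')))"
    by auto
  have "distinct (map fst (concat ?L))" using L unfolding copying_def by (rule conjunct1)
  moreover have "map fst (concat ?L) = map fst (concat LA) @ map fst u @ l1 # l2 # map fst v @ map fst (concat LB)"
    by simp
  ultimately have dist: "distinct (map fst (concat LA) @ map fst u @ l1 # l2 # map fst v @ map fst (concat LB))"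
    by metis
  then have l12: "l1 \<noteq> l2" "l1 \<notin> fst ` set (concat ?L')" "l2 \<notin> fst ` set (concat ?L')"
    unfolding distinct_append distinct.simps by (auto simp: image_Un)
  have nolab: "(l, p, f) \<notin> set (concat ?L')" if "l \<in> {l1, l2}" for l p f
  proof
    assume "(l, p, f) \<in> set (concat ?L')"
    then have "fst (l, p, f) \<in> fst ` set (concat ?L')" by (rule imageI)
    then show False using that l12 by (auto simp del: set_concat)
  qed
  have i: "i < m" using copying_less[OF L, of l1 i e] by simp
  have len: "length ?A = m" using D by (rule beaded_diagram_length)
  have Ai: "beads_in n (?A ! i)"
    using beaded_diagram_beads_in[OF D] i len by simp
  have Q: "beads_in n Q" by (simp add: Q_def beads_in_orient Ai)
  have setQ: "Leg h \<in> set Q \<longleftrightarrow> Leg h \<in> set (?A ! i)" for h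
  proof -
    have "set (leg_seq Q) = set (leg_seq (?A ! i))" by (simp add: Q_def del: set_leg_seq)
    then show ?thesis unfolding set_leg_seq by auto
  qed
  have distQ: "distinct (leg_seq Q)"
  proof -
    have "distinct (concat (map leg_seq ?A))"
      using distinct_leg_seq[OF D] by (simp add: leg_seq_concat)
    then have "distinct (leg_seq (?A ! i))"
      using i len by (auto simp: distinct_concat_iff)
    then show ?thesis by (simp add: Q_def)
  qed
  let ?X = "\<lambda>\<chi>. map (\<lambda>xs. concat (map (lcopy n ?A \<chi>) xs)) LA" and ?Y = "\<lambda>\<chi>. map (\<lambda>xs. concat (map (lcopy n ?A \<chi>) xs)) LB"
    and ?P = "\<lambda>\<chi>. concat (map (lcopy n ?A \<chi>) u)" and ?R = "\<lambda>\<chi>. concat (map (lcopy n ?A \<chi>) v)"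
  let ?core = "\<lambda>\<chi> c. BDiag (?X \<chi> @ (?P \<chi> @ c @ ?R \<chi>) # ?Y \<chi>) (tris D) (edges D)"
  have att: "lattach n ?L \<chi> D = ?core \<chi> (keep \<chi> l1 Q @ orient n False (keep \<chi> l2 Q))" for \<chi>
    using Ai by (simp add: lattach_def lcopy_def[of n ?A \<chi>] Q_def keep_orient orient_orient)
  have att': "lattach n ?L' \<chi> D = ?core \<chi> []" for \<chi>
    by (simp add: lattach_def)
  have core: "mod_eq n (length ?L') (dgm (lattach n ?L \<chi> D)) (dgm (?core \<chi> c) :: bdiag \<Rightarrow>\<^sub>0 'k)"
    if "\<chi> \<in> lattachments ?L D" "arc_eq n (keep \<chi> l1 Q @ orient n False (keep \<chi> l2 Q)) c" for \<chi> c
  proof -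
    have "beaded_diagram n (length ?L') (lattach n ?L \<chi> D)"
      using lattach_beaded[OF D L that(1)] by simp
    moreover have "arc_eq n (?P \<chi> @ (keep \<chi> l1 Q @ orient n False (keep \<chi> l2 Q)) @ ?R \<chi>) (?P \<chi> @ c @ ?R \<chi>)"
      using that(2) by (intro arc_eq.arc_append arc_eq.arc_refl)
    ultimately show ?thesis
      unfolding att by (intro arc_eq_mod_eq list_all2_appendI list.rel_intros) (auto simp: list_all2_same)
  qed
  have pl': "places ?L' D h = places ?L D h - {l1, l2}" for h
    using nolab unfolding places_def setL by blast
  have pl: "Leg h \<in> set Q" if l: "l \<in> {l1, l2}" "l \<in> places ?L D h" for l h
  proof -
    obtain p f where p: "(l, p, f) \<in> set (concat ?L)" "Leg h \<in> set (?A ! p)"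
      using l(2) unfolding places_def by blast
    then have "p = i"
      using l(1) nolab unfolding setL by blast
    then show ?thesis using p setQ by simp
  qed
  have plQ: "{l1, l2} \<subseteq> places ?L D h" if "Leg h \<in> set Q" for h
    using that i unfolding places_def setL setQ len by (auto simp del: set_concat)
  have latt': "lattachments ?L' D = {\<chi> \<in> lattachments ?L D. \<forall>h \<in> legs D. \<chi> h \<notin> {l1, l2}}"
    unfolding lattachments_def pl' by (auto simp: PiE_def Pi_def)
  define S where "S = {\<chi> \<in> lattachments ?L D. \<exists>h \<in> legs D. \<chi> h \<in> {l1, l2}}"
  define F where "F = (\<lambda>\<chi>. scale (\<Prod>h\<in>legs D. lsign ?L (\<chi> h)) (dgm (lattach n ?L \<chi> D)) :: bdiag \<Rightarrow>\<^sub>0 'k)"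
  have legsQ: "h \<in> legs D" if "Leg h \<in> set Q" for h
    using that i len Leg_in_legs[of i D h] by (simp add: setQ)

  \<comment> \<open>If no leg is attached to the two copies, their beads cancel.\<close>
  have 1: "mod_eq n (length ?L') (\<Sum>\<chi>\<in>lattachments ?L' D. F \<chi>) (lact n ?L' D)"
    unfolding lact_def
  proof (rule mod_eq_sum)
    fix \<chi> assume \<chi>: "\<chi> \<in> lattachments ?L' D"
    have no: "\<chi> h \<noteq> l1" "\<chi> h \<noteq> l2" if "Leg h \<in> set Q" for h
      using \<chi> legsQ[OF that] unfolding latt' by auto
    have "keep \<chi> l1 Q = keep \<chi> l2 Q" using no by (intro keep_cong) auto
    moreover have "leg_seq (keep \<chi> l1 Q) = []" using no by (auto simp: filter_empty_conv)
    ultimately have "arc_eq n (keep \<chi> l1 Q @ orient n False (keep \<chi> l2 Q)) []"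
      using arc_eq_cancel Q by simp
    then have "mod_eq n (length ?L') (dgm (lattach n ?L \<chi> D)) (dgm (lattach n ?L' \<chi> D) :: bdiag \<Rightarrow>\<^sub>0 'k)"
      using core[of \<chi> "[]"] \<chi> unfolding latt' att' by blast
    moreover have "lsign ?L (\<chi> h) = (lsign ?L' (\<chi> h) :: 'k)" if "h \<in> legs D" for h
      using \<chi> that unfolding latt' lsign_def setL by (auto simp del: set_concat)
    ultimately show "mod_eq n (length ?L') (F \<chi>) (scale (\<Prod>h\<in>legs D. lsign ?L' (\<chi> h)) (dgm (lattach n ?L' \<chi> D)))"
      unfolding F_def by (auto intro!: mod_eq_scale cong: prod.cong)
  qed

  \<comment> \<open>\<open>top\<close> picks, among the legs on the two copies, the one nearest to the place where the copies meet.
    Moving it from one copy to the other moves it across beads with product \<open>1\<close> only, and changes the sign.\<close>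
  define top where "top \<chi> = last (filter (\<lambda>h. \<chi> h \<in> {l1, l2}) (leg_seq Q))" for \<chi>
  define flip where "flip \<chi> = \<chi>(top \<chi> := if \<chi> (top \<chi>) = l1 then l2 else l1)" for \<chi>
  have top: "Leg (top \<chi>) \<in> set Q \<and> \<chi> (top \<chi>) \<in> {l1, l2}" if \<chi>: "\<chi> \<in> S" for \<chi>
  proof -
    obtain h where "h \<in> legs D" "\<chi> h \<in> {l1, l2}" "\<chi> \<in> lattachments ?L D"
      using \<chi> by (auto simp: S_def)
    then have "\<chi> h \<in> places ?L D h" by (auto simp: lattachments_def)
    then have "Leg h \<in> set Q" using pl \<open>\<chi> h \<in> {l1, l2}\<close> by blast
    then have "filter (\<lambda>h. \<chi> h \<in> {l1, l2}) (leg_seq Q) \<noteq> []"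
      using \<open>\<chi> h \<in> {l1, l2}\<close> by (auto simp: filter_empty_conv)
    from last_in_set[OF this] show ?thesis unfolding top_def by auto
  qed
  have top_flip: "top (flip \<chi>) = top \<chi>" if "\<chi> \<in> S" for \<chi>
  proof -
    have "filter (\<lambda>h. flip \<chi> h \<in> {l1, l2}) (leg_seq Q) = filter (\<lambda>h. \<chi> h \<in> {l1, l2}) (leg_seq Q)"
      using top[OF that] by (intro filter_cong) (auto simp: flip_def)
    then show ?thesis by (simp add: top_def)
  qed
  have flip_flip: "flip (flip \<chi>) = \<chi>" if "\<chi> \<in> S" for \<chi>
    using top[OF that] top_flip[OF that] l12(1) unfolding flip_def[of "flip \<chi>"] by (auto simp: flip_def)
  have flipS: "flip \<chi> \<in> S" if "\<chi> \<in> S" for \<chi>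
  proof -
    have t: "Leg (top \<chi>) \<in> set Q" "\<chi> \<in> lattachments ?L D" using top[OF that] that by (auto simp: S_def)
    have "flip \<chi> \<in> lattachments ?L D"
      using t(2) plQ[OF t(1)] legsQ[OF t(1)] unfolding lattachments_def flip_def
      by (auto simp: PiE_def Pi_def extensional_def)
    moreover have "flip \<chi> (top \<chi>) \<in> {l1, l2}" by (simp add: flip_def)
    ultimately show ?thesis using legsQ[OF t(1)] by (auto simp: S_def)
  qed
  have flipF: "mod_eq n (length ?L') (F (flip \<chi>)) (- F \<chi>)" if \<chi>: "\<chi> \<in> S" for \<chi>
  proof -
    obtain Q1 x Q2 where Q12: "Q = Q1 @ x # Q2" and x: "\<exists>h. x = Leg h \<and> \<chi> h \<in> {l1, l2}"
      and Q2: "\<forall>z \<in> set Q2. \<not> (\<exists>h. z = Leg h \<and> \<chi> h \<in> {l1, l2})"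
      using split_list_last_prop[of Q "\<lambda>x. \<exists>h. x = Leg h \<and> \<chi> h \<in> {l1, l2}"] top[OF \<chi>] by blast
    obtain h where h: "x = Leg h" "\<chi> h \<in> {l1, l2}" using x by blast
    have "filter (\<lambda>h. \<chi> h \<in> {l1, l2}) (leg_seq Q2) = []"
      using Q2 by (auto simp: filter_empty_conv)
    then have toph: "top \<chi> = h"
      using h by (simp add: top_def Q12)
    let ?c = "keep \<chi> l1 Q1 @ [Leg h] @ orient n False (keep \<chi> l2 Q1)"
    have hQ1: "Leg h \<notin> set Q1" "Leg h \<notin> set Q2" using distQ by (auto simp: Q12 h)
    have arc: "arc_eq n (keep \<psi> l1 Q @ orient n False (keep \<psi> l2 Q)) ?c"
      if \<psi>: "\<psi> h \<in> {l1, l2}" "\<And>h'. h' \<noteq> h \<Longrightarrow> \<psi> h' = \<chi> h'" for \<psi>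
    proof -
      have Q1': "keep \<psi> l Q1 = keep \<chi> l Q1" for l
        using hQ1 \<psi>(2) by (intro keep_cong) metis
      have no: "\<psi> h' \<noteq> l1 \<and> \<psi> h' \<noteq> l2" if "Leg h' \<in> set Q2" for h'
        using Q2 that hQ1 \<psi>(2) by (metis insertCI)
      have eq: "keep \<psi> l2 Q2 = keep \<psi> l1 Q2" using no by (intro keep_cong) auto
      have "leg_seq (keep \<psi> l1 Q2) = []" using no by (auto simp: filter_empty_conv)
      then have c: "arc_eq n (keep \<psi> l1 Q2 @ orient n False (keep \<psi> l1 Q2)) []"
        using Q by (intro arc_eq_cancel) (simp_all add: Q12 h(1))
      show ?thesis
      proof (cases "\<psi> h = l1")
        case True
        have "arc_eq n (keep \<chi> l1 Q1 @ [Leg h] @ (keep \<psi> l1 Q2 @ orient n False (keep \<psi> l1 Q2)) @ orient n False (keep \<chi> l2 Q1))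
          (keep \<chi> l1 Q1 @ [Leg h] @ [] @ orient n False (keep \<chi> l2 Q1))"
          by (intro arc_eq.arc_append arc_eq.arc_refl c)
        then show ?thesis
          using True l12(1) by (simp add: Q12 h(1) Q1' eq)
      next
        case False
        then have "\<psi> h = l2" using \<psi>(1) by simp
        have "arc_eq n (keep \<chi> l1 Q1 @ (keep \<psi> l1 Q2 @ orient n False (keep \<psi> l1 Q2)) @ [Leg h] @ orient n False (keep \<chi> l2 Q1))
          (keep \<chi> l1 Q1 @ [] @ [Leg h] @ orient n False (keep \<chi> l2 Q1))"
          by (intro arc_eq.arc_append arc_eq.arc_refl c)
        then show ?thesis
          using \<open>\<psi> h = l2\<close> l12(1) by (simp add: Q12 h(1) Q1' eq)
      qed
    qed
    have "lcopy n ?A (flip \<chi>) y = lcopy n ?A \<chi> y" if "y \<in> set (concat ?L')" for y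
    proof -
      obtain l p f where y: "y = (l, p, f)" by (cases y) auto
      then have "l \<noteq> l1" "l \<noteq> l2" using that l12 by (metis fst_conv image_eqI)+
      then have "keep (flip \<chi>) l (?A ! p) = keep \<chi> l (?A ! p)"
        using top[OF \<chi>] by (intro keep_cong) (auto simp: flip_def)
      then show ?thesis by (simp add: y lcopy_def)
    qed
    then have same: "concat (map (lcopy n ?A (flip \<chi>)) ys) = concat (map (lcopy n ?A \<chi>) ys)" if "set ys \<subseteq> set (concat ?L')" for ys
      using that by (induction ys) auto
    have "?P (flip \<chi>) = ?P \<chi>" "?R (flip \<chi>) = ?R \<chi>" "?X (flip \<chi>) = ?X \<chi>" "?Y (flip \<chi>) = ?Y \<chi>"
      by (auto intro!: map_cong same)
    then have core_eq: "?core (flip \<chi>) c = ?core \<chi> c" for c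
      by simp
    have "mod_eq n (length ?L') (dgm (lattach n ?L (flip \<chi>) D)) (dgm (?core (flip \<chi>) ?c) :: bdiag \<Rightarrow>\<^sub>0 'k)"
      using flipS[OF \<chi>] by (intro core arc) (auto simp: S_def flip_def toph)
    moreover have "mod_eq n (length ?L') (dgm (lattach n ?L \<chi> D)) (dgm (?core \<chi> ?c) :: bdiag \<Rightarrow>\<^sub>0 'k)"
      using \<chi> h(2) by (intro core arc) (auto simp: S_def)
    ultimately have m: "mod_eq n (length ?L') (dgm (lattach n ?L (flip \<chi>) D)) (dgm (lattach n ?L \<chi> D) :: bdiag \<Rightarrow>\<^sub>0 'k)"
      unfolding core_eq using mod_eq_sym mod_eq_trans by blast
    have hl: "h \<in> legs D" using top[OF \<chi>] legsQ toph by simp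
    have "lsign ?L l1 = (if e then 1 else - 1 :: 'k)" "lsign ?L l2 = (if \<not> e then 1 else - 1 :: 'k)"
      using lsign_eq[OF L, of l1 i e] lsign_eq[OF L, of l2 i "\<not> e"] by simp_all
    then have sg: "lsign ?L (flip \<chi> h) = (- lsign ?L (\<chi> h) :: 'k)"
      using h(2) l12(1) by (auto simp: flip_def toph)
    have "(\<Prod>h\<in>legs D. lsign ?L (flip \<chi> h)) = (- (\<Prod>h\<in>legs D. lsign ?L (\<chi> h)) :: 'k)"
    proof -
      have "(\<Prod>h'\<in>legs D - {h}. lsign ?L (flip \<chi> h')) = (\<Prod>h'\<in>legs D - {h}. lsign ?L (\<chi> h') :: 'k)"
        by (intro prod.cong) (auto simp: flip_def toph)
      then show ?thesis
        by (simp add: prod.remove[OF _ hl] sg)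
    qed
    then show ?thesis
      using mod_eq_scale[OF m, of "- (\<Prod>h\<in>legs D. lsign ?L (\<chi> h))"] by (simp add: F_def)
  qed
  have "(\<Sum>\<chi>\<in>S. F \<chi>) = (\<Sum>\<chi>\<in>S. F (flip \<chi>))"
    by (rule sum.reindex_bij_witness[of _ flip flip]) (auto simp: flip_flip flipS)
  moreover have "mod_eq n (length ?L') (\<Sum>\<chi>\<in>S. F (flip \<chi>)) (\<Sum>\<chi>\<in>S. - F \<chi>)"
    using flipF by (rule mod_eq_sum)
  ultimately have "(\<Sum>\<chi>\<in>S. F \<chi>) + (\<Sum>\<chi>\<in>S. F \<chi>) \<in> relations n (length ?L')"
    by (simp add: mod_eq_def sum_negf)
  then have "scale (1 / 2) ((\<Sum>\<chi>\<in>S. F \<chi>) + (\<Sum>\<chi>\<in>S. F \<chi>)) \<in> relations n (length ?L')"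
    by (rule relations_scale)
  moreover have "scale (1 / 2) (w + w) = w" for w :: "bdiag \<Rightarrow>\<^sub>0 'k"
    by (simp add: diagrams.scale_right_distrib diagrams.scale_left_distrib[symmetric])
  ultimately have 2: "(\<Sum>\<chi>\<in>S. F \<chi>) \<in> relations n (length ?L')" by simp
  have "lattachments ?L D = lattachments ?L' D \<union> S" "lattachments ?L' D \<inter> S = {}"
    unfolding latt' S_def by auto
  then have "lact n ?L D = (\<Sum>\<chi>\<in>lattachments ?L' D. F \<chi>) + (\<Sum>\<chi>\<in>S. F \<chi>)"
    unfolding lact_def F_def[symmetric] by (metis finite_lattachments finite_Un sum.union_disjoint)
  moreover have "mod_eq n (length ?L') (\<Sum>\<chi>\<in>S. F \<chi>) 0"
    using 2 by (simp add: mod_eq_def)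
  ultimately show ?thesis
    using mod_eq_add[OF 1] by fastforce
qed

lemma lact_cancel_word:
  assumes D: "beaded_diagram n m D" and W: "\<forall>w \<in> set (A @ (u @ a # inv_letter a # v) # B). \<forall>x \<in> set w. fst x < m"
  shows "mod_eq n (length (A @ (u @ v) # B)) (lact n (copies_of (A @ (u @ a # inv_letter a # v) # B)) D)
    (lact n (copies_of (A @ (u @ v) # B)) D :: bdiag \<Rightarrow>\<^sub>0 'k::field_char_0)"
proof -
  let ?L = "copies_of (A @ (u @ a # inv_letter a # v) # B)"
  obtain i e where a: "a = (i, e)" by (cases a) auto
  have "map (map snd) ?L = A @ (u @ a # inv_letter a # v) # B" by (rule map_snd_copies_of)
  then obtain LA R where R: "?L = LA @ R" "map (map snd) LA = A" "map (map snd) R = (u @ a # inv_letter a # v) # B"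
    unfolding map_eq_append_conv by metis
  then obtain xs LB where xs: "?L = LA @ xs # LB" "map (map snd) LA = A" "map snd xs = u @ a # inv_letter a # v"
    "map (map snd) LB = B"
    unfolding map_eq_Cons_conv by metis
  obtain u' x1 x2 v' where x: "xs = u' @ x1 # x2 # v'" "map snd u' = u" "snd x1 = a" "snd x2 = inv_letter a" "map snd v' = v"
  proof -
    obtain us vs where uv: "xs = us @ vs" "map snd us = u" "map snd vs = a # inv_letter a # v"
      using xs(3) unfolding map_eq_append_conv by metis
    then obtain x1 vs' where "vs = x1 # vs'" "snd x1 = a" "map snd vs' = inv_letter a # v"
      unfolding map_eq_Cons_conv by metis
    moreover from this obtain x2 v' where "vs' = x2 # v'" "snd x2 = inv_letter a" "map snd v' = v"
      unfolding map_eq_Cons_conv by metis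
    ultimately show ?thesis using that uv by simp
  qed
  then obtain l1 l2 where L: "?L = LA @ (u' @ (l1, a) # (l2, inv_letter a) # v') # LB"
    "map (map snd) LA = A" "map snd u' = u" "map snd v' = v" "map (map snd) LB = B"
    using xs by (cases x1; cases x2) auto
  let ?L' = "LA @ (u' @ v') # LB"
  have cL: "copying m ?L" using W by (simp only: copying_copies_of)
  have "distinct (map fst (concat ?L))" by (rule distinct_copies_of)
  then have "distinct (map fst (concat ?L'))" unfolding L(1) by auto
  moreover have "set (concat ?L') \<subseteq> set (concat ?L)" unfolding L(1) by auto
  ultimately have cL': "copying m ?L'" using cL unfolding copying_def by blast
  have "mod_eq n (length ?L') (lact n ?L D) (lact n ?L' D :: bdiag \<Rightarrow>\<^sub>0 'k)"
  proof -
    have L2: "?L = LA @ (u' @ (l1, i, e) # (l2, i, \<not> e) # v') # LB"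
      using L(1) by (simp add: a inv_letter_def)
    show ?thesis
      using lact_cancel[OF D cL[unfolded L2]] unfolding L2 .
  qed
  moreover have "lact n ?L' D = (lact n (copies_of (A @ (u @ v) # B)) D :: bdiag \<Rightarrow>\<^sub>0 'k)"
    using lact_copies_of[of D ?L'] cL' beaded_diagram_length[OF D] by (simp add: L)
  moreover have "length ?L' = length (A @ (u @ v) # B)" using L by auto
  ultimately show ?thesis by metis
qed

text \<open>
  Reduction pushes letters one by one from the right, and each step either does nothing or cancels two
  letters that have become adjacent.
\<close>

lemma lact_reduce:
  assumes D: "beaded_diagram n m D" and W: "\<forall>w \<in> set W. \<forall>x \<in> set w. fst x < m"
  shows "mod_eq n (length W) (lact n (copies_of W) D) (lact n (copies_of (map reduce W)) D :: bdiag \<Rightarrow>\<^sub>0 'k::field_char_0)"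
proof -
  have one: "mod_eq n (length (A @ (u @ w) # B)) (lact n (copies_of (A @ (u @ w) # B)) D)
    (lact n (copies_of (A @ (u @ reduce w) # B)) D :: bdiag \<Rightarrow>\<^sub>0 'k)"
    if "\<forall>w \<in> set (A @ (u @ w) # B). \<forall>x \<in> set w. fst x < m" for A B u w
    using that
  proof (induction w arbitrary: u)
    case Nil
    then show ?case by (simp add: reduce_def)
  next
    case (Cons a w)
    have IH: "mod_eq n (length (A @ (u @ a # w) # B)) (lact n (copies_of (A @ (u @ a # w) # B)) D)
        (lact n (copies_of (A @ (u @ a # reduce w) # B)) D :: bdiag \<Rightarrow>\<^sub>0 'k)"
      using Cons.IH[of "u @ [a]"] Cons.prems by simp
    show ?case
    proof (cases "\<exists>r. reduce w = inv_letter a # r")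
      case True
      then obtain r where r: "reduce w = inv_letter a # r" ..
      have "\<forall>x \<in> set r. fst x < m" using set_reduce[of w] Cons.prems by (auto simp: r)
      then have "mod_eq n (length (A @ (u @ r) # B)) (lact n (copies_of (A @ (u @ a # inv_letter a # r) # B)) D)
          (lact n (copies_of (A @ (u @ r) # B)) D :: bdiag \<Rightarrow>\<^sub>0 'k)"
        using Cons.prems by (intro lact_cancel_word[OF D]) auto
      then show ?thesis
        using IH mod_eq_trans by (fastforce simp: reduce_Cons r)
    next
      case False
      then have "reduce (a # w) = a # reduce w"
        by (cases "reduce w") (auto simp: reduce_Cons)
      then show ?thesis using IH by simp
    qed
  qed
  have "mod_eq n (length (A @ W)) (lact n (copies_of (A @ W)) D) (lact n (copies_of (A @ map reduce W)) D :: bdiag \<Rightarrow>\<^sub>0 'k)"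
    if "\<forall>w \<in> set (A @ W). \<forall>x \<in> set w. fst x < m" for A
    using that
  proof (induction W arbitrary: A)
    case (Cons w W)
    have "\<forall>x \<in> set (reduce w). fst x < m" using set_reduce[of w] Cons.prems by auto
    then have "mod_eq n (length (A @ w # W)) (lact n (copies_of (A @ reduce w # W)) D) (lact n (copies_of (A @ reduce w # map reduce W)) D :: bdiag \<Rightarrow>\<^sub>0 'k)"
      using Cons.IH[of "A @ [reduce w]"] Cons.prems by simp
    moreover have "mod_eq n (length (A @ w # W)) (lact n (copies_of (A @ w # W)) D) (lact n (copies_of (A @ reduce w # W)) D :: bdiag \<Rightarrow>\<^sub>0 'k)"
      using one[of A "[]" w W] Cons.prems by simp
    ultimately show ?case
      using mod_eq_trans by fastforce
  qed simp
  from this[of "[]"] show ?thesis using W by simp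
qed

lemma map_snd_lcomp:
  assumes "copying (length L) K"
  shows "map (map snd) (lcomp K L) = map (\<lambda>u. concat (map (subst_letter (map (map snd) L)) u)) (map (map snd) K)"
proof -
  have "map snd (block L x) = subst_letter (map (map snd) L) (snd x)" if "x \<in> set (concat K)" for x
  proof -
    obtain k p e where x: "x = (k, p, e)" by (cases x) auto
    then have p: "p < length L" using copying_less[OF assms] that by metis
    then show ?thesis
      by (auto simp: x block_def subst_letter_def inv_word_def inv_letter_def rev_map)
  qed
  then have "map snd (concat (map (block L) xs)) = concat (map (subst_letter (map (map snd) L)) (map snd xs))"
    if "set xs \<subseteq> set (concat K)" for xs
    using that by (induction xs) auto
  then show ?thesis
    by (auto simp: lcomp_def)
qed

lemma lact_lact_words:
  assumes D: "beaded_diagram n m D" and W: "\<forall>w \<in> set W. \<forall>x \<in> set w. fst x < m"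
    and U: "\<forall>w \<in> set U. \<forall>x \<in> set w. fst x < length W"
  shows "linear_ext scale (lact n (copies_of U)) (lact n (copies_of W) D)
    = (lact n (copies_of (map (\<lambda>u. concat (map (subst_letter W) u)) U)) D :: bdiag \<Rightarrow>\<^sub>0 'k::field)"
proof -
  have L: "copying m (copies_of W)" and K: "copying (length (copies_of W)) (copies_of U)"
    using W U by (simp_all add: copying_copies_of)
  show ?thesis
    unfolding lact_lact[OF D L K]
    using lact_copies_of[of D "lcomp (copies_of U) (copies_of W)" n] copying_lcomp[OF K L] beaded_diagram_length[OF D]
    by (simp add: map_snd_lcomp[OF K])
qed


section \<open>The functor\<close>

lemma mem_rel_coset: "x \<in> rel_coset n m v \<longleftrightarrow> mod_eq n m x v"
proof
  assume "mod_eq n m x v"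
  then have "x = v + (x - v)" "x - v \<in> relations n m" by (simp_all add: mod_eq_def)
  then show "x \<in> rel_coset n m v" unfolding rel_coset_def by blast
qed (auto simp: rel_coset_def mod_eq_def)

lemma rel_coset_eq: "rel_coset n m u = rel_coset n m v \<longleftrightarrow> mod_eq n m u v"
proof
  assume "rel_coset n m u = rel_coset n m v"
  then show "mod_eq n m u v" using mem_rel_coset mod_eq_refl by blast
next
  assume "mod_eq n m u v"
  then show "rel_coset n m u = rel_coset n m v"
    using mod_eq_sym mod_eq_trans unfolding Set.set_eq_iff mem_rel_coset by blast
qed

lemma UN_rel_coset:
  assumes "\<And>x. mod_eq n m x u \<Longrightarrow> mod_eq n' m' (f x) (f u)"
  shows "(\<Union>x \<in> rel_coset n m u. rel_coset n' m' (f x)) = rel_coset n' m' (f u)"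
proof -
  have "rel_coset n' m' (f x) = rel_coset n' m' (f u)" if "x \<in> rel_coset n m u" for x
    using that assms by (simp add: mem_rel_coset rel_coset_eq)
  moreover have "u \<in> rel_coset n m u" by (simp add: mem_rel_coset)
  ultimately show ?thesis by blast
qed

text \<open>
  The operations on cosets give single cosets because the relations form a subspace.
\<close>

lemma A_span_simps:
  "carrier (A_span n m S) = rel_coset n m ` diagrams.span (dgm ` S)"
  "\<zero>\<^bsub>A_span n m S\<^esub> = rel_coset n m 0"
  "rel_coset n m u \<oplus>\<^bsub>A_span n m S\<^esub> rel_coset n m v = rel_coset n m (u + v)"
  "c \<odot>\<^bsub>A_span n m S\<^esub> rel_coset n m u = rel_coset n m (scale c u)"
proof -
  show "carrier (A_span n m S) = rel_coset n m ` diagrams.span (dgm ` S)" "\<zero>\<^bsub>A_span n m S\<^esub> = rel_coset n m 0"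
    by (simp_all add: A_span_def)
  show "c \<odot>\<^bsub>A_span n m S\<^esub> rel_coset n m u = rel_coset n m (scale c u)"
    by (simp add: A_span_def UN_rel_coset mod_eq_scale)
  have "(\<Union>y \<in> rel_coset n m v. rel_coset n m (x + y)) = rel_coset n m (x + v)" for x
    by (intro UN_rel_coset mod_eq_add mod_eq_refl)
  moreover have "(\<Union>x \<in> rel_coset n m u. rel_coset n m (x + v)) = rel_coset n m (u + v)"
    by (intro UN_rel_coset mod_eq_add mod_eq_refl)
  ultimately show "rel_coset n m u \<oplus>\<^bsub>A_span n m S\<^esub> rel_coset n m v = rel_coset n m (u + v)"
    by (simp add: A_span_def)
qed

lemma cring_coeff_ring: "cring (coeff_ring :: 'k::field ring)"
proof (rule cringI)
  show "abelian_group (coeff_ring :: 'k ring)"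
    by (rule abelian_groupI) (auto simp: coeff_ring_def algebra_simps intro: exI[of _ "- x" for x])
  show "comm_monoid (coeff_ring :: 'k ring)"
    by (rule comm_monoidI) (auto simp: coeff_ring_def)
qed (auto simp: coeff_ring_def algebra_simps)

lemma module_A_span: "module coeff_ring (A_span n m S :: ('k::field, _) module)"
proof (rule moduleI)
  show "cring (coeff_ring :: 'k ring)" by (rule cring_coeff_ring)
  show "abelian_group (A_span n m S :: ('k, _) module)"
  proof (rule abelian_groupI)
    fix X assume "X \<in> carrier (A_span n m S :: ('k, _) module)"
    then obtain u where u: "X = rel_coset n m u" "u \<in> diagrams.span (dgm ` S)"
      by (auto simp: A_span_simps)
    then have "rel_coset n m (- u) \<oplus>\<^bsub>A_span n m S\<^esub> X = \<zero>\<^bsub>A_span n m S\<^esub>" "rel_coset n m (- u) \<in> carrier (A_span n m S)"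
      by (simp_all add: A_span_simps diagrams.span_neg)
    then show "\<exists>Y\<in>carrier (A_span n m S). Y \<oplus>\<^bsub>A_span n m S\<^esub> X = \<zero>\<^bsub>A_span n m S\<^esub>" by blast
  qed (auto simp: A_span_simps diagrams.span_add diagrams.span_zero ac_simps)
qed (auto simp: A_span_simps diagrams.span_scale coeff_ring_def
    diagrams.scale_left_distrib diagrams.scale_right_distrib)

definition trivial_diagrams :: "nat \<Rightarrow> nat \<Rightarrow> nat \<Rightarrow> bdiag set" where
  "trivial_diagrams d n m = {D. beaded_diagram n m D \<and> degree D = d \<and> homotopically_trivial n D}"

lemma A_deg_trivial_eq: "A_deg_trivial d n m = A_span n m (trivial_diagrams d n m)"
  by (simp add: A_deg_trivial_def trivial_diagrams_def)

lemma gen_images_letters: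
  assumes "g \<in> hom (free_group m') (free_group m)"
  shows "\<forall>w \<in> set (gen_images g m'). \<forall>x \<in> set w. fst x < m"
proof -
  have "g (gen j) \<in> carrier (free_group m)" if "j < m'" for j
    using assms gen_in_carrier[OF that] by (auto simp: hom_def)
  then show ?thesis by (auto simp: free_group_simps)
qed

lemma act_eq_lact: "(act n g m' :: _ \<Rightarrow> bdiag \<Rightarrow>\<^sub>0 'k::field) = linear_ext scale (lact n (copies_of (gen_images g m')))"
proof -
  have "(act_diagram n g m' :: _ \<Rightarrow> bdiag \<Rightarrow>\<^sub>0 'k) = lact n (copies_of (gen_images g m'))"
    by (rule ext) (rule act_diagram_eq_lact)
  then show ?thesis by (simp add: act_eq_linear_ext)
qed

lemma act_mod_eq:
  assumes g: "g \<in> hom (free_group m') (free_group m)" and uv: "mod_eq n m u v"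
  shows "mod_eq n m' (act n g m' u) (act n g m' v)"
proof -
  have "copying m (copies_of (gen_images g m'))"
    unfolding copying_copies_of using g by (rule gen_images_letters)
  from lact_relations[OF _ this, of "u - v" n] show ?thesis
    using uv by (simp add: mod_eq_def act_eq_lact linear_ext_diff[OF vector_space_scale])
qed

lemma A_mor_rel_coset:
  "g \<in> hom (free_group m') (free_group m) \<Longrightarrow>
    A_mor n m' m g (rel_coset n m v) = rel_coset n m' (act n g m' v)"
  unfolding A_mor_def by (intro UN_rel_coset act_mod_eq)

lemma act_span:
  assumes g: "g \<in> hom (free_group m') (free_group m)" and v: "v \<in> diagrams.span (dgm ` trivial_diagrams d n m)"
  shows "act n g m' v \<in> diagrams.span (dgm ` trivial_diagrams d n m')"
  unfolding act_eq_lact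
proof (rule linear_ext_span[OF vector_space_scale v _ diagrams.subspace_span])
  let ?L = "copies_of (gen_images g m')"
  fix u :: "bdiag \<Rightarrow>\<^sub>0 'a" assume "u \<in> dgm ` trivial_diagrams d n m"
  then obtain D where D: "u = dgm D" "beaded_diagram n m D" "degree D = d" "homotopically_trivial n D"
    by (auto simp: trivial_diagrams_def)
  have L: "copying m ?L"
    unfolding copying_copies_of using g by (rule gen_images_letters)
  have "lattach n ?L \<chi> D \<in> trivial_diagrams d n m'" if "\<chi> \<in> lattachments ?L D" for \<chi>
    using lattach_beaded[OF D(2) L that] lattach_degree[OF D(2) L that] lattach_homotopically_trivial[OF D(2) L D(4)] D(3)
    by (simp add: trivial_diagrams_def)
  then show "linear_ext scale (lact n ?L) u \<in> diagrams.span (dgm ` trivial_diagrams d n m')"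
    unfolding D(1) linear_ext_dgm[OF vector_space_scale] lact_def
    by (intro diagrams.span_sum diagrams.span_scale diagrams.span_base) auto
qed

lemma linear_ext_mod_eq:
  assumes v: "v \<in> diagrams.span (dgm ` S)" and S: "\<And>D. D \<in> S \<Longrightarrow> mod_eq n m (linear_ext scale F (dgm D)) (linear_ext scale G (dgm D))"
  shows "mod_eq n m (linear_ext scale F v) (linear_ext scale G v :: bdiag \<Rightarrow>\<^sub>0 'k::field)"
proof -
  note le = linear_ext_zero[OF vector_space_scale] linear_ext_add[OF vector_space_scale] linear_ext_scale[OF vector_space_scale]
  show ?thesis
  proof (rule diagrams.span_induct[OF v])
    show "diagrams.subspace {v. mod_eq n m (linear_ext scale F v) (linear_ext scale G v :: bdiag \<Rightarrow>\<^sub>0 'k)}"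
      by (auto simp: diagrams.subspace_def le mod_eq_add mod_eq_scale)
  qed (use S in auto)
qed

lemma linear_ext_dgm_id:
  assumes "v \<in> diagrams.span (dgm ` S)"
  shows "linear_ext scale dgm v = (v :: bdiag \<Rightarrow>\<^sub>0 'k::field)"
proof (rule diagrams.span_induct[OF assms])
  show "diagrams.subspace {v :: bdiag \<Rightarrow>\<^sub>0 'k. linear_ext scale dgm v = v}"
    by (auto simp: diagrams.subspace_def linear_ext_zero[OF vector_space_scale]
        linear_ext_add[OF vector_space_scale] linear_ext_scale[OF vector_space_scale])
qed (auto simp: linear_ext_dgm[OF vector_space_scale])

text \<open>
  If every leg has only one copy to go to, then the action produces a single diagram.
\<close>

lemma lact_unique_places:
  assumes L: "copying (length (arcs D)) L" and pl: "\<And>h. h \<in> legs D \<Longrightarrow> places L D h = {\<chi> h}"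
  shows "lact n L D = (scale (\<Prod>h\<in>legs D. lsign L (\<chi> h)) (dgm (lattach n L \<chi> D)) :: bdiag \<Rightarrow>\<^sub>0 'k::field)"
proof -
  let ?\<chi> = "restrict \<chi> (legs D)"
  have "lattachments L D = Pi\<^sub>E (legs D) (\<lambda>h. {?\<chi> h})"
    unfolding lattachments_def using pl by (intro PiE_cong) simp
  also have "\<dots> = {?\<chi>}"
    by (rule PiE_singleton) (rule restrict_extensional)
  finally have "lattachments L D = {?\<chi>}" .
  moreover have "lattach n L ?\<chi> D = lattach n L \<chi> D"
    using L by (rule lattach_cong) simp
  ultimately show ?thesis
    by (simp add: lact_def)
qed

definition home :: "bdiag \<Rightarrow> nat \<Rightarrow> nat" where
  "home D h = (THE p. p < length (arcs D) \<and> Leg h \<in> set (arcs D ! p))"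

lemma home_eq:
  assumes "beaded_diagram n m D" "p < m" "Leg h \<in> set (arcs D ! p)"
  shows "home D h = p"
  unfolding home_def using assms Leg_unique_arc[OF assms(1)] beaded_diagram_length[OF assms(1)]
  by (intro the_equality) auto

lemma home:
  assumes "beaded_diagram n m D" "h \<in> legs D"
  shows "home D h < m" "Leg h \<in> set (arcs D ! home D h)"
proof -
  obtain p where "p < m" "Leg h \<in> set (arcs D ! p)"
    using assms beaded_diagram_length[OF assms(1)] by (auto simp: legs_eq)
  then show "home D h < m" "Leg h \<in> set (arcs D ! home D h)"
    using home_eq[OF assms(1)] by simp_all
qed

lemma keep_id: "(\<And>h. Leg h \<in> set p \<Longrightarrow> \<chi> h = l) \<Longrightarrow> keep \<chi> l p = p"
  unfolding keep_def by (auto simp: filter_id_conv split: point.splits)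

lemma lact_identity:
  assumes D: "beaded_diagram n m D"
  shows "lact n (copies_of (map gen [0..<m])) D = (dgm D :: bdiag \<Rightarrow>\<^sub>0 'k::field)"
proof -
  define L where "L = map (\<lambda>j. [((j, 0::nat), (j, True))]) [0..<m]"
  have cL: "copies_of (map gen [0..<m]) = L"
    by (simp add: copies_of_def L_def)
  have len: "length (arcs D) = m" using D by (rule beaded_diagram_length)
  have set: "(l, p, e) \<in> set (concat L) \<longleftrightarrow> p < m \<and> l = (p, 0) \<and> e" for l p e
    by (auto simp: L_def)
  have sg: "lsign L l = (1 :: 'k)" for l
    unfolding lsign_def set by simp
  have L: "copying m L" unfolding cL[symmetric] copying_copies_of by simp
  let ?\<chi> = "\<lambda>h. (home D h, 0::nat)"
  have pl: "places L D h = {?\<chi> h}" if h: "h \<in> legs D" for h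
    unfolding places_eq[OF D home[OF D h]] set using home[OF D h] by auto
  have "lattach n L ?\<chi> D = D"
  proof -
    have "keep ?\<chi> (p, 0) (arcs D ! p) = arcs D ! p" if "p < m" for p
      using home_eq[OF D that] by (intro keep_id) simp
    then have "arcs (lattach n L ?\<chi> D) = arcs D"
      by (intro nth_equalityI) (simp_all add: lattach_def L_def lcopy_def len)
    then show ?thesis by (cases D) (simp add: lattach_def)
  qed
  then show ?thesis
    unfolding cL using L pl by (subst lact_unique_places[of D L ?\<chi> n]) (simp_all add: len sg)
qed

text \<open>
  Composition is compatible with the actions before reduction of the words by \<open>lact_lact\<close>, and
  \<open>lact_reduce\<close> allows for the reduction.
\<close>

lemma gr_op_functor_A_deg_trivial:
  "gr_op_functor (A_deg_trivial d n :: nat \<Rightarrow> ('k::field_char_0, (bdiag \<Rightarrow>\<^sub>0 'k) set) module) (A_mor n)"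
proof (rule gr_op_functor.intro)
  show "module coeff_ring (A_deg_trivial d n m :: ('k, _) module)" for m
    unfolding A_deg_trivial_eq by (rule module_A_span)
next
  fix g m' m assume g: "g \<in> hom (free_group m') (free_group m)"
  show "A_mor n m' m g \<in> hom (add_monoid (A_deg_trivial d n m :: ('k, _) module)) (add_monoid (A_deg_trivial d n m'))"
    unfolding A_deg_trivial_eq hom_def
    by (auto simp: A_span_simps A_mor_rel_coset[OF g] act_add intro!: imageI act_span[OF g])
next
  fix g m' m c and X :: "(bdiag \<Rightarrow>\<^sub>0 'k) set"
  assume g: "g \<in> hom (free_group m') (free_group m)" and X: "X \<in> carrier (A_deg_trivial d n m)"
  then show "A_mor n m' m g (c \<odot>\<^bsub>A_deg_trivial d n m\<^esub> X) = c \<odot>\<^bsub>A_deg_trivial d n m'\<^esub> A_mor n m' m g X"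
    unfolding A_deg_trivial_eq by (auto simp: A_span_simps A_mor_rel_coset[OF g] act_scale)
next
  fix g g' m' m and X :: "(bdiag \<Rightarrow>\<^sub>0 'k) set"
  assume "g \<in> hom (free_group m') (free_group m)" "g' \<in> hom (free_group m') (free_group m)"
    and eq: "\<forall>w \<in> carrier (free_group m'). g w = g' w"
  have "gen_images g m' = gen_images g' m'"
    using eq gen_in_carrier by auto
  then show "A_mor n m' m g X = A_mor n m' m g' X"
    by (simp only: A_mor_def act_eq_lact)
next
  fix m and X :: "(bdiag \<Rightarrow>\<^sub>0 'k) set"
  assume "X \<in> carrier (A_deg_trivial d n m)"
  then obtain v where v: "X = rel_coset n m v" "v \<in> diagrams.span (dgm ` trivial_diagrams d n m)"
    unfolding A_deg_trivial_eq by (auto simp: A_span_simps)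
  have id: "(\<lambda>w. w) \<in> hom (free_group m) (free_group m)" by (simp add: hom_def)
  have "mod_eq n m (linear_ext scale (lact n (copies_of (map gen [0..<m]))) v) (linear_ext scale dgm v)"
    using v(2) by (rule linear_ext_mod_eq)
      (auto simp: linear_ext_dgm[OF vector_space_scale] lact_identity trivial_diagrams_def)
  moreover have "linear_ext scale dgm v = v"
    using v(2) by (rule linear_ext_dgm_id)
  ultimately show "A_mor n m m (\<lambda>w. w) X = X"
    by (simp add: v(1) A_mor_rel_coset[OF id] rel_coset_eq act_eq_lact)
next
  fix g h m m' m'' and X :: "(bdiag \<Rightarrow>\<^sub>0 'k) set"
  assume g: "g \<in> hom (free_group m') (free_group m)" and h: "h \<in> hom (free_group m'') (free_group m')"
    and "X \<in> carrier (A_deg_trivial d n m)"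
  then obtain v where v: "X = rel_coset n m v" "v \<in> diagrams.span (dgm ` trivial_diagrams d n m)"
    unfolding A_deg_trivial_eq by (auto simp: A_span_simps)
  have gh: "g \<circ> h \<in> hom (free_group m'') (free_group m)"
    using hom_compose[OF h g] .
  let ?W = "gen_images g m'" and ?U = "gen_images h m''"
  have W: "\<forall>w \<in> set ?W. \<forall>x \<in> set w. fst x < m" and U: "\<forall>w \<in> set ?U. \<forall>x \<in> set w. fst x < length ?W"
    using gen_images_letters[OF g] gen_images_letters[OF h] by simp_all
  let ?V = "map (\<lambda>u. concat (map (subst_letter ?W) u)) ?U"
  have V: "map reduce ?V = gen_images (g \<circ> h) m''"
  proof -
    have "g (h (gen j)) = reduce (concat (map (subst_letter ?W) (h (gen j))))" if "j < m''" for j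
      using hom_eq_reduce_subst[OF g, of "h (gen j)"] h gen_in_carrier[OF that] by (auto simp: hom_def)
    then show ?thesis by simp
  qed
  have Vl: "\<forall>w \<in> set ?V. \<forall>x \<in> set w. fst x < m"
  proof -
    have 1: "fst y < m" if "fst x < m'" "y \<in> set (subst_letter ?W x)" for x y
    proof -
      have "\<forall>z \<in> set (?W ! fst x). fst z < m" using that(1) W by simp
      then show ?thesis using that by (cases "snd x") (auto simp: subst_letter_def set_inv_word simp del: nth_map)
    qed
    have 2: "fst x < m'" if "x \<in> set u" "u \<in> set ?U" for x u
      using U that by auto
    show ?thesis
    proof (intro ballI)
      fix w y assume w: "w \<in> set ?V" and y: "y \<in> set w"
      obtain u where u: "w = concat (map (subst_letter ?W) u)" "u \<in> set ?U"
        using w unfolding set_map[of _ ?U] by (rule imageE)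
      obtain x where "x \<in> set u" "y \<in> set (subst_letter ?W x)"
        using y unfolding u(1) set_concat set_map by blast
      then show "fst y < m" using 1 2 u(2) by blast
    qed
  qed
  have "mod_eq n m'' (linear_ext scale (\<lambda>D. linear_ext scale (lact n (copies_of ?U)) (lact n (copies_of ?W) D)) v)
    (linear_ext scale (lact n (copies_of (gen_images (g \<circ> h) m''))) v)"
    using v(2)
  proof (rule linear_ext_mod_eq)
    fix D assume "D \<in> trivial_diagrams d n m"
    then have D: "beaded_diagram n m D" by (simp add: trivial_diagrams_def)
    show "mod_eq n m'' (linear_ext scale (\<lambda>D. linear_ext scale (lact n (copies_of ?U)) (lact n (copies_of ?W) D)) (dgm D))
      (linear_ext scale (lact n (copies_of (gen_images (g \<circ> h) m''))) (dgm D) :: bdiag \<Rightarrow>\<^sub>0 'k)"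
      unfolding linear_ext_dgm[OF vector_space_scale] lact_lact_words[OF D W U] V[symmetric]
      using lact_reduce[OF D Vl] by simp
  qed
  moreover have "linear_ext scale (\<lambda>D. linear_ext scale (lact n (copies_of ?U)) (lact n (copies_of ?W) D)) v
      = linear_ext scale (lact n (copies_of ?U)) (linear_ext scale (lact n (copies_of ?W)) v)"
    unfolding linear_ext_def[of _ _ v] linear_ext_sum[OF vector_space_scale] linear_ext_scale[OF vector_space_scale] ..
  ultimately show "A_mor n m'' m (g \<circ> h) X = A_mor n m'' m' h (A_mor n m' m g X)"
    using mod_eq_sym by (simp add: v(1) A_mor_rel_coset[OF g] A_mor_rel_coset[OF h] A_mor_rel_coset[OF gh] rel_coset_eq act_eq_lact)
qed


section \<open>The four-term relation\<close>

lemma beaded_diagramI: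
  assumes "length (arcs D) = m" "\<forall>pts \<in> set (arcs D). beads_in n pts"
    and "\<forall>(s, ws, t) \<in># edges D. set ws \<subseteq> carrier (free_group n)"
    and "vertex_halves D = edge_halves D" "\<And>h. count (vertex_halves D) h \<le> 1"
    and c: "\<And>h. \<lbrakk>h \<in> halves D; h \<notin> legs D\<rbrakk> \<Longrightarrow> \<exists>l \<in> legs D. (h, l) \<in> joined D \<union> (joined D)\<inverse>"
  shows "beaded_diagram n m D"
proof -
  have "\<exists>l \<in> legs D. (h, l) \<in> (joined D \<union> (joined D)\<inverse>)\<^sup>*" if "h \<in> halves D" for h
  proof (cases "h \<in> legs D")
    case False
    then show ?thesis using c[OF that] by blast
  qed blast
  then show ?thesis
    using assms(1-5) unfolding beaded_diagram_def beads_in_def by blast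
qed

lemma beaded_diagram_reverse:
  assumes D: "beaded_diagram n m (BDiag A V (add_mset (s, ws, t) E))" and "set ws' \<subseteq> carrier (free_group n)"
  shows "beaded_diagram n m (BDiag A V (add_mset (t, ws', s) E))"
proof -
  let ?D = "BDiag A V (add_mset (s, ws, t) E)" and ?D' = "BDiag A V (add_mset (t, ws', s) E)"
  have J: "joined ?D' \<union> (joined ?D')\<inverse> = joined ?D \<union> (joined ?D)\<inverse>"
    unfolding joined_BDiag by auto
  have e: "legs_mset ?D' = legs_mset ?D" "vertex_halves ?D' = vertex_halves ?D" "edge_halves ?D' = edge_halves ?D"
    by (simp_all add: legs_mset_BDiag vertex_halves_BDiag edge_halves_BDiag)
  have "\<forall>(s, ws, t) \<in># edges ?D'. set ws \<subseteq> carrier (free_group n)"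
    using assms by (auto simp: beaded_diagram_def)
  then show ?thesis
    using D unfolding beaded_diagram_def J e bdiag.sel by blast
qed

text \<open>
  The reversal move requires a bead on the edge, so a trivial one is inserted first.
\<close>

lemma edge_reverse_unbeaded:
  assumes D: "beaded_diagram n m (BDiag A V (add_mset (s, [], t) E))"
  shows "(BDiag A V (add_mset (s, [], t) E), BDiag A V (add_mset (t, [], s) E)) \<in> bead_equiv n m"
proof -
  let ?o = "[\<one>\<^bsub>free_group n\<^esub>]"
  have b: "beaded_diagram n m (BDiag A V (add_mset (s, ?o, t) E))"
    "beaded_diagram n m (BDiag A V (add_mset (t, ?o, s) E))" "beaded_diagram n m (BDiag A V (add_mset (t, [], s) E))"
    using beaded_diagram_replace_edge[OF D] beaded_diagram_reverse[OF D] by simp_all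
  have 1: "(BDiag A V (add_mset (s, [], t) E), BDiag A V (add_mset (s, ?o, t) E)) \<in> bead_equiv n m"
    using D b by (intro edges_bead_equiv) (simp_all add: merge_beads_def)
  have "bead_move n (BDiag A V (add_mset (s, ?o, t) E)) (BDiag A V (add_mset (t, [inv\<^bsub>free_group n\<^esub> \<one>\<^bsub>free_group n\<^esub>], s) E))"
    by (rule bead_move.reverse)
  then have 2: "(BDiag A V (add_mset (s, ?o, t) E), BDiag A V (add_mset (t, ?o, s) E)) \<in> bead_equiv n m"
    using b by (intro bead_equiv_step) simp_all
  have 3: "(BDiag A V (add_mset (t, ?o, s) E), BDiag A V (add_mset (t, [], s) E)) \<in> bead_equiv n m"
    using b by (intro edges_bead_equiv) (simp_all add: merge_beads_def)
  show ?thesis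
    using bead_equiv_trans[OF 1 bead_equiv_trans[OF 2 3]] .
qed

text \<open>
  Chord diagrams without beads on the arcs, given by the legs along each arc.
\<close>

definition chords :: "nat list list \<Rightarrow> (nat \<times> word list \<times> nat) multiset \<Rightarrow> bdiag" where
  "chords G E = BDiag (map (map Leg) G) {#} E"

abbreviation ends :: "(nat \<times> word list \<times> nat) multiset \<Rightarrow> nat multiset" where
  "ends E \<equiv> (\<Sum>(s, ws, t) \<in># E. {#s, t#})"

lemma leg_seq_map_Leg [simp]: "leg_seq (map Leg xs) = xs"
  by (induction xs) auto

lemma leg_seq_concat_Leg [simp]: "leg_seq (concat (map (map Leg) G)) = concat G"
  by (simp add: leg_seq_concat comp_def)

lemma beads_in_map_Leg [simp]: "beads_in n (map Leg xs)"
  by (auto simp: beads_in_def)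

lemma count_le_1_mset: "distinct xs \<Longrightarrow> count (mset xs) h \<le> 1"
  by (simp add: distinct_count_atmost_1)

lemma beaded_chords:
  assumes "length G = m" "distinct (concat G)" "mset (concat G) = ends E" "\<forall>(s, ws, t) \<in># E. ws = []"
  shows "beaded_diagram n m (chords G E)"
proof (rule beaded_diagramI)
  have v: "vertex_halves (chords G E) = mset (concat G)"
    by (simp add: chords_def vertex_halves_BDiag)
  show "vertex_halves (chords G E) = edge_halves (chords G E)"
    unfolding v assms(3) by (simp add: chords_def edge_halves_BDiag)
  show "count (vertex_halves (chords G E)) h \<le> 1" for h
    unfolding v using assms(2) by (rule count_le_1_mset)
  have l: "legs (chords G E) = set (concat G)"
    unfolding chords_def legs_mset_BDiag leg_seq_concat_Leg by (rule set_mset_mset)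
  show "\<exists>l \<in> legs (chords G E). (h, l) \<in> joined (chords G E) \<union> (joined (chords G E))\<inverse>"
    if "h \<in> halves (chords G E)" "h \<notin> legs (chords G E)" for h
    using that unfolding v l set_mset_mset by blast
  show "\<forall>(s, ws, t) \<in># edges (chords G E). set ws \<subseteq> carrier (free_group n)"
    using assms(4) by (fastforce simp: chords_def)
qed (use assms(1) in \<open>auto simp: chords_def\<close>)

text \<open>
  The free end \<open>l\<close> is put just before or just after the leg \<open>k\<close> by replacing \<open>k\<close> by \<open>[l, k]\<close> or \<open>[k, l]\<close>;
  replacing \<open>k\<close> by a new leg makes room for a tripod.
\<close>

definition rep :: "nat \<Rightarrow> nat list \<Rightarrow> nat list list \<Rightarrow> nat list list" where
  "rep k ws G = map (\<lambda>xs. concat (map (\<lambda>y. if y = k then ws else [y]) xs)) G"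

lemma rep_fresh: "k \<notin> set (concat G) \<Longrightarrow> rep k ws G = G"
proof -
  have "concat (map (\<lambda>y. if y = k then ws else [y]) xs) = xs" if "k \<notin> set xs" for xs
    using that by (induction xs) auto
  then show "k \<notin> set (concat G) \<Longrightarrow> rep k ws G = G"
    by (auto simp: rep_def intro!: map_idI)
qed

lemma rep_decomp:
  assumes "distinct (concat G)" "k \<in> set (concat G)"
  obtains GA gp gq GB where "G = GA @ (gp @ k # gq) # GB" "\<And>ws. rep k ws G = GA @ (gp @ ws @ gq) # GB"
proof -
  obtain xs where "xs \<in> set G" "k \<in> set xs" using assms(2) by auto
  then obtain GA gp gq GB where G: "G = GA @ (gp @ k # gq) # GB" by (metis split_list)
  have k: "k \<notin> set (concat GA)" "k \<notin> set (concat GB)" "k \<notin> set (concat [gp])" "k \<notin> set (concat [gq])"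
    using assms(1) by (auto simp: G)
  have "rep k ws [gp] = [gp]" "rep k ws [gq] = [gq]" "rep k ws GA = GA" "rep k ws GB = GB" for ws
    using k by (auto intro: rep_fresh)
  then have "rep k ws G = GA @ (gp @ ws @ gq) # GB" for ws
    by (simp add: G rep_def)
  then show ?thesis using that G by blast
qed

lemma mset_concat_rep:
  assumes "distinct (concat G)" "k \<in> set (concat G)"
  shows "mset (concat (rep k ws G)) + {#k#} = mset (concat G) + mset ws"
  by (rule rep_decomp[OF assms, where thesis = ?thesis]) simp

lemma length_rep [simp]: "length (rep k ws G) = length G"
  by (simp add: rep_def)

lemma map_rep:
  assumes "\<And>y. y \<in> set (concat G) \<Longrightarrow> map f (if y = k then ws else [y]) = (if y = k' then ws' else [y])"
  shows "map (map f) (rep k ws G) = rep k' ws' G"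
proof -
  have "map f (concat (map (\<lambda>y. if y = k then ws else [y]) xs)) = concat (map (\<lambda>y. if y = k' then ws' else [y]) xs)"
    if "set xs \<subseteq> set (concat G)" for xs
    using that
  proof (induction xs)
    case (Cons y xs)
    then show ?case using assms[of y] by auto
  qed simp
  then show ?thesis by (auto simp: rep_def)
qed

text \<open>
  The two ways of inserting a free end next to the leg \<open>k\<close> are the two resolutions of one tripod.
\<close>

lemma stu_rep:
  assumes "distinct (concat G)" "k \<in> set (concat G)"
  shows "stu (BDiag (map (map Leg) (rep k [z] G)) {#(x, b, a)#} (add_mset (z, [], x) E))
    (chords (rep k [a, b] G) E) (chords (rep k [b, a] G) E)"
proof -
  obtain GA gp gq GB where G: "\<And>ws. rep k ws G = GA @ (gp @ ws @ gq) # GB"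
    using rep_decomp[OF assms] by metis
  show ?thesis
    using stuI[of "map (map Leg) GA" "map Leg gp" z "map Leg gq" "map (map Leg) GB" x b a "{#}" E]
    by (simp add: G chords_def)
qed

lemma rename_Leg: "rename f (BDiag (map (map Leg) G) V E) = BDiag (map (map Leg) (map (map f) G))
    (image_mset (\<lambda>(a, b, c). (f a, f b, f c)) V) (image_mset (\<lambda>(s, ws, t). (f s, ws, f t)) E)"
  by (simp add: rename_eq comp_def)

lemma in_ends: "(s, ws, t) \<in># E \<Longrightarrow> s \<in># ends E \<and> t \<in># ends E"
  by force

lemma rename_edges_fixed:
  assumes "\<And>h. h \<in># ends E \<Longrightarrow> f h = h"
  shows "image_mset (\<lambda>(s, ws, t). (f s, ws, f t)) E = E"
proof -
  have "image_mset (\<lambda>(s, ws, t). (f s, ws, f t)) E = image_mset id E"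
    using assms in_ends by (intro image_mset_cong) fastforce
  then show ?thesis by simp
qed

text \<open>
  The STU relation turns the difference at \<open>s\<close> into a tripod whose three branches end at the positions
  of \<open>s\<close> and \<open>t\<close> and at \<open>l'\<close>.  The difference at \<open>t\<close> gives the same tripod with the opposite cyclic order.
  Resolving it again at \<open>s\<close> shows that it is the negative of the first one.
\<close>

lemma four_term_chord:
  assumes len: "length G = m" and dist: "distinct (l # concat G)"
    and halves: "mset (l # concat G) = ends (add_mset (s, [], t) E)"
    and unbeaded: "\<forall>(s, ws, t) \<in># E. ws = []"
    and l': "(l, [], l') \<in># E \<or> (l', [], l) \<in># E"
  defines "E' \<equiv> add_mset (s, [], t) E"
  shows "(dgm (chords (rep s [l, s] G) E') - dgm (chords (rep s [s, l] G) E')) +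
    (dgm (chords (rep t [l, t] G) E') - dgm (chords (rep t [t, l] G) E')) \<in> (relations n m :: (bdiag \<Rightarrow>\<^sub>0 'k::field) set)"
proof -
  have cnt: "count (ends E') h \<le> 1" for h
    using count_le_1_mset[OF dist, of h] unfolding halves E'_def .
  have dG: "distinct (concat G)" using dist by simp
  have setH: "set (l # concat G) = set_mset (ends E')"
    using halves unfolding E'_def by (metis set_mset_mset)
  have lE: "l \<in># ends E" "l' \<in># ends E" using l' in_ends by blast+
  have ne: "h \<noteq> s \<and> h \<noteq> t" if "h \<in># ends E" for h
  proof -
    have "count (ends E) h \<ge> 1" using that by (simp only: Suc_le_eq One_nat_def count_greater_zero_iff)
    moreover have "ends E' = {#s, t#} + ends E" by (simp add: E'_def)
    then have "count {#s, t#} h + count (ends E) h \<le> 1" using cnt[of h] by (simp only: count_union)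
    ultimately have "count {#s, t#} h = 0" by linarith
    then show ?thesis by (auto split: if_splits)
  qed
  have st: "s \<noteq> t" using cnt[of t] unfolding E'_def by (auto split: if_splits)
  have "l \<noteq> l'"
  proof
    assume "l = l'"
    then have "(l, [], l) \<in># E" using l' by simp
    then obtain E0 where "E = add_mset (l, [], l) E0" by (meson multi_member_split)
    then show False using cnt[of l] unfolding E'_def by (auto split: if_splits)
  qed
  have mem: "s \<in> set (concat G)" "t \<in> set (concat G)" "l' \<in> set (concat G)"
  proof -
    have "{s, t, l'} \<subseteq> set (l # concat G)" unfolding setH E'_def using lE by auto
    then show "s \<in> set (concat G)" "t \<in> set (concat G)" "l' \<in> set (concat G)"
      using ne[OF lE(1)] \<open>l \<noteq> l'\<close> by auto
  qed
  obtain z where z: "z \<notin> set (l # concat G)" using ex_new_if_finite[OF infinite_UNIV_nat, of "set (l # concat G)"] by blast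
  obtain x where x: "x \<notin> set (z # l # concat G)" using ex_new_if_finite[OF infinite_UNIV_nat, of "set (z # l # concat G)"] by blast
  let ?J = "\<lambda>E''. {(h, h'). (h, [], h') \<in># E'' \<or> (h', [], h) \<in># E''}"
  \<comment> \<open>A tripod is connected to the arcs because each of its half-edges \<open>x\<close>, \<open>u\<close>, \<open>l\<close> is joined to a leg.\<close>
  have Y: "beaded_diagram n m (BDiag (map (map Leg) (rep u [z] G)) {#(a, b, c)#} E'')"
    if u: "(u, u') \<in> {(s, t), (t, s)}" and abc: "{#a, b, c#} = {#x, u, l#}" and E'': "ends E'' = {#z, x#} + ends E'"
      and ub: "\<forall>(s, ws, t) \<in># E''. ws = []" and J: "{(x, z), (u, u'), (l, l')} \<subseteq> ?J E''" for u u' a b c E''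
  proof (rule beaded_diagramI)
    let ?D = "BDiag (map (map Leg) (rep u [z] G)) {#(a, b, c)#} E''"
    have u_in: "u \<in> set (concat G)" "u' \<in> set (concat G)" "u \<noteq> u'" using u mem st by auto
    have m: "mset (concat (rep u [z] G)) + {#u#} = mset (concat G) + {#z#}"
      using mset_concat_rep[OF dG u_in(1), of "[z]"] by simp
    have v: "vertex_halves ?D = mset (concat (rep u [z] G)) + {#x, u, l#}"
      by (simp add: vertex_halves_BDiag abc[symmetric])
    also have "\<dots> = (mset (concat (rep u [z] G)) + {#u#}) + {#x, l#}" by simp
    also have "\<dots> = mset (z # x # l # concat G)" unfolding m by simp
    finally have v: "vertex_halves ?D = mset (z # x # l # concat G)" .
    show "vertex_halves ?D = edge_halves ?D"
      unfolding v edge_halves_BDiag E'' using halves by (simp add: E'_def)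
    have "distinct (z # x # l # concat G)" using dist z x by auto
    then show "count (vertex_halves ?D) h \<le> 1" for h
      unfolding v by (rule count_le_1_mset)
    have legs: "legs ?D = insert z (set (concat G) - {u})"
    proof -
      obtain GA gp gq GB where G: "G = GA @ (gp @ u # gq) # GB" "\<And>ws. rep u ws G = GA @ (gp @ ws @ gq) # GB"
        using rep_decomp[OF dG u_in(1)] by metis
      then have "legs ?D = set (concat (GA @ (gp @ [z] @ gq) # GB))"
        unfolding legs_mset_BDiag leg_seq_concat_Leg set_mset_mset by metis
      then show ?thesis using dG by (auto simp: G(1))
    qed
    have partners: "z \<in> legs ?D" "u' \<in> legs ?D" "l' \<in> legs ?D"
      unfolding legs using u_in mem ne[OF lE(2)] u by auto
    have joined: "?J E'' \<subseteq> joined ?D \<union> (joined ?D)\<inverse>"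
      by (auto simp: joined_BDiag)
    fix h assume h: "h \<in> halves ?D" "h \<notin> legs ?D"
    then have "h \<in> {x, u, l}" unfolding v legs by auto
    then show "\<exists>l \<in> legs ?D. (h, l) \<in> joined ?D \<union> (joined ?D)\<inverse>"
      using partners J joined by blast
  next
    show "\<forall>(s, ws, t) \<in># edges (BDiag (map (map Leg) (rep u [z] G)) {#(a, b, c)#} E''). set ws \<subseteq> carrier (free_group n)"
      using ub by fastforce
  qed (use len in auto)
  let ?Ys = "\<lambda>V E''. BDiag (map (map Leg) (rep s [z] G)) V E''" and ?Yt = "\<lambda>V E''. BDiag (map (map Leg) (rep t [z] G)) V E''"
  let ?Es = "add_mset (z, [], x) E'"
  have ubE': "\<forall>(s, ws, t) \<in># ?Es. ws = []" using unbeaded by (simp add: E'_def)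
  have Js: "{(x, z), (s, t), (t, s), (l, l')} \<subseteq> ?J ?Es" using l' by (auto simp: E'_def)
  have bs: "beaded_diagram n m (?Ys {#(x, s, l)#} ?Es)"
    using Js ubE' by (intro Y[of s t]) auto
  have bs2: "beaded_diagram n m (?Ys {#(s, x, l)#} ?Es)" "beaded_diagram n m (?Ys {#(x, l, s)#} ?Es)"
  proof -
    have perm: "{#s, x, l#} = {#x, s, l#}" "{#x, l, s#} = {#x, s, l#}" by (simp_all add: add_mset_commute)
    have e: "ends ?Es = {#z, x#} + ends E'" by simp
    have J: "{(x, z), (s, t), (l, l')} \<subseteq> ?J ?Es" using Js by blast
    show "beaded_diagram n m (?Ys {#(s, x, l)#} ?Es)"
      using Y[OF _ perm(1) e ubE' J] by simp
    show "beaded_diagram n m (?Ys {#(x, l, s)#} ?Es)"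
      using Y[OF _ perm(2) e ubE' J] by simp
  qed
  have bt: "beaded_diagram n m (?Yt {#(x, t, l)#} ?Es)"
    using Js ubE' by (intro Y[of t s]) (auto simp: E'_def)
  have s1: "mod_eq n m (dgm (?Ys {#(x, s, l)#} ?Es)) (dgm (chords (rep s [l, s] G) E') - dgm (chords (rep s [s, l] G) E') :: bdiag \<Rightarrow>\<^sub>0 'k)"
    using stu_rep[OF dG mem(1)] bs by (rule stu_mod_eq)
  have s2: "mod_eq n m (dgm (?Ys {#(x, l, s)#} ?Es)) (dgm (chords (rep s [s, l] G) E') - dgm (chords (rep s [l, s] G) E') :: bdiag \<Rightarrow>\<^sub>0 'k)"
    using stu_rep[OF dG mem(1)] bs2(2) by (rule stu_mod_eq)
  have t1: "mod_eq n m (dgm (?Yt {#(x, t, l)#} ?Es)) (dgm (chords (rep t [l, t] G) E') - dgm (chords (rep t [t, l] G) E') :: bdiag \<Rightarrow>\<^sub>0 'k)"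
    using stu_rep[OF dG mem(2)] bt by (rule stu_mod_eq)
  \<comment> \<open>The same tripod, seen from the other end of the chord, has the opposite cyclic order.\<close>
  define f where "f = (\<lambda>h. if h = z then t else if h = x then s else if h = s then z else if h = t then x else h)"
  have neq: "z \<noteq> x" "z \<noteq> s" "z \<noteq> t" "x \<noteq> s" "x \<noteq> t" "z \<noteq> l" "x \<noteq> l" "l \<noteq> s" "l \<noteq> t"
    using z x mem ne[OF lE(1)] by auto
  have f: "f z = t" "f x = s" "f s = z" "f t = x" "f l = l"
    using neq st by (simp_all add: f_def)
  have "inj f" unfolding f_def inj_def using neq st by auto
  then have inj: "inj_on f (halves (?Yt {#(x, t, l)#} ?Es))" by (rule inj_on_subset) simp
  have fG: "map (map f) (rep t [z] G) = rep s [z] G"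
  proof (rule map_rep)
    fix y assume y: "y \<in> set (concat G)"
    have "y \<noteq> z" "y \<noteq> x" using y z x by auto
    then show "map f (if y = t then [z] else [y]) = (if y = s then [z] else [y])"
      using st f by (auto simp: f_def)
  qed
  have fE: "image_mset (\<lambda>(s, ws, t). (f s, ws, f t)) E = E"
  proof (rule rename_edges_fixed)
    fix h assume h: "h \<in># ends E"
    then have "h \<in> set (l # concat G)" unfolding setH E'_def by simp
    then show "f h = h" using ne[OF h] z x unfolding f_def by auto
  qed
  let ?Et = "add_mset (t, [], s) (add_mset (z, [], x) E)"
  have ren: "rename f (?Yt {#(x, t, l)#} ?Es) = ?Ys {#(s, x, l)#} ?Et"
    unfolding rename_Leg fG by (simp add: f fE E'_def add_mset_commute)
  have bEt: "beaded_diagram n m (?Ys {#(s, x, l)#} ?Et)"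
    using beaded_diagram_reverse[of n m _ _ s "[]" t "add_mset (z, [], x) E" "[]"] bs2(1)
    by (simp add: E'_def add_mset_commute)
  have "bead_move n (?Yt {#(x, t, l)#} ?Es) (?Ys {#(s, x, l)#} ?Et)"
    using bead_move.isomorphism[OF inj] unfolding ren .
  then have 1: "(?Yt {#(x, t, l)#} ?Es, ?Ys {#(s, x, l)#} ?Et) \<in> bead_equiv n m"
    using bt bEt by (rule bead_equiv_step)
  have 2: "(?Ys {#(s, x, l)#} ?Et, ?Ys {#(s, x, l)#} ?Es) \<in> bead_equiv n m"
    using edge_reverse_unbeaded[OF bEt] by (simp add: E'_def add_mset_commute)
  have "bead_move n (?Ys {#(s, x, l)#} ?Es) (?Ys {#(x, l, s)#} ?Es)"
    by (rule bead_move.cyclic)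
  then have 3: "(?Ys {#(s, x, l)#} ?Es, ?Ys {#(x, l, s)#} ?Es) \<in> bead_equiv n m"
    using bs2 by (intro bead_equiv_step)
  have "(?Yt {#(x, t, l)#} ?Es, ?Ys {#(x, l, s)#} ?Es) \<in> bead_equiv n m"
    using bead_equiv_trans[OF 1 bead_equiv_trans[OF 2 3]] .
  then have "mod_eq n m (dgm (?Yt {#(x, t, l)#} ?Es)) (dgm (?Ys {#(x, l, s)#} ?Es) :: bdiag \<Rightarrow>\<^sub>0 'k)"
    using bt by (rule bead_equiv_mod_eq)
  then have "mod_eq n m (dgm (chords (rep t [l, t] G) E') - dgm (chords (rep t [t, l] G) E'))
    (dgm (chords (rep s [s, l] G) E') - dgm (chords (rep s [l, s] G) E') :: bdiag \<Rightarrow>\<^sub>0 'k)"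
    using s2 t1 mod_eq_sym mod_eq_trans by meson
  then show ?thesis
    by (simp add: mod_eq_def algebra_simps)
qed

text \<open>
  For a chord with adjacent ends, exchanging the ends is an isomorphism.
\<close>

lemma four_term_own_end:
  assumes len: "length G = m" and dist: "distinct (l # concat G)"
    and halves: "mset (l # concat G) = ends E'" and unbeaded: "\<forall>(s, ws, t) \<in># E'. ws = []"
    and l': "E' = add_mset (l, [], l') E \<or> E' = add_mset (l', [], l) E"
  shows "dgm (chords (rep l' [l, l'] G) E') - dgm (chords (rep l' [l', l] G) E') \<in> (relations n m :: (bdiag \<Rightarrow>\<^sub>0 'k::field) set)"
proof -
  have cnt: "count (ends E') h \<le> 1" for h
    using count_le_1_mset[OF dist, of h] unfolding halves .
  have "l \<noteq> l'" using cnt[of l] l' by (auto split: if_splits)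
  have ne: "h \<noteq> l \<and> h \<noteq> l'" if "h \<in># ends E" for h
  proof -
    have "count (ends E) h \<ge> 1" using that by (simp only: Suc_le_eq One_nat_def count_greater_zero_iff)
    moreover have "ends E' = {#l, l'#} + ends E" using l' by auto
    then have "count {#l, l'#} h + count (ends E) h \<le> 1" using cnt[of h] by (simp only: count_union)
    ultimately have "count {#l, l'#} h = 0" by linarith
    then show ?thesis by (auto split: if_splits)
  qed
  have dG: "distinct (concat G)" using dist by simp
  have "set (l # concat G) = set_mset (ends E')"
    using halves by (metis set_mset_mset)
  then have l'G: "l' \<in> set (concat G)" using l' \<open>l \<noteq> l'\<close> by auto
  have b: "beaded_diagram n m (chords (rep l' ws G) E')" if "ws = [l, l'] \<or> ws = [l', l]" for ws
  proof (rule beaded_chords)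
    have "mset (concat (rep l' ws G)) + {#l'#} = mset (l # concat G) + {#l'#}"
      unfolding mset_concat_rep[OF dG l'G] using that by auto
    then have m: "mset (concat (rep l' ws G)) = mset (l # concat G)" by simp
    then show "mset (concat (rep l' ws G)) = ends E'" using halves by simp
    show "distinct (concat (rep l' ws G))" using m dist mset_eq_imp_distinct_iff by blast
  qed (use len unbeaded in auto)
  define f where "f = (\<lambda>h. if h = l then l' else if h = l' then l else h)"
  have "inj f" unfolding f_def inj_def by auto
  then have inj: "inj_on f S" for S by (rule inj_on_subset) simp
  have fG: "map (map f) (rep l' [l, l'] G) = rep l' [l', l] G"
  proof (rule map_rep)
    fix y assume "y \<in> set (concat G)"
    then have "y \<noteq> l" using dist by auto
    then show "map f (if y = l' then [l, l'] else [y]) = (if y = l' then [l', l] else [y])"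
      by (auto simp: f_def)
  qed
  have fE: "image_mset (\<lambda>(s, ws, t). (f s, ws, f t)) E = E"
    by (rule rename_edges_fixed) (use ne in \<open>auto simp: f_def\<close>)
  have fl: "f l = l'" "f l' = l" by (auto simp: f_def)
  obtain s t where st: "E' = add_mset (s, [], t) E" "f s = t" "f t = s" using l' fl by auto
  let ?A = "map (map Leg) (rep l' [l', l] G)"
  have ren: "rename f (chords (rep l' [l, l'] G) E') = BDiag ?A {#} (add_mset (t, [], s) E)"
    unfolding chords_def rename_Leg fG by (simp add: st fE)
  have bA: "beaded_diagram n m (BDiag ?A {#} (add_mset (s, [], t) E))"
    using b[of "[l', l]"] by (simp add: chords_def st)
  have bA': "beaded_diagram n m (BDiag ?A {#} (add_mset (t, [], s) E))"
    using beaded_diagram_reverse[OF bA, of "[]"] by simp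
  have "bead_move n (chords (rep l' [l, l'] G) E') (BDiag ?A {#} (add_mset (t, [], s) E))"
    unfolding ren[symmetric] by (rule bead_move.isomorphism[OF inj])
  then have 1: "(chords (rep l' [l, l'] G) E', BDiag ?A {#} (add_mset (t, [], s) E)) \<in> bead_equiv n m"
    using b bA' by (intro bead_equiv_step) auto
  have "(chords (rep l' [l, l'] G) E', chords (rep l' [l', l] G) E') \<in> bead_equiv n m"
    using bead_equiv_trans[OF 1 edge_reverse_unbeaded[OF bA']] by (simp add: chords_def st)
  then show ?thesis
    using b bead_equiv_mod_eq unfolding mod_eq_def by blast
qed

text \<open>
  Moving \<open>l\<close> from the beginning to the end of a list, one entry at a time.
\<close>

lemma telescope:
  fixes \<Phi> :: "nat list \<Rightarrow> 'v::ab_group_add"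
  defines "r \<equiv> \<lambda>k ws xs. concat (map (\<lambda>y. if y = k then ws else [y]) xs)"
  assumes "distinct xs"
  shows "\<Phi> (us @ l # xs) - \<Phi> (us @ xs @ [l]) = (\<Sum>k\<in>set xs. \<Phi> (us @ r k [l, k] xs) - \<Phi> (us @ r k [k, l] xs))"
  using assms(2)
proof (induction xs arbitrary: us)
  case (Cons k xs)
  have k: "r k ws xs = xs" for ws
    using Cons.prems unfolding r_def by (induction xs) auto
  have "(\<Sum>k'\<in>set xs. \<Phi> (us @ r k' [l, k'] (k # xs)) - \<Phi> (us @ r k' [k', l] (k # xs)))
    = (\<Sum>k'\<in>set xs. \<Phi> ((us @ [k]) @ r k' [l, k'] xs) - \<Phi> ((us @ [k]) @ r k' [k', l] xs))"
    using Cons.prems by (intro sum.cong) (auto simp: r_def)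
  also have "\<dots> = \<Phi> (us @ k # l # xs) - \<Phi> (us @ k # xs @ [l])"
    using Cons.IH[of "us @ [k]"] Cons.prems by simp
  finally have "(\<Sum>k'\<in>set (k # xs). \<Phi> (us @ r k' [l, k'] (k # xs)) - \<Phi> (us @ r k' [k', l] (k # xs)))
    = \<Phi> (us @ r k [l, k] (k # xs)) - \<Phi> (us @ r k [k, l] (k # xs)) + (\<Phi> (us @ k # l # xs) - \<Phi> (us @ k # xs @ [l]))"
    using Cons.prems by simp
  moreover have "r k [l, k] (k # xs) = l # k # xs" "r k [k, l] (k # xs) = k # l # xs"
    using k by (simp_all add: r_def)
  ultimately show ?case by simp
qed simp

lemma sum_mset_ends: "(\<Sum>k\<in>#ends E. (\<Delta> k :: 'v::comm_monoid_add)) = (\<Sum>(s, ws, t)\<in>#E. \<Delta> s + \<Delta> t)"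
  by (induction E) (auto simp: add.assoc)

lemma relations_sum_mset: "(\<And>e. e \<in># F \<Longrightarrow> f e \<in> relations n m) \<Longrightarrow> (\<Sum>e\<in>#F. f e) \<in> relations n m"
  by (induction F) (auto simp: relations_0 relations_add)

text \<open>
  Moving \<open>l\<close> from the beginning to the end of every arc makes it pass each leg once.  The contributions
  of the two ends of a chord cancel, and the other end of \<open>l\<close> contributes nothing.
\<close>

lemma four_term:
  assumes len: "length G = m" and dist: "distinct (l # concat G)"
    and halves: "mset (l # concat G) = ends E" and unbeaded: "\<forall>(s, ws, t) \<in># E. ws = []"
  shows "(\<Sum>j<m. dgm (chords (G[j := l # G ! j]) E) - dgm (chords (G[j := G ! j @ [l]]) E)) \<in> (relations n m :: (bdiag \<Rightarrow>\<^sub>0 'k::field) set)"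
proof -
  define \<Delta> where "\<Delta> k = (dgm (chords (rep k [l, k] G) E) - dgm (chords (rep k [k, l] G) E) :: bdiag \<Rightarrow>\<^sub>0 'k)" for k
  have dG: "distinct (concat G)" using dist by simp
  have disj: "k \<notin> set (G ! i)" if "i < m" "j < m" "i \<noteq> j" "k \<in> set (G ! j)" for i j k
    using distinct_concat_nth_inj[OF dG] that len by (metis in_set_conv_nth)
  have "(\<Sum>j<m. dgm (chords (G[j := l # G ! j]) E) - dgm (chords (G[j := G ! j @ [l]]) E)) = (\<Sum>j<m. \<Sum>k\<in>set (G ! j). \<Delta> k)"
  proof (rule sum.cong[OF refl])
    fix j assume "j \<in> {..<m}"
    then have j: "j < m" by simp
    let ?r = "\<lambda>k ws xs. concat (map (\<lambda>y. if y = k then ws else [y]) xs)"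
    have r: "G[j := ?r k ws (G ! j)] = rep k ws G" if k: "k \<in> set (G ! j)" for k ws
    proof (rule nth_equalityI)
      fix i assume "i < length (G[j := ?r k ws (G ! j)])"
      then have i: "i < m" using len by simp
      show "G[j := ?r k ws (G ! j)] ! i = rep k ws G ! i"
      proof (cases "i = j")
        case False
        then have "rep k ws [G ! i] = [G ! i]"
          using disj[OF i j _ k] by (intro rep_fresh) simp
        then show ?thesis using False i len by (simp add: rep_def)
      qed (use i len in \<open>simp add: rep_def\<close>)
    qed simp
    have "distinct (G ! j)" using dG j len by (auto simp: distinct_concat_iff)
    from telescope[OF this, of "\<lambda>ys. dgm (chords (G[j := ys]) E)" "[]" l]
    show "dgm (chords (G[j := l # G ! j]) E) - dgm (chords (G[j := G ! j @ [l]]) E) = (\<Sum>k\<in>set (G ! j). \<Delta> k)"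
      by (simp add: r \<Delta>_def)
  qed
  also have "\<dots> = (\<Sum>k\<in>(\<Union>j<m. set (G ! j)). \<Delta> k)"
    using disj by (intro sum.UNION_disjoint[symmetric]) auto
  also have "(\<Union>j<m. set (G ! j)) = set (concat G)"
  proof -
    have "set G = (\<lambda>j. G ! j) ` {..<m}" using len by (auto simp: set_conv_nth)
    then show ?thesis by (simp only: set_concat image_image)
  qed
  also have "(\<Sum>k\<in>set (concat G). \<Delta> k) = (\<Sum>k\<in>#mset (concat G). \<Delta> k)"
    using dG by (metis sum_unfold_sum_mset mset_set_set)
  finally have eq: "(\<Sum>j<m. dgm (chords (G[j := l # G ! j]) E) - dgm (chords (G[j := G ! j @ [l]]) E)) = (\<Sum>k\<in>#mset (concat G). \<Delta> k)" .
  have "l \<in># ends E" using halves by (metis list.set_intros(1) set_mset_mset)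
  then obtain s ws t where "(s, ws, t) \<in># E" "l = s \<or> l = t" by force
  moreover from this have "ws = []" using unbeaded by auto
  ultimately obtain E0 where "E = add_mset (s, [], t) E0" "l = s \<or> l = t"
    by (meson multi_member_split)
  then obtain l' where E0: "E = add_mset (l, [], l') E0 \<or> E = add_mset (l', [], l) E0"
    by blast
  then have ends: "ends E = {#l, l'#} + ends E0" by (auto simp: add_mset_commute)
  have "mset (concat G) = add_mset l' (ends E0)"
    using halves unfolding ends by simp
  then have "(\<Sum>k\<in>#mset (concat G). \<Delta> k) = \<Delta> l' + (\<Sum>(s, ws, t)\<in>#E0. \<Delta> s + \<Delta> t)"
    by (simp add: sum_mset_ends)
  moreover have "\<Delta> l' \<in> relations n m"
    unfolding \<Delta>_def using four_term_own_end[OF len dist halves unbeaded E0] .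
  moreover have "(\<Sum>(s, ws, t)\<in>#E0. \<Delta> s + \<Delta> t) \<in> relations n m"
  proof (rule relations_sum_mset)
    fix e assume "e \<in># E0"
    then obtain E1 where E1: "E0 = add_mset e E1" by (meson multi_member_split)
    obtain s ws t where e: "e = (s, ws, t)" by (cases e) auto
    have ws: "ws = []" using unbeaded E0 E1 by (auto simp: e)
    obtain E2 where E: "E = add_mset (s, [], t) E2" and E2: "E2 = add_mset (l, [], l') E1 \<or> E2 = add_mset (l', [], l) E1"
    proof -
      have "E = add_mset (s, [], t) (add_mset (l, [], l') E1) \<or> E = add_mset (s, [], t) (add_mset (l', [], l) E1)"
        using E0 unfolding E1 e ws by (simp only: add_mset_commute[of "(s, [], t)"])
      then show ?thesis using that by blast
    qed
    have "\<Delta> s + \<Delta> t \<in> relations n m"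
      unfolding \<Delta>_def E
    proof (rule four_term_chord[OF len dist])
      show "mset (l # concat G) = ends (add_mset (s, [], t) E2)" using halves by (simp only: E)
      show "\<forall>(s, ws, t) \<in># E2. ws = []" using unbeaded by (simp add: E)
      show "(l, [], l') \<in># E2 \<or> (l', [], l) \<in># E2" using E2 by auto
    qed
    then show "(case e of (s, ws, t) \<Rightarrow> \<Delta> s + \<Delta> t) \<in> relations n m" by (simp add: e)
  qed
  ultimately show ?thesis
    unfolding eq using relations_add by simp
qed


section \<open>Trivial action of inner automorphisms\<close>

lemma conj_hom:
  assumes "a \<in> carrier (free_group m)"
  shows "(\<lambda>w. a \<otimes>\<^bsub>free_group m\<^esub> w \<otimes>\<^bsub>free_group m\<^esub> inv\<^bsub>free_group m\<^esub> a) \<in> hom (free_group m) (free_group m)"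
proof (rule homI)
  fix x y assume x: "x \<in> carrier (free_group m)" and y: "y \<in> carrier (free_group m)"
  have "(a \<otimes>\<^bsub>free_group m\<^esub> x \<otimes>\<^bsub>free_group m\<^esub> inv\<^bsub>free_group m\<^esub> a) \<otimes>\<^bsub>free_group m\<^esub> (a \<otimes>\<^bsub>free_group m\<^esub> y \<otimes>\<^bsub>free_group m\<^esub> inv\<^bsub>free_group m\<^esub> a)
    = a \<otimes>\<^bsub>free_group m\<^esub> x \<otimes>\<^bsub>free_group m\<^esub> (inv\<^bsub>free_group m\<^esub> a \<otimes>\<^bsub>free_group m\<^esub> a) \<otimes>\<^bsub>free_group m\<^esub> y \<otimes>\<^bsub>free_group m\<^esub> inv\<^bsub>free_group m\<^esub> a"
    using assms x y by (simp only: F.m_assoc F.m_closed F.inv_closed)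
  then show "a \<otimes>\<^bsub>free_group m\<^esub> (x \<otimes>\<^bsub>free_group m\<^esub> y) \<otimes>\<^bsub>free_group m\<^esub> inv\<^bsub>free_group m\<^esub> a
    = (a \<otimes>\<^bsub>free_group m\<^esub> x \<otimes>\<^bsub>free_group m\<^esub> inv\<^bsub>free_group m\<^esub> a) \<otimes>\<^bsub>free_group m\<^esub> (a \<otimes>\<^bsub>free_group m\<^esub> y \<otimes>\<^bsub>free_group m\<^esub> inv\<^bsub>free_group m\<^esub> a)"
    using assms x y by (simp add: F.m_assoc)
qed (use assms in simp)

definition conj_words :: "nat \<Rightarrow> word \<Rightarrow> word list" where
  "conj_words m a = map (\<lambda>j. a @ gen j @ inv_word a) [0..<m]"

lemma gen_images_conj:
  assumes "a \<in> carrier (free_group m)"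
  shows "gen_images (\<lambda>w. a \<otimes>\<^bsub>free_group m\<^esub> w \<otimes>\<^bsub>free_group m\<^esub> inv\<^bsub>free_group m\<^esub> a) m = map reduce (conj_words m a)"
  using assms by (simp add: conj_words_def inv_free_group free_group_simps(2))

lemma conj_words_letters:
  assumes "a \<in> carrier (free_group m)"
  shows "\<forall>w \<in> set (conj_words m a). \<forall>x \<in> set w. fst x < m"
  using assms by (auto simp: conj_words_def free_group_simps set_inv_word)

text \<open>
  It suffices to look at diagrams, and the conjugates of the generators need not be reduced.
\<close>

lemma outer_functorI:
  assumes "\<And>m a D. \<lbrakk>a \<in> carrier (free_group m); D \<in> trivial_diagrams d n m\<rbrakk> \<Longrightarrow>
    mod_eq n m (lact n (copies_of (conj_words m a)) D) (dgm D :: bdiag \<Rightarrow>\<^sub>0 'k::field_char_0)"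
  shows "outer_functor (A_deg_trivial d n :: nat \<Rightarrow> ('k, (bdiag \<Rightarrow>\<^sub>0 'k) set) module) (A_mor n)"
proof (rule outer_functor.intro[OF gr_op_functor_A_deg_trivial], rule outer_functor_axioms.intro)
  fix a m and X :: "(bdiag \<Rightarrow>\<^sub>0 'k) set"
  assume a: "a \<in> carrier (free_group m)" and "X \<in> carrier (A_deg_trivial d n m)"
  then obtain v where v: "X = rel_coset n m v" "v \<in> diagrams.span (dgm ` trivial_diagrams d n m)"
    unfolding A_deg_trivial_eq by (auto simp: A_span_simps)
  let ?L = "copies_of (map reduce (conj_words m a))"
  have "mod_eq n m (linear_ext scale (lact n ?L) v) (linear_ext scale dgm v)"
    using v(2)
  proof (rule linear_ext_mod_eq)
    fix D assume D: "D \<in> trivial_diagrams d n m"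
    then have "beaded_diagram n m D" by (simp add: trivial_diagrams_def)
    moreover have "length (conj_words m a) = m" by (simp add: conj_words_def)
    ultimately have "mod_eq n m (lact n (copies_of (conj_words m a)) D) (lact n ?L D :: bdiag \<Rightarrow>\<^sub>0 'k)"
      using lact_reduce[of n m D "conj_words m a"] conj_words_letters[OF a] by simp
    then have "mod_eq n m (lact n ?L D) (lact n (copies_of (conj_words m a)) D :: bdiag \<Rightarrow>\<^sub>0 'k)"
      by (rule mod_eq_sym)
    then show "mod_eq n m (linear_ext scale (lact n ?L) (dgm D)) (linear_ext scale dgm (dgm D) :: bdiag \<Rightarrow>\<^sub>0 'k)"
      unfolding linear_ext_dgm[OF vector_space_scale] using assms[OF a D] mod_eq_trans by blast
  qed
  moreover have "linear_ext scale dgm v = v"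
    using v(2) by (rule linear_ext_dgm_id)
  ultimately show "A_mor n m m (\<lambda>w. a \<otimes>\<^bsub>free_group m\<^esub> w \<otimes>\<^bsub>free_group m\<^esub> inv\<^bsub>free_group m\<^esub> a) X = X"
    unfolding v(1) A_mor_rel_coset[OF conj_hom[OF a]] rel_coset_eq act_eq_lact gen_images_conj[OF a] by simp
qed


subsection \<open>Degree zero\<close>

lemma size_vertex_halves: "size (vertex_halves D) = size (legs_mset D) + 3 * size (tris D)"
proof -
  have "size (\<Sum>(a, b, c) \<in># V. {#a, b, c#}) = 3 * size V" for V :: "(nat \<times> nat \<times> nat) multiset"
    by (induction V) auto
  then show ?thesis by (simp add: vertex_halves_def)
qed

lemma size_edge_halves: "size (edge_halves D) = 2 * size (edges D)"
proof -
  have "size (\<Sum>(s, ws, t) \<in># E. {#s, t#}) = 2 * size E" for E :: "(nat \<times> word list \<times> nat) multiset"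
    by (induction E) auto
  then show ?thesis by (simp add: edge_halves_def)
qed

text \<open>
  Counting half-edges, the number of legs plus three times the number of trivalent vertices is even.
\<close>

lemma degree_0_empty:
  assumes D: "beaded_diagram n m D" and "degree D = 0"
  shows "legs D = {}" "tris D = {#}" "edges D = {#}"
proof -
  have "size (legs_mset D) + 3 * size (tris D) = 2 * size (edges D)"
    using D size_vertex_halves[of D] size_edge_halves[of D] by (simp add: beaded_diagram_def)
  moreover have "size (legs_mset D) + size (tris D) < 2"
    using assms(2) by (simp add: degree_def)
  ultimately have "size (legs_mset D) = 0" "size (tris D) = 0" "size (edges D) = 0"
    by presburger+
  then show "legs D = {}" "tris D = {#}" "edges D = {#}" by simp_all
qed

lemma degree_0_trivial:
  assumes "D \<in> trivial_diagrams 0 n m"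
  shows "mod_eq n m (dgm D) (dgm (BDiag (replicate m []) {#} {#}) :: bdiag \<Rightarrow>\<^sub>0 'k::field)"
proof -
  have D: "beaded_diagram n m D" "degree D = 0" "homotopically_trivial n D"
    using assms by (simp_all add: trivial_diagrams_def)
  note e = degree_0_empty[OF D(1,2)]
  have len: "length (arcs D) = m" using D(1) by (rule beaded_diagram_length)
  have "arc_eq n p []" if "p \<in> set (arcs D)" for p
  proof -
    have "leg_seq p = []"
    proof -
      have "set (leg_seq p) \<subseteq> legs D" using that by (auto simp: legs_eq in_set_conv_nth[of p])
      then show ?thesis unfolding e(1) subset_empty set_empty .
    qed
    moreover have "beads_in n p" using D(1) that by (rule beaded_diagram_beads_in)
    ultimately have "arc_eq n p [Bead (bead_product n p)]"
      unfolding bead_product_def by (rule arc_eq_bead_product)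
    also have "bead_product n p = \<one>\<^bsub>free_group n\<^esub>"
      using D(3) that by (simp add: homotopically_trivial_iff)
    finally show ?thesis using arc_eq.arc_unit arc_eq.arc_trans by blast
  qed
  then have "list_all2 (arc_eq n) (arcs D) (replicate m [])"
    by (simp add: list_all2_conv_all_nth len)
  then have "mod_eq n m (dgm (BDiag (arcs D) (tris D) (edges D))) (dgm (BDiag (replicate m []) (tris D) (edges D)) :: bdiag \<Rightarrow>\<^sub>0 'k)"
    using D(1) by (intro arc_eq_mod_eq) simp_all
  then show ?thesis using e by (cases D) simp
qed

text \<open>
  Diagrams of degree \<open>0\<close> only consist of beads on arcs, whose products are \<open>1\<close>.
\<close>

lemma outer_functor_degree_0:
  "outer_functor (A_deg_trivial 0 n :: nat \<Rightarrow> ('k::field_char_0, (bdiag \<Rightarrow>\<^sub>0 'k) set) module) (A_mor n)"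
proof (rule outer_functorI)
  fix m a D assume a: "a \<in> carrier (free_group m)" and D: "D \<in> trivial_diagrams 0 n m"
  let ?L = "copies_of (conj_words m a)"
  have L: "copying m ?L" unfolding copying_copies_of using a by (rule conj_words_letters)
  have bD: "beaded_diagram n m D" "degree D = 0" "homotopically_trivial n D"
    using D by (simp_all add: trivial_diagrams_def)
  note e = degree_0_empty[OF bD(1,2)]
  define \<chi> :: "nat \<Rightarrow> nat \<times> nat" where "\<chi> = (\<lambda>_. undefined)"
  have \<chi>: "\<chi> \<in> lattachments ?L D" by (simp add: lattachments_def e(1) \<chi>_def)
  have "lattach n ?L \<chi> D \<in> trivial_diagrams 0 n m"
    using lattach_beaded[OF bD(1) L \<chi>] lattach_degree[OF bD(1) L \<chi>] lattach_homotopically_trivial[OF bD(1) L bD(3)] bD(2)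
    by (simp add: trivial_diagrams_def conj_words_def)
  from degree_0_trivial[OF this] degree_0_trivial[OF D]
  have "mod_eq n m (dgm (lattach n ?L \<chi> D)) (dgm D :: bdiag \<Rightarrow>\<^sub>0 'k)"
    using mod_eq_sym mod_eq_trans by blast
  moreover have "lact n ?L D = (dgm (lattach n ?L \<chi> D) :: bdiag \<Rightarrow>\<^sub>0 'k)"
    using lact_unique_places[of D ?L \<chi> n] L beaded_diagram_length[OF bD(1)] by (simp add: e(1))
  ultimately show "mod_eq n m (lact n ?L D) (dgm D :: bdiag \<Rightarrow>\<^sub>0 'k)" by simp
qed


subsection \<open>Resolving trivalent vertices\<close>

lemma rtrancl_exit:
  assumes "(x, y) \<in> r\<^sup>*" "x \<in> T" "y \<notin> T"
  obtains u v where "(u, v) \<in> r" "u \<in> T" "v \<notin> T"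
  using assms by (induction rule: rtrancl_induct) blast+

text \<open>
  A path from a trivalent vertex to a leg leaves the set of half-edges at trivalent vertices through
  an edge, whose other end is then a leg.
\<close>

lemma trivalent_leg_edge:
  assumes D: "beaded_diagram n m D" and "tris D \<noteq> {#}"
  obtains h x ws where "h \<in> legs D" "x \<in># (\<Sum>(a, b, c) \<in># tris D. {#a, b, c#})" "(h, ws, x) \<in># edges D \<or> (x, ws, h) \<in># edges D"
proof -
  define T where "T = set_mset (\<Sum>(a, b, c) \<in># tris D. {#a, b, c#})"
  have cnt: "count (vertex_halves D) h \<le> 1" for h using D unfolding beaded_diagram_def by blast
  have disj: "h \<notin> T" if "h \<in> legs D" for h
  proof
    assume "h \<in> T"
    then have "count (\<Sum>(a, b, c) \<in># tris D. {#a, b, c#}) h \<ge> 1" "count (legs_mset D) h \<ge> 1"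
      using that unfolding T_def by (simp_all only: Suc_le_eq One_nat_def count_greater_zero_iff)
    moreover have "count (legs_mset D) h + count (\<Sum>(a, b, c) \<in># tris D. {#a, b, c#}) h \<le> 1"
      using cnt[of h] unfolding vertex_halves_def count_union .
    ultimately show False by linarith
  qed
  have halves: "halves D = legs D \<union> T" by (simp only: vertex_halves_def T_def set_mset_union)
  obtain a b c where abc: "(a, b, c) \<in># tris D" using assms(2) by (metis multiset_nonemptyE prod_cases3)
  have inT: "y \<in> T" if "(a, b, c) \<in># tris D" "y \<in> {a, b, c}" for a b c y
    using that unfolding T_def by force
  have a: "a \<in> T" using inT[OF abc] by simp
  have "\<exists>l \<in> legs D. (a, l) \<in> (joined D \<union> (joined D)\<inverse>)\<^sup>*"
    using D a halves unfolding beaded_diagram_def by blast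
  then obtain l where l: "l \<in> legs D" "(a, l) \<in> (joined D \<union> (joined D)\<inverse>)\<^sup>*" by blast
  obtain u v where uv: "(u, v) \<in> joined D \<union> (joined D)\<inverse>" "u \<in> T" "v \<notin> T"
    using rtrancl_exit[OF l(2) a disj[OF l(1)]] .
  then obtain ws where ws: "(v, ws, u) \<in># edges D \<or> (u, ws, v) \<in># edges D"
    unfolding joined_def using inT by blast
  then have "v \<in># ends (edges D)" using in_ends by blast
  then have "v \<in> halves D" using D unfolding beaded_diagram_def edge_halves_def by simp
  then show ?thesis using that[of v u ws] ws uv halves unfolding T_def by blast
qed

text \<open>
  For connectivity, follow a path in the old diagram up to the first of \<open>a\<close> and \<open>b\<close>, which are legs of
  the new one; before that point, it avoids the half-edges \<open>h\<close> and \<open>x\<close> that have disappeared.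
\<close>

lemma beaded_stu:
  assumes D: "beaded_diagram n m (BDiag (A @ (p @ Leg h # q) # B) (add_mset (x, b, a) V) (add_mset (h, [], x) E))"
  shows "beaded_diagram n m (BDiag (A @ (p @ Leg a # Leg b # q) # B) V E)"
proof -
  let ?D = "BDiag (A @ (p @ Leg h # q) # B) (add_mset (x, b, a) V) (add_mset (h, [], x) E)"
  let ?D1 = "BDiag (A @ (p @ Leg a # Leg b # q) # B) V E"
  let ?T = "\<Sum>(a, b, c) \<in># V. {#a, b, c#}"
  define Lg where "Lg = mset (leg_seq (concat A)) + mset (leg_seq p) + mset (leg_seq q) + mset (leg_seq (concat B))"
  have v: "vertex_halves ?D = {#h, x#} + {#a, b#} + Lg + ?T" and v1: "vertex_halves ?D1 = {#a, b#} + Lg + ?T"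
    and l: "legs_mset ?D = add_mset h Lg" and l1: "legs_mset ?D1 = {#a, b#} + Lg"
    by (simp_all add: vertex_halves_BDiag legs_mset_BDiag Lg_def)
  have cnt: "count (vertex_halves ?D) y \<le> 1" for y using D unfolding beaded_diagram_def by blast
  have ve: "vertex_halves ?D = edge_halves ?D" using D unfolding beaded_diagram_def by blast
  moreover have "edge_halves ?D = {#h, x#} + ends E" by (simp add: edge_halves_BDiag)
  ultimately have "{#h, x#} + ({#a, b#} + Lg + ?T) = {#h, x#} + ends E" unfolding v by (simp only: add.assoc)
  then have ve1: "vertex_halves ?D1 = ends E" unfolding v1 by (simp only: add_left_cancel)
  have fresh: "y \<notin># ends E" "y \<notin># {#a, b#} + Lg + ?T" if "y \<in> {h, x}" for y
  proof -
    have "count {#h, x#} y \<ge> 1" using that by auto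
    moreover have "count {#h, x#} y + count ({#a, b#} + Lg + ?T) y \<le> 1"
      using cnt[of y] unfolding v by (simp only: count_union add.assoc)
    ultimately have "count ({#a, b#} + Lg + ?T) y = 0" by linarith
    then show "y \<notin># {#a, b#} + Lg + ?T" by (simp only: count_eq_zero_iff not_False_eq_True)
    then show "y \<notin># ends E" unfolding ve1[symmetric] v1 .
  qed
  let ?r = "joined ?D \<union> (joined ?D)\<inverse>" and ?r1 = "joined ?D1 \<union> (joined ?D1)\<inverse>"
  have r1: "(y, z) \<in> ?r1 \<and> z \<notin> {h, x}" if "(y, z) \<in> ?r" "y \<notin> {h, x, a, b}" for y z
  proof -
    have T: "y \<in># ?T" if "(a, b, c) \<in># V" "y \<in> {a, b, c}" for a b c y
      using that by force
    have "(\<exists>ws. (y, ws, z) \<in># E \<or> (z, ws, y) \<in># E) \<or> (\<exists>a b c. (a, b, c) \<in># V \<and> y \<in> {a, b, c} \<and> z \<in> {a, b, c})"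
      using that unfolding joined_BDiag by auto
    then show ?thesis
    proof
      assume "\<exists>ws. (y, ws, z) \<in># E \<or> (z, ws, y) \<in># E"
      moreover from this have "z \<in># ends E" using in_ends by blast
      ultimately show ?thesis using fresh(1) unfolding joined_BDiag by blast
    next
      assume yz: "\<exists>a b c. (a, b, c) \<in># V \<and> y \<in> {a, b, c} \<and> z \<in> {a, b, c}"
      then have "z \<in># ?T" using T by blast
      then have "z \<in># {#a, b#} + Lg + ?T" by (simp only: union_iff simp_thms)
      then have "z \<notin> {h, x}" using fresh(2) by blast
      moreover have "(y, z) \<in> joined ?D1" using yz unfolding joined_BDiag by blast
      ultimately show ?thesis by blast
    qed
  qed
  have conn: "\<exists>l \<in> legs ?D1. (y, l) \<in> ?r1\<^sup>*" if "(y, l) \<in> ?r\<^sup>*" "l \<in> legs ?D" "y \<notin> {h, x}" for y l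
    using that
  proof (induction rule: converse_rtrancl_induct)
    case base
    then show ?case unfolding l l1 by auto
  next
    case (step y z)
    show ?case
    proof (cases "y \<in> {a, b}")
      case True
      then have "y \<in> legs ?D1" unfolding l1 by auto
      then show ?thesis by blast
    next
      case False
      then have "(y, z) \<in> ?r1" "z \<notin> {h, x}" using r1[OF step.hyps(1)] step.prems(2) by auto
      then show ?thesis using step.IH step.prems(1) by (meson converse_rtrancl_into_rtrancl)
    qed
  qed
  have "\<exists>l \<in> legs ?D1. (y, l) \<in> ?r1\<^sup>*" if "y \<in> halves ?D1" for y
  proof -
    have "y \<notin> {h, x}" using that fresh(2) unfolding v1 by blast
    moreover have "y \<in> halves ?D" using that unfolding v v1 by auto
    then have "\<exists>l \<in> legs ?D. (y, l) \<in> ?r\<^sup>*" using D unfolding beaded_diagram_def by blast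
    ultimately show ?thesis using conn by blast
  qed
  moreover have "vertex_halves ?D1 = edge_halves ?D1" by (simp add: ve1 edge_halves_BDiag)
  moreover have "count (vertex_halves ?D1) y \<le> 1" for y
    using cnt[of y] unfolding v v1 by (simp only: count_union)
  moreover have "length (arcs ?D1) = m" using beaded_diagram_length[OF D] by simp
  moreover have "\<forall>arc \<in> set (arcs ?D1). beads_in n arc"
  proof -
    have "\<forall>arc \<in> set (arcs ?D). beads_in n arc" using beaded_diagram_beads_in[OF D] by blast
    then show ?thesis by auto
  qed
  moreover have "\<forall>(s, ws, t) \<in># edges ?D1. set ws \<subseteq> carrier (free_group n)"
    using D unfolding beaded_diagram_def by auto
  ultimately show ?thesis
    unfolding beaded_diagram_def beads_in_def by blast
qed


subsection \<open>Conjugation by a free generator\<close>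

text \<open>
  The conjugation of the generators of \<open>F\<^sub>m\<close> by one more generator \<open>x\<^sub>m\<close>.  Substituting \<open>a\<close> for \<open>x\<^sub>m\<close> gives
  the conjugation by \<open>a\<close>; see \<open>conj_words_factor\<close>.
\<close>

definition gen_conj :: "nat \<Rightarrow> word list" where
  "gen_conj m = map (\<lambda>j. [(m, True), (j, True), (m, False)]) [0..<m]"

definition gen_conj_copies :: "nat \<Rightarrow> ((nat \<times> nat) \<times> letter) list list" where
  "gen_conj_copies m = map (\<lambda>j. [((j, 0), m, True), ((j, 1), j, True), ((j, 2), m, False)]) [0..<m]"

lemma copies_of_gen_conj: "copies_of (gen_conj m) = gen_conj_copies m"
proof -
  have "[0..<3] = [0, 1, 2::nat]" by (simp add: upt_rec)
  then show ?thesis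
    by (auto simp: copies_of_def gen_conj_def gen_conj_copies_def numeral_3_eq_3)
qed

lemma length_gen_conj_copies [simp]: "length (gen_conj_copies m) = m"
  by (simp add: gen_conj_copies_def)

lemma set_gen_conj_copies: "(l, p, e) \<in> set (concat (gen_conj_copies m)) \<longleftrightarrow>
    (\<exists>j < m. l = (j, 0) \<and> p = m \<and> e \<or> l = (j, 1) \<and> p = j \<and> e \<or> l = (j, 2) \<and> p = m \<and> \<not> e)"
  by (auto simp: gen_conj_copies_def)

lemma copying_gen_conj: "copying (Suc m) (gen_conj_copies m)"
  unfolding copies_of_gen_conj[symmetric] copying_copies_of by (auto simp: gen_conj_def)

lemma lsign_gen_conj:
  "lsign (gen_conj_copies m) (j, 0) = 1" "lsign (gen_conj_copies m) (j, 1) = 1"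
  "j < m \<Longrightarrow> lsign (gen_conj_copies m) (j, 2) = - 1"
  unfolding lsign_def set_gen_conj_copies by auto

lemma keep_map_Leg: "keep \<chi> l (map Leg xs) = map Leg (filter (\<lambda>h. \<chi> h = l) xs)"
  by (induction xs) auto

lemma orient_map_Leg: "orient n e (map Leg xs) = map Leg (if e then xs else rev xs)"
  by (simp add: orient_def rev_map comp_def)

lemma mset_concat_update:
  assumes "j < length G" "mset ys = add_mset l (mset (G ! j))"
  shows "mset (concat (G[j := ys])) = add_mset l (mset (concat G))"
proof -
  have "concat G = concat (take j G) @ G ! j @ concat (drop (Suc j) G)"
    using id_take_nth_drop[OF assms(1)] by (metis concat.simps(2) concat_append)
  then show ?thesis
    using assms by (simp add: upd_conv_take_nth_drop)
qed

text \<open>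
  The first leg \<open>l\<close> on the arc \<open>m\<close> comes first on all other arcs when it is attached to copies of \<open>x\<^sub>m\<close>,
  and last, with a minus sign, when it is attached to copies of the inverse.  For fixed attachments of the other
  legs, the sum over the attachments of \<open>l\<close> is thus a sum of four-term relations.
\<close>

lemma gen_conj_kills_chords:
  assumes D: "beaded_diagram n (Suc m) (chords H E)" and H: "H ! m \<noteq> []" and unbeaded: "\<forall>(s, ws, t) \<in># E. ws = []"
  shows "lact n (gen_conj_copies m) (chords H E) \<in> (relations n m :: (bdiag \<Rightarrow>\<^sub>0 'k::field) set)"
proof -
  let ?L = "gen_conj_copies m" and ?D = "chords H E"
  have len: "length H = Suc m" using beaded_diagram_length[OF D] by (simp add: chords_def)
  obtain l ys where lys: "H ! m = l # ys" using H by (cases "H ! m") auto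
  have distH: "distinct (concat H)" using distinct_leg_seq[OF D] by (simp add: chords_def)
  have arcs: "arcs ?D = map (map Leg) H" by (simp add: chords_def)
  have halves: "mset (concat H) = ends E"
  proof -
    have "vertex_halves ?D = edge_halves ?D" using D unfolding beaded_diagram_def by blast
    then show ?thesis by (simp add: chords_def vertex_halves_BDiag edge_halves_BDiag)
  qed
  define R where "R = set (concat H) - {l}"
  have l: "l \<in> set (concat H)" using lys len by (metis UN_I lessI list.set_intros(1) nth_mem set_concat)
  then have legs: "legs ?D = insert l R"
    unfolding R_def chords_def legs_mset_BDiag leg_seq_concat_Leg set_mset_mset by blast
  have lR: "l \<notin> R" by (simp add: R_def)
  have finR: "finite R" by (simp add: R_def)
  have lys': "l \<notin> set ys" "j < m \<Longrightarrow> l \<notin> set (H ! j)" for j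
  proof -
    have "distinct (H ! m)" using distH len by (auto simp: distinct_concat_iff)
    then show "l \<notin> set ys" by (simp add: lys)
    show "l \<notin> set (H ! j)" if "j < m"
    proof
      assume "l \<in> set (H ! j)"
      then obtain s where "s < length (H ! j)" "H ! j ! s = l" by (meson in_set_conv_nth)
      then show False using distinct_concat_nth_inj[OF distH, of j s m 0] len that lys by simp
    qed
  qed
  have pl: "places ?L ?D l = (\<lambda>j. (j, 0)) ` {..<m} \<union> (\<lambda>j. (j, 2)) ` {..<m}"
  proof -
    have "Leg l \<in> set (arcs ?D ! m)" using len lys by (simp add: arcs)
    then show ?thesis
      unfolding places_eq[OF D lessI \<open>Leg l \<in> set (arcs ?D ! m)\<close>] set_gen_conj_copies by auto
  qed
  define T where "T = places ?L ?D"
  define c where "c \<chi> = (\<Prod>h\<in>R. lsign ?L (\<chi> h) :: 'k)" for \<chi>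
  let ?F = "\<lambda>\<chi> y. scale (c \<chi>) (dgm (lattach n ?L (\<chi>(l := y)) ?D)) :: bdiag \<Rightarrow>\<^sub>0 'k"
  have c_upd: "c (\<chi>(l := y)) = c \<chi>" for \<chi> y
    unfolding c_def using lR by (intro prod.cong) auto
  have pr: "(\<Prod>h\<in>insert l R. lsign ?L (\<chi> h)) = lsign ?L (\<chi> l) * c \<chi>" for \<chi>
    unfolding c_def using lR finR by simp
  have "lact n ?L ?D = (\<Sum>y\<in>T l. \<Sum>\<chi>\<in>Pi\<^sub>E R T. scale (lsign ?L y) (?F \<chi> y))"
    unfolding lact_def lattachments_def legs sum_PiE_insert[OF lR] pr T_def by (simp add: c_upd)
  also have "\<dots> = (\<Sum>\<chi>\<in>Pi\<^sub>E R T. \<Sum>y\<in>T l. scale (lsign ?L y) (?F \<chi> y))"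
    by (rule sum.swap)
  also have "\<dots> = (\<Sum>\<chi>\<in>Pi\<^sub>E R T. \<Sum>j<m. ?F \<chi> (j, 0) - ?F \<chi> (j, 2))"
  proof (rule sum.cong[OF refl])
    fix \<chi>
    have "(\<Sum>y\<in>T l. scale (lsign ?L y) (?F \<chi> y)) = (\<Sum>j<m. scale (lsign ?L (j, 0)) (?F \<chi> (j, 0))) + (\<Sum>j<m. scale (lsign ?L (j, 2)) (?F \<chi> (j, 2)))"
      unfolding T_def pl by (subst sum.union_disjoint) (auto simp: sum.reindex inj_on_def)
    also have "\<dots> = (\<Sum>j<m. ?F \<chi> (j, 0)) + (\<Sum>j<m. - ?F \<chi> (j, 2))"
      by (intro arg_cong2[of _ _ _ _ "(+)"] sum.cong) (auto simp: lsign_gen_conj)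
    finally show "(\<Sum>y\<in>T l. scale (lsign ?L y) (?F \<chi> y)) = (\<Sum>j<m. ?F \<chi> (j, 0) - ?F \<chi> (j, 2))"
      by (simp add: sum_negf sum_subtractf)
  qed
  finally have sum: "lact n ?L ?D = (\<Sum>\<chi>\<in>Pi\<^sub>E R T. \<Sum>j<m. ?F \<chi> (j, 0) - ?F \<chi> (j, 2))" .
  have "(\<Sum>j<m. ?F \<chi> (j, 0) - ?F \<chi> (j, 2)) \<in> relations n m" if \<chi>: "\<chi> \<in> Pi\<^sub>E R T" for \<chi>
  proof (cases "m = 0")
    case False
    define G where "G = map (\<lambda>k. filter (\<lambda>h. \<chi> h = (k, 0)) ys @ filter (\<lambda>h. \<chi> h = (k, 1)) (H ! k) @ rev (filter (\<lambda>h. \<chi> h = (k, 2)) ys)) [0..<m]"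
    have lenG: "length G = m" by (simp add: G_def)
    have fl: "filter (\<lambda>h. (\<chi>(l := y)) h = z) xs = filter (\<lambda>h. \<chi> h = z) xs" if "l \<notin> set xs" for y z xs
      using that by (intro filter_cong) auto
    have att: "lattach n ?L (\<chi>(l := y)) ?D = chords (G[j := ws]) E"
      if "j < m" "y = (j, 0) \<and> ws = l # G ! j \<or> y = (j, 2) \<and> ws = G ! j @ [l]" for j y ws
    proof -
      have "arcs (lattach n ?L (\<chi>(l := y)) ?D) = map (map Leg) (G[j := ws])"
      proof (rule nth_equalityI)
        fix k assume "k < length (arcs (lattach n ?L (\<chi>(l := y)) ?D))"
        then have k: "k < m" by (simp add: lattach_def)
        let ?f = "\<lambda>i xs. filter (\<lambda>h. (\<chi>(l := y)) h = (k, i)) xs"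
        let ?c = "lcopy n (arcs ?D) (\<chi>(l := y))"
        have Hk: "map (map Leg) H ! m = map Leg (l # ys)" "map (map Leg) H ! k = map Leg (H ! k)"
          using k len by (simp_all add: lys)
        have "arcs (lattach n ?L (\<chi>(l := y)) ?D) ! k = ?c ((k, 0), m, True) @ ?c ((k, 1), k, True) @ ?c ((k, 2), m, False)"
          using k by (simp add: lattach_def gen_conj_copies_def)
        also have "\<dots> = map Leg (?f 0 (l # ys) @ ?f 1 (H ! k) @ rev (?f 2 (l # ys)))"
          unfolding lcopy_def prod.case arcs Hk keep_map_Leg orient_map_Leg by (simp only: map_append if_True if_False)
        also have "?f 0 (l # ys) = (if y = (k, 0) then [l] else []) @ filter (\<lambda>h. \<chi> h = (k, 0)) ys"
          using fl[OF lys'(1)] by simp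
        also have "?f 2 (l # ys) = (if y = (k, 2) then [l] else []) @ filter (\<lambda>h. \<chi> h = (k, 2)) ys"
          using fl[OF lys'(1)] by simp
        also have "?f 1 (H ! k) = filter (\<lambda>h. \<chi> h = (k, 1)) (H ! k)"
          using fl[OF lys'(2)[OF k]] .
        finally have arc_k: "arcs (lattach n ?L (\<chi>(l := y)) ?D) ! k = map Leg (((if y = (k, 0) then [l] else []) @ filter (\<lambda>h. \<chi> h = (k, 0)) ys)
            @ filter (\<lambda>h. \<chi> h = (k, 1)) (H ! k) @ rev ((if y = (k, 2) then [l] else []) @ filter (\<lambda>h. \<chi> h = (k, 2)) ys))" .
        show "arcs (lattach n ?L (\<chi>(l := y)) ?D) ! k = map (map Leg) (G[j := ws]) ! k"
          unfolding arc_k using that k by (cases "k = j") (auto simp: G_def nth_list_update)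
      qed (simp add: lattach_def lenG)
      then show ?thesis by (simp add: lattach_def chords_def)
    qed
    have j0: "0 < m" using False by simp
    have "\<chi>(l := (0, 0)) \<in> lattachments ?L ?D"
      unfolding lattachments_def legs T_def[symmetric] using \<chi> j0
      by (intro PiE_fun_upd) (auto simp: T_def pl)
    from lattach_legs_mset[OF D copying_gen_conj this]
    have "mset (concat (G[0 := l # G ! 0])) = mset (concat H)"
      unfolding att[OF j0, of "(0, 0)" "l # G ! 0", simplified] by (simp only: chords_def legs_mset_BDiag leg_seq_concat_Leg)
    then have mG: "mset (l # concat G) = mset (concat H)"
      using mset_concat_update[of 0 G "l # G ! 0" l] j0 lenG by simp
    have "(\<Sum>j<m. dgm (chords (G[j := l # G ! j]) E) - dgm (chords (G[j := G ! j @ [l]]) E)) \<in> (relations n m :: (bdiag \<Rightarrow>\<^sub>0 'k) set)"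
    proof (rule four_term[OF lenG])
      show "distinct (l # concat G)" using mG distH mset_eq_imp_distinct_iff by blast
      show "mset (l # concat G) = ends E" using mG halves by simp
    qed (rule unbeaded)
    then have "scale (c \<chi>) (\<Sum>j<m. dgm (chords (G[j := l # G ! j]) E) - dgm (chords (G[j := G ! j @ [l]]) E)) \<in> relations n m"
      by (rule relations_scale)
    moreover have "(\<Sum>j<m. ?F \<chi> (j, 0) - ?F \<chi> (j, 2)) = scale (c \<chi>) (\<Sum>j<m. dgm (chords (G[j := l # G ! j]) E) - dgm (chords (G[j := G ! j @ [l]]) E))"
      unfolding diagrams.scale_sum_right diagrams.scale_right_diff_distrib
      using att by (intro sum.cong) auto
    ultimately show ?thesis by simp
  qed (simp add: relations_0)
  then show ?thesis unfolding sum by (rule relations_sum)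
qed


subsection \<open>Diagrams without beads\<close>

lemma leg_seq_eq_Nil: "leg_seq p = [] \<longleftrightarrow> (\<forall>h. Leg h \<notin> set p)"
proof (induction p)
  case (Cons x p)
  then show ?case by (cases x) auto
qed simp

lemma carrier_free_group_0: "carrier (free_group 0) = {[]}"
proof -
  have *: "(\<forall>a \<in> set w. fst a < 0) \<longleftrightarrow> w = []" for w :: word
    by (cases w) auto
  show ?thesis unfolding free_group_simps(1) * using reduced_Nil by blast
qed

text \<open>
  All beads are trivial when the group is.
\<close>

lemma arc_eq_0:
  assumes "beads_in 0 p" "beads_in 0 q" "leg_seq p = leg_seq q"
  shows "arc_eq 0 p q"
proof -
  have strip: "arc_eq 0 p (map Leg (leg_seq p))" if "beads_in 0 p" for p
    using that
  proof (induction p)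
    case (Cons x p)
    show ?case
    proof (cases x)
      case (Bead w)
      then have "x = Bead \<one>\<^bsub>free_group 0\<^esub>" using Cons.prems by (simp add: carrier_free_group_0 free_group_simps(3))
      moreover have "arc_eq 0 ([Bead \<one>\<^bsub>free_group 0\<^esub>] @ p) ([] @ map Leg (leg_seq p))"
        using Cons Bead by (intro arc_eq.arc_append arc_eq.arc_unit) auto
      ultimately show ?thesis by simp
    next
      case (Leg h)
      then show ?thesis using Cons by (auto intro: arc_eq_Cons)
    qed
  qed simp
  show ?thesis
    using strip[OF assms(1)] arc_eq.arc_sym[OF strip[OF assms(2)]] assms(3) arc_eq.arc_trans by metis
qed

lemma merge_beads_0: "set ws \<subseteq> carrier (free_group 0) \<Longrightarrow> merge_beads 0 (s, ws, t) = (s, [[]], t)"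
  using bead_product_words_closed[of ws 0] by (simp add: merge_beads_def carrier_free_group_0)

lemma edges_bead_equiv_0:
  assumes D: "beaded_diagram 0 m (BDiag A V (add_mset (s, ws, t) E))"
  shows "(BDiag A V (add_mset (s, ws, t) E), BDiag A V (add_mset (s, [], t) E)) \<in> bead_equiv 0 m"
proof (rule edges_bead_equiv[OF D])
  show "beaded_diagram 0 m (BDiag A V (add_mset (s, [], t) E))"
    by (rule beaded_diagram_replace_edge[OF D]) simp
  have "set ws \<subseteq> carrier (free_group 0)" using D by (simp add: beaded_diagram_def)
  then show "image_mset (merge_beads 0) (add_mset (s, ws, t) E) = image_mset (merge_beads 0) (add_mset (s, [], t) E)"
    by (simp add: merge_beads_0)
qed

lemma joined_rotate:
  "joined (BDiag A (add_mset (b, c, a) V) E) = joined (BDiag A (add_mset (a, b, c) V) E)"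
proof -
  have "(\<exists>a' b' c'. (a', b', c') \<in># add_mset (b, c, a) V \<and> h \<in> {a', b', c'} \<and> h' \<in> {a', b', c'}) \<longleftrightarrow>
    (\<exists>a' b' c'. (a', b', c') \<in># add_mset (a, b, c) V \<and> h \<in> {a', b', c'} \<and> h' \<in> {a', b', c'})" for h h'
    by (simp only: set_mset_add_mset_insert insert_iff) blast
  then show ?thesis unfolding joined_BDiag by simp
qed

text \<open>
  By induction on the number of trivalent vertices: one of them is joined to a leg and is resolved by
  the STU relation, which never takes the last leg from an arc.
\<close>

lemma gen_conj_kills:
  assumes "beaded_diagram 0 (Suc m) D" "leg_seq (arcs D ! m) \<noteq> []"
  shows "lact 0 (gen_conj_copies m) D \<in> (relations 0 m :: (bdiag \<Rightarrow>\<^sub>0 'k::field) set)"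
  using assms
proof (induction "size (tris D)" arbitrary: D rule: less_induct)
  case less
  note L = copying_gen_conj[of m]
  have len: "length (arcs D) = Suc m" using less.prems(1) by (rule beaded_diagram_length)
  obtain A V E where D: "D = BDiag A V E" by (cases D) auto
  have inv: "lact 0 (gen_conj_copies m) D \<in> (relations 0 m :: (bdiag \<Rightarrow>\<^sub>0 'k) set)"
    if "(D, D') \<in> bead_equiv 0 (Suc m)" "lact 0 (gen_conj_copies m) D' \<in> (relations 0 m :: (bdiag \<Rightarrow>\<^sub>0 'k) set)" for D'
  proof -
    have "mod_eq 0 m (lact 0 (gen_conj_copies m) D) (lact 0 (gen_conj_copies m) D' :: bdiag \<Rightarrow>\<^sub>0 'k)"
      using lact_bead_equiv[OF that(1) less.prems(1) L] by simp
    then show ?thesis using that(2) relations_add unfolding mod_eq_def by fastforce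
  qed
  show ?case
  proof (cases "V = {#}")
    case True
    let ?G = "map leg_seq A" and ?E = "image_mset (\<lambda>(s, ws, t). (s, [], t)) E"
    have beads: "set ws \<subseteq> carrier (free_group 0)" if "(s, ws, t) \<in># E" for s ws t
      using less.prems(1) that by (auto simp: D beaded_diagram_def)
    have arcs: "list_all2 (arc_eq 0) A (map (map Leg) ?G)"
      using beaded_diagram_beads_in[OF less.prems(1)] by (auto simp: list_all2_conv_all_nth D intro!: arc_eq_0)
    have 1: "(D, BDiag (map (map Leg) ?G) {#} E) \<in> bead_equiv 0 (Suc m)"
      using arc_eq_bead_equiv[OF arcs] less.prems(1) by (simp add: D True)
    note b1 = bead_equiv_beaded[OF 1 less.prems(1)]
    have b2: "beaded_diagram 0 (Suc m) (BDiag (map (map Leg) ?G) {#} ?E)"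
      using b1 by (rule beaded_diagram_image_edges) simp
    have 2: "(BDiag (map (map Leg) ?G) {#} E, BDiag (map (map Leg) ?G) {#} ?E) \<in> bead_equiv 0 (Suc m)"
    proof (rule edges_bead_equiv[OF b1 b2])
      show "image_mset (merge_beads 0) E = image_mset (merge_beads 0) ?E"
        unfolding image_mset.compositionality comp_def
        by (intro image_mset_cong) (use beads in \<open>auto simp: merge_beads_0\<close>)
    qed
    show ?thesis
    proof (rule inv)
      show "(D, chords ?G ?E) \<in> bead_equiv 0 (Suc m)"
        unfolding chords_def using 1 2 by (rule bead_equiv_trans)
      show "lact 0 (gen_conj_copies m) (chords ?G ?E) \<in> (relations 0 m :: (bdiag \<Rightarrow>\<^sub>0 'k) set)"
        using b2 less.prems(2) len by (intro gen_conj_kills_chords) (auto simp: chords_def D)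
    qed
  next
    case False
    then obtain h x ws where hx: "h \<in> legs D" "x \<in># (\<Sum>(a, b, c) \<in># V. {#a, b, c#})" "(h, ws, x) \<in># E \<or> (x, ws, h) \<in># E"
      using trivalent_leg_edge[OF less.prems(1)] D by (metis bdiag.sel(2,3))
    obtain AA y BB where "A = AA @ y # BB" "Leg h \<in> set y"
      using hx(1) unfolding D legs_mset_BDiag set_mset_mset set_leg_seq by (auto dest: split_list)
    then obtain p q where A: "A = AA @ (p @ Leg h # q) # BB" by (metis split_list)
    obtain t where t: "t \<in># V" "x \<in># (case t of (a, b, c) \<Rightarrow> {#a, b, c#})"
      using hx(2) by auto
    then obtain V' where V: "V = add_mset t V'" by (meson multi_member_split)
    have edge: "\<exists>E'. (D, BDiag A V (add_mset (h, [], x) E')) \<in> bead_equiv 0 (Suc m)"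
      using hx(3)
    proof
      assume "(h, ws, x) \<in># E"
      then obtain E' where "E = add_mset (h, ws, x) E'" by (meson multi_member_split)
      then show ?thesis using edges_bead_equiv_0 less.prems(1) unfolding D by blast
    next
      assume "(x, ws, h) \<in># E"
      then obtain E' where E: "E = add_mset (x, ws, h) E'" by (meson multi_member_split)
      then have 1: "(D, BDiag A V (add_mset (x, [], h) E')) \<in> bead_equiv 0 (Suc m)"
        using edges_bead_equiv_0 less.prems(1) unfolding D by blast
      from bead_equiv_trans[OF 1 edge_reverse_unbeaded[OF bead_equiv_beaded[OF 1 less.prems(1)]]]
      show ?thesis by blast
    qed
    then obtain E' where E': "(D, BDiag A V (add_mset (h, [], x) E')) \<in> bead_equiv 0 (Suc m)" by blast
    have rot: "\<exists>b a. (BDiag A V E'', BDiag A (add_mset (x, b, a) V') E'') \<in> bead_equiv 0 (Suc m)"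
      if b: "beaded_diagram 0 (Suc m) (BDiag A V E'')" for E''
    proof -
      obtain a b c where abc: "t = (a, b, c)" by (cases t) auto
      have cyc: "(BDiag A (add_mset (a, b, c) V') E'', BDiag A (add_mset (b, c, a) V') E'') \<in> bead_equiv 0 (Suc m)"
        if "beaded_diagram 0 (Suc m) (BDiag A (add_mset (a, b, c) V') E'')" for a b c
      proof (rule bead_equiv_step[OF bead_move.cyclic that])
        have v: "vertex_halves (BDiag A (add_mset (b, c, a) V') E'') = vertex_halves (BDiag A (add_mset (a, b, c) V') E'')"
          by (simp add: vertex_halves_BDiag add_mset_commute)
        have j: "joined (BDiag A (add_mset (b, c, a) V') E'') = joined (BDiag A (add_mset (a, b, c) V') E'')"
          by (rule joined_rotate)
        have l: "legs_mset (BDiag A (add_mset (b, c, a) V') E'') = legs_mset (BDiag A (add_mset (a, b, c) V') E'')"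
          "edge_halves (BDiag A (add_mset (b, c, a) V') E'') = edge_halves (BDiag A (add_mset (a, b, c) V') E'')"
          by (simp_all add: legs_mset_BDiag edge_halves_BDiag)
        show "beaded_diagram 0 (Suc m) (BDiag A (add_mset (b, c, a) V') E'')"
          using that unfolding beaded_diagram_def v j l bdiag.sel .
      qed
      have 1: "beaded_diagram 0 (Suc m) (BDiag A (add_mset (a, b, c) V') E'')"
        using b by (simp add: V abc)
      note c1 = cyc[OF 1]
      note c2 = bead_equiv_trans[OF c1 cyc[OF bead_equiv_beaded[OF c1 1]]]
      have "x = a \<or> x = b \<or> x = c" using t(2) by (auto simp: abc)
      then show ?thesis
        using bead_equiv_refl c1 c2 unfolding V abc by blast
    qed
    from rot[OF bead_equiv_beaded[OF E' less.prems(1)]] obtain b a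
      where ba: "(BDiag A V (add_mset (h, [], x) E'), BDiag A (add_mset (x, b, a) V') (add_mset (h, [], x) E')) \<in> bead_equiv 0 (Suc m)"
      by blast
    let ?D0 = "BDiag (AA @ (p @ Leg h # q) # BB) (add_mset (x, b, a) V') (add_mset (h, [], x) E')"
    let ?D1 = "BDiag (AA @ (p @ Leg a # Leg b # q) # BB) V' E'" and ?D2 = "BDiag (AA @ (p @ Leg b # Leg a # q) # BB) V' E'"
    have 0: "(D, ?D0) \<in> bead_equiv 0 (Suc m)" using bead_equiv_trans[OF E' ba] unfolding A .
    note b0 = bead_equiv_beaded[OF 0 less.prems(1)]
    note b1 = beaded_stu[OF b0]
    have b2: "beaded_diagram 0 (Suc m) ?D2"
      by (rule beaded_diagram_arcs_cong[OF b1])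
        (use beaded_diagram_length[OF b1] beaded_diagram_beads_in[OF b1]
          beaded_diagram_beads_in[OF b1, of "p @ Leg a # Leg b # q"] in auto)
    have "lact 0 (gen_conj_copies m) D' \<in> (relations 0 m :: (bdiag \<Rightarrow>\<^sub>0 'k) set)" if D': "D' = ?D1 \<or> D' = ?D2" for D'
    proof (rule less.hyps)
      show "size (tris D') < size (tris D)" using D' by (auto simp: D V)
      show "beaded_diagram 0 (Suc m) D'" using D' b1 b2 by blast
      show "leg_seq (arcs D' ! m) \<noteq> []"
        using D' less.prems(2) unfolding D A by (auto simp: nth_append nth_Cons split: nat.splits if_splits)
    qed
    then have "lact 0 (gen_conj_copies m) ?D1 - lact 0 (gen_conj_copies m) ?D2 \<in> (relations 0 m :: (bdiag \<Rightarrow>\<^sub>0 'k) set)"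
      by (intro relations_diff) blast+
    moreover have "mod_eq 0 m (lact 0 (gen_conj_copies m) ?D0) (lact 0 (gen_conj_copies m) ?D1 - lact 0 (gen_conj_copies m) ?D2 :: bdiag \<Rightarrow>\<^sub>0 'k)"
      using lact_stu[OF b0 L] by simp
    ultimately have "lact 0 (gen_conj_copies m) ?D0 \<in> (relations 0 m :: (bdiag \<Rightarrow>\<^sub>0 'k) set)"
      using relations_add unfolding mod_eq_def by fastforce
    then show ?thesis using 0 by (intro inv)
  qed
qed

text \<open>
  Copies of an arc without legs only contribute trivial beads.
\<close>

lemma gen_conj_fixes:
  assumes D: "beaded_diagram 0 (Suc m) D" and m: "leg_seq (arcs D ! m) = []"
  shows "mod_eq 0 m (lact 0 (gen_conj_copies m) D) (dgm (BDiag (take m (arcs D)) (tris D) (edges D)) :: bdiag \<Rightarrow>\<^sub>0 'k::field)"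
proof -
  let ?L = "gen_conj_copies m" and ?\<chi> = "\<lambda>h. (home D h, 1::nat)"
  have len: "length (arcs D) = Suc m" using D by (rule beaded_diagram_length)
  have noleg: "Leg h \<notin> set (arcs D ! m)" for h
    using m set_leg_seq[of "arcs D ! m"] by auto
  have hm: "home D h < m" if "h \<in> legs D" for h
    using home[OF D that] noleg by (metis less_Suc_eq)
  have pl: "places ?L D h = {?\<chi> h}" if h: "h \<in> legs D" for h
    unfolding places_eq[OF D home[OF D h]] set_gen_conj_copies using hm[OF h] by auto
  have lact: "lact 0 ?L D = (dgm (lattach 0 ?L ?\<chi> D) :: bdiag \<Rightarrow>\<^sub>0 'k)"
    using copying_gen_conj[of m] pl by (subst lact_unique_places[of D ?L ?\<chi> 0]) (simp_all add: len lsign_gen_conj[simplified])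
  have b: "beaded_diagram 0 m (BDiag (take m (arcs D)) (tris D) (edges D))"
  proof (rule beaded_diagram_arcs_cong[of 0 "Suc m" "arcs D"])
    have "arcs D = take m (arcs D) @ [arcs D ! m]"
      using len by (metis lessI order_refl take_Suc_conv_app_nth take_all)
    then have "leg_seq (concat (arcs D)) = leg_seq (concat (take m (arcs D))) @ leg_seq (arcs D ! m)"
      by (metis append.right_neutral concat.simps concat_append leg_seq_simps(2))
    then show "mset (leg_seq (concat (take m (arcs D)))) = mset (leg_seq (concat (arcs D)))" using m by simp
    show "\<forall>pts\<in>set (take m (arcs D)). beads_in 0 pts"
      using beaded_diagram_beads_in[OF D] by (meson in_set_takeD)
  qed (use D len in simp_all)
  have beads: "beads_in 0 (arcs D ! k)" if "k < Suc m" for k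
    using beaded_diagram_beads_in[OF D] that len by simp
  have "list_all2 (arc_eq 0) (take m (arcs D)) (arcs (lattach 0 ?L ?\<chi> D))"
    unfolding list_all2_conv_all_nth
  proof (intro conjI allI impI)
    fix k assume "k < length (take m (arcs D))"
    then have k: "k < m" by (simp add: len)
    have "keep ?\<chi> (k, 1) (arcs D ! k) = arcs D ! k"
      using home_eq[OF D, of k] k by (intro keep_id) auto
    then have "arcs (lattach 0 ?L ?\<chi> D) ! k = keep ?\<chi> (k, 0) (arcs D ! m) @ arcs D ! k @ orient 0 False (keep ?\<chi> (k, 2) (arcs D ! m))"
      using k by (simp add: lattach_def gen_conj_copies_def lcopy_def)
    then show "arc_eq 0 (take m (arcs D) ! k) (arcs (lattach 0 ?L ?\<chi> D) ! k)"
      using k beads m by (auto intro!: arc_eq_0 beads_in_orient)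
  qed (simp add: lattach_def len)
  then have "mod_eq 0 m (dgm (BDiag (take m (arcs D)) (tris D) (edges D))) (dgm (BDiag (arcs (lattach 0 ?L ?\<chi> D)) (tris D) (edges D)) :: bdiag \<Rightarrow>\<^sub>0 'k)"
    using b by (rule arc_eq_mod_eq)
  moreover have "BDiag (arcs (lattach 0 ?L ?\<chi> D)) (tris D) (edges D) = lattach 0 ?L ?\<chi> D" by (simp add: lattach_def)
  ultimately show ?thesis unfolding lact using mod_eq_sym by metis
qed

lemma conj_words_factor:
  "conj_words m a = map (\<lambda>u. concat (map (subst_letter (map gen [0..<m] @ [a])) u)) (gen_conj m)"
  by (auto simp: conj_words_def gen_conj_def subst_letter_def nth_append)

text \<open>
  Conjugation by \<open>a\<close> acts as the substitution of \<open>a\<close> for \<open>x\<^sub>m\<close> followed by the conjugation by \<open>x\<^sub>m\<close>.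
  The former sends \<open>D\<close> to \<open>D\<close> with an additional arc without legs, plus diagrams with legs on the arc \<open>m\<close>,
  which the latter kills.
\<close>

lemma outer_functor_no_beads:
  "outer_functor (A_deg_trivial d 0 :: nat \<Rightarrow> ('k::field_char_0, (bdiag \<Rightarrow>\<^sub>0 'k) set) module) (A_mor 0)"
proof (rule outer_functorI)
  fix m a D assume a: "a \<in> carrier (free_group m)" and "D \<in> trivial_diagrams d 0 m"
  then have D: "beaded_diagram 0 m D" by (simp add: trivial_diagrams_def)
  have len: "length (arcs D) = m" using D by (rule beaded_diagram_length)
  let ?W = "map gen [0..<m] @ [a]" and ?C = "gen_conj_copies m"
  let ?L = "copies_of ?W"
  have W: "\<forall>w \<in> set ?W. \<forall>x \<in> set w. fst x < m" using a by (auto simp: free_group_simps)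
  then have L: "copying m ?L" by (simp only: copying_copies_of)
  have U: "\<forall>w \<in> set (gen_conj m). \<forall>x \<in> set w. fst x < length ?W" by (auto simp: gen_conj_def)
  have setL: "((j, s), p, e) \<in> set (concat ?L) \<longleftrightarrow> j < m \<and> s = 0 \<and> p = j \<and> e \<or> j = m \<and> s < length a \<and> a ! s = (p, e)" for j s p e
    unfolding set_copies_of by (auto simp: nth_append less_Suc_eq)
  let ?\<chi> = "\<lambda>h. (home D h, 0::nat)"
  define \<chi>0 where "\<chi>0 = restrict ?\<chi> (legs D)"
  have \<chi>0: "\<chi>0 \<in> lattachments ?L D"
  proof -
    have "?\<chi> h \<in> places ?L D h" if "h \<in> legs D" for h
      unfolding places_eq[OF D home[OF D that]] mem_Collect_eq setL using home[OF D that] by blast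
    then show ?thesis unfolding \<chi>0_def lattachments_def by auto
  qed
  have arc_m: "arcs (lattach 0 ?L \<chi> D) ! m = concat (map (lcopy 0 (arcs D) \<chi>) (?L ! m))" for \<chi>
    by (simp add: lattach_def)
  have L_m: "?L ! m = map (\<lambda>s. ((m, s), a ! s)) [0..<length a]" by (simp add: copies_of_def nth_append)
  have b: "beaded_diagram 0 (Suc m) (lattach 0 ?L \<chi> D)" if "\<chi> \<in> lattachments ?L D" for \<chi>
    using lattach_beaded[OF D L that] by simp
  have kill: "lact 0 ?C (lattach 0 ?L \<chi> D) \<in> (relations 0 m :: (bdiag \<Rightarrow>\<^sub>0 'k) set)"
    if \<chi>: "\<chi> \<in> lattachments ?L D" "\<chi> \<noteq> \<chi>0" for \<chi>
  proof (rule gen_conj_kills[OF b[OF \<chi>(1)]])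
    obtain h where h: "h \<in> legs D" "\<chi> h \<noteq> ?\<chi> h"
    proof (rule ccontr)
      assume "\<not> thesis"
      then have "\<chi> h = \<chi>0 h" if "h \<in> legs D" for h using that \<open>\<And>h. h \<in> legs D \<Longrightarrow> \<chi> h \<noteq> ?\<chi> h \<Longrightarrow> thesis\<close> by (auto simp: \<chi>0_def)
      then have "\<chi> = \<chi>0"
        using \<chi>(1) \<chi>0 unfolding lattachments_def by (intro PiE_ext) auto
      then show False using \<chi>(2) by simp
    qed
    have "\<chi> h \<in> places ?L D h" using \<chi>(1) h(1) by (auto simp: lattachments_def)
    then obtain e where e: "(\<chi> h, home D h, e) \<in> set (concat ?L)"
      unfolding places_eq[OF D home[OF D h(1)]] by blast
    then have "fst (\<chi> h) = m \<and> snd (\<chi> h) < length a \<and> a ! snd (\<chi> h) = (home D h, e)"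
      using h(2) setL[of "fst (\<chi> h)" "snd (\<chi> h)"] by (cases "\<chi> h") auto
    then have "(\<chi> h, home D h, e) \<in> set (?L ! m)"
      unfolding L_m by (cases "\<chi> h") force
    moreover have "Leg h \<in> set (lcopy 0 (arcs D) \<chi> (\<chi> h, home D h, e))"
      using home[OF D h(1)] by (simp add: Leg_in_lcopy)
    ultimately have "Leg h \<in> set (arcs (lattach 0 ?L \<chi> D) ! m)"
      unfolding arc_m by auto
    then have "h \<in> set (leg_seq (arcs (lattach 0 ?L \<chi> D) ! m))" by simp
    then show "leg_seq (arcs (lattach 0 ?L \<chi> D) ! m) \<noteq> []" by (metis empty_iff empty_set)
  qed
  have fixed: "mod_eq 0 m (lact 0 ?C (lattach 0 ?L \<chi>0 D)) (dgm D :: bdiag \<Rightarrow>\<^sub>0 'k)"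
  proof -
    have eq: "lattach 0 ?L \<chi>0 D = lattach 0 ?L ?\<chi> D"
      by (rule lattach_cong) (use L len in \<open>simp_all add: \<chi>0_def\<close>)
    have arcs: "take m (arcs (lattach 0 ?L ?\<chi> D)) = arcs D"
    proof (rule nth_equalityI)
      fix k assume "k < length (take m (arcs (lattach 0 ?L ?\<chi> D)))"
      then have k: "k < m" by (simp add: lattach_def)
      have "keep ?\<chi> (k, 0) (arcs D ! k) = arcs D ! k"
        using home_eq[OF D k] by (intro keep_id) simp
      then show "take m (arcs (lattach 0 ?L ?\<chi> D)) ! k = arcs D ! k"
        using k by (simp add: lattach_def copies_of_def nth_append lcopy_def)
    qed (simp add: lattach_def len)
    have "leg_seq (arcs (lattach 0 ?L \<chi>0 D) ! m) = []"
    proof -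
      have "Leg h \<notin> set (arcs (lattach 0 ?L ?\<chi> D) ! m)" for h
      proof
        assume "Leg h \<in> set (arcs (lattach 0 ?L ?\<chi> D) ! m)"
        then obtain s where s: "s < length a" "Leg h \<in> set (lcopy 0 (arcs D) ?\<chi> ((m, s), a ! s))"
          unfolding arc_m L_m by auto
        obtain p e where pe: "a ! s = (p, e)" by (cases "a ! s") auto
        have "Leg h \<in> set (arcs D ! p)" "home D h = m" using s unfolding pe Leg_in_lcopy by auto
        moreover have "p < m"
        proof -
          have "(p, e) \<in> set a" using nth_mem[OF s(1)] pe by simp
          then show ?thesis using a by (auto simp: free_group_simps)
        qed
        ultimately show False using home_eq[OF D] by fastforce
      qed
      then show ?thesis unfolding eq leg_seq_eq_Nil by blast
    qed
    from gen_conj_fixes[OF b[OF \<chi>0] this]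
    show ?thesis unfolding eq arcs by (cases D) (simp add: lattach_def)
  qed
  have sg: "(\<Prod>h\<in>legs D. lsign ?L (\<chi>0 h)) = (1 :: 'k)"
  proof (rule prod.neutral, rule ballI)
    fix h assume h: "h \<in> legs D"
    then show "lsign ?L (\<chi>0 h) = (1 :: 'k)"
      using home(1)[OF D h] unfolding lsign_def by (auto simp: \<chi>0_def setL simp del: set_concat)
  qed
  note le = linear_ext_sum[OF vector_space_scale] linear_ext_scale[OF vector_space_scale] linear_ext_dgm[OF vector_space_scale]
  have "lact 0 (copies_of (conj_words m a)) D = (linear_ext scale (lact 0 ?C) (lact 0 ?L D) :: bdiag \<Rightarrow>\<^sub>0 'k)"
    unfolding conj_words_factor lact_lact_words[OF D W U, symmetric] copies_of_gen_conj ..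
  also have "\<dots> = (\<Sum>\<chi>\<in>lattachments ?L D. scale (\<Prod>h\<in>legs D. lsign ?L (\<chi> h)) (lact 0 ?C (lattach 0 ?L \<chi> D)))"
    unfolding lact_def[of 0 ?L] le ..
  also have "\<dots> = lact 0 ?C (lattach 0 ?L \<chi>0 D) +
      (\<Sum>\<chi>\<in>lattachments ?L D - {\<chi>0}. scale (\<Prod>h\<in>legs D. lsign ?L (\<chi> h)) (lact 0 ?C (lattach 0 ?L \<chi> D)))"
    by (simp add: sum.remove[OF finite_lattachments \<chi>0] sg)
  finally have eq: "lact 0 (copies_of (conj_words m a)) D = lact 0 ?C (lattach 0 ?L \<chi>0 D) +
      (\<Sum>\<chi>\<in>lattachments ?L D - {\<chi>0}. scale (\<Prod>h\<in>legs D. lsign ?L (\<chi> h)) (lact 0 ?C (lattach 0 ?L \<chi> D)) :: bdiag \<Rightarrow>\<^sub>0 'k)" .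
  have "(\<Sum>\<chi>\<in>lattachments ?L D - {\<chi>0}. scale (\<Prod>h\<in>legs D. lsign ?L (\<chi> h)) (lact 0 ?C (lattach 0 ?L \<chi> D))) \<in> (relations 0 m :: (bdiag \<Rightarrow>\<^sub>0 'k) set)"
    using kill by (intro relations_sum relations_scale) auto
  then have "mod_eq 0 m (\<Sum>\<chi>\<in>lattachments ?L D - {\<chi>0}. scale (\<Prod>h\<in>legs D. lsign ?L (\<chi> h)) (lact 0 ?C (lattach 0 ?L \<chi> D))) (0 :: bdiag \<Rightarrow>\<^sub>0 'k)"
    by (simp add: mod_eq_def)
  from mod_eq_add[OF fixed this] show "mod_eq 0 m (lact 0 (copies_of (conj_words m a)) D) (dgm D :: bdiag \<Rightarrow>\<^sub>0 'k)"
    unfolding eq by simp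
qed


section \<open>An invariant that detects inner automorphisms\<close>

definition exponent :: "word \<Rightarrow> int" where
  "exponent w = (\<Sum>a\<leftarrow>w. if snd a then 1 else - 1)"

lemma exponent_simps [simp]:
  "exponent [] = 0" "exponent (a # w) = (if snd a then 1 else - 1) + exponent w"
  "exponent (u @ v) = exponent u + exponent v"
  by (simp_all add: exponent_def)

lemma exponent_reduce [simp]: "exponent (reduce w) = exponent w"
proof -
  have "exponent (push a w) = exponent (a # w)" for a w
    by (cases w) (auto simp: inv_letter_def)
  then show ?thesis
    by (induction w) (simp_all add: reduce_Cons, simp add: reduce_def)
qed

lemma exponent_mult: "exponent (u \<otimes>\<^bsub>free_group n\<^esub> v) = exponent u + exponent v"
  by (simp add: free_group_simps(2))

lemma exponent_inv: "w \<in> carrier (free_group n) \<Longrightarrow> exponent (inv\<^bsub>free_group n\<^esub> w) = - exponent w"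
proof -
  have "exponent (inv_word w) = - exponent w"
    by (induction w) (auto simp: inv_letter_def)
  then show "w \<in> carrier (free_group n) \<Longrightarrow> exponent (inv\<^bsub>free_group n\<^esub> w) = - exponent w"
    by (simp add: inv_free_group)
qed

definition words_exponent :: "word list \<Rightarrow> int" where
  "words_exponent ws = (\<Sum>w\<leftarrow>ws. exponent w)"

lemma words_exponent_simps [simp]:
  "words_exponent [] = 0" "words_exponent (w # ws) = exponent w + words_exponent ws"
  "words_exponent (us @ ws) = words_exponent us + words_exponent ws"
  by (simp_all add: words_exponent_def)

definition until :: "nat \<Rightarrow> point list \<Rightarrow> point list" where
  "until h p = takeWhile (\<lambda>x. x \<noteq> Leg h) p"

lemma until_simps [simp]:
  "until h [] = []" "until h (Bead w # p) = Bead w # until h p"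
  "until h (Leg h' # p) = (if h' = h then [] else Leg h' # until h p)"
  by (simp_all add: until_def)

lemma until_append [simp]: "until h (p @ q) = (if Leg h \<in> set p then until h p else p @ until h q)"
  by (induction p) (auto simp: until_def)

text \<open>
  Adding the potentials of its ends to the exponent of the beads on a chord gives the exponent of the
  loop that follows the chord and returns along the arc.
\<close>

definition potential :: "point list \<Rightarrow> nat \<Rightarrow> int" where
  "potential p h = words_exponent (bead_seq (until h p))"

text \<open>
  \<open>1\<close> if \<open>s\<close> comes before \<open>t\<close>, \<open>- 1\<close> if it comes after \<open>t\<close>, and \<open>0\<close> unless both are on the arc.
\<close>

definition order_sign :: "point list \<Rightarrow> nat \<Rightarrow> nat \<Rightarrow> int" where
  "order_sign p s t = (if Leg s \<in> set p \<and> Leg t \<in> set p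
    then of_bool (Leg s \<in> set (until t p)) - of_bool (Leg t \<in> set (until s p)) else 0)"

definition chord_value :: "point list list \<Rightarrow> nat \<times> word list \<times> nat \<Rightarrow> int" where
  "chord_value A = (\<lambda>(s, ws, t). \<Sum>p\<leftarrow>A. order_sign p s t * (words_exponent ws + potential p s - potential p t))"

text \<open>
  \<open>1\<close> if \<open>s\<close> follows \<open>t\<close> in the cyclic order, \<open>- 1\<close> if \<open>t\<close> follows \<open>s\<close>, and \<open>0\<close> unless both are at the vertex.
\<close>

definition turn_sign :: "nat \<times> nat \<times> nat \<Rightarrow> nat \<Rightarrow> nat \<Rightarrow> int" where
  "turn_sign = (\<lambda>(a, b, c) s t. of_bool ((t, s) \<in> {(a, b), (b, c), (c, a)}) - of_bool ((s, t) \<in> {(a, b), (b, c), (c, a)}))"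

definition tadpole_value :: "nat \<times> nat \<times> nat \<Rightarrow> nat \<times> word list \<times> nat \<Rightarrow> int" where
  "tadpole_value v = (\<lambda>(s, ws, t). 2 * words_exponent ws * turn_sign v s t)"

text \<open>
  On chord diagrams, the weight adds up the exponents of the chords that return to the arc from which they start.
  Exchanging adjacent legs \<open>a\<close> and \<open>b\<close> changes it only if they are joined, by twice the exponent of their chord.
  The STU relation then prescribes the value on diagrams with one trivalent vertex, where only tadpoles count, and
  allows it to vanish on all others.
\<close>

definition weight :: "bdiag \<Rightarrow> int" where
  "weight D = (if size (tris D) = 0 then \<Sum>e\<in>#edges D. chord_value (arcs D) e
    else if size (tris D) = 1 then \<Sum>e\<in>#edges D. \<Sum>v\<in>#tris D. tadpole_value v e else 0)"

lemma weight_0: "weight (BDiag A {#} E) = (\<Sum>e\<in>#E. chord_value A e)"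
  and weight_1: "weight (BDiag A {#v#} E) = (\<Sum>e\<in>#E. tadpole_value v e)"
  and weight_2: "size V \<ge> 2 \<Longrightarrow> weight (BDiag A V E) = 0"
  by (auto simp: weight_def)

lemma size_cases:
  obtains "V = {#}" | v where "V = {#v#}" | "size V \<ge> 2"
proof (cases "size V = 0 \<or> size V = 1")
  case True
  then show ?thesis using that size_1_singleton_mset by (metis size_eq_0_iff_empty)
next
  case False
  then show ?thesis using that by linarith
qed

lemma order_sign_antisym: "order_sign p t s = - order_sign p s t"
  by (simp add: order_sign_def)

lemma turn_sign_antisym: "turn_sign v t s = - turn_sign v s t"
proof -
  obtain a b c where "v = (a, b, c)" by (cases v) auto
  then show ?thesis unfolding turn_sign_def by (simp only: prod.case minus_diff_eq)
qed

lemma turn_sign_0: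
  assumes "\<not> {s, t} \<subseteq> {a, b, c}"
  shows "turn_sign (a, b, c) s t = 0"
proof -
  have "((t, s) \<in> {(a, b), (b, c), (c, a)}) = False" "((s, t) \<in> {(a, b), (b, c), (c, a)}) = False"
    using assms by blast+
  then show ?thesis unfolding turn_sign_def by (simp only: prod.case of_bool_eq diff_self)
qed

lemma chord_value_eqI:
  assumes "\<And>p. p \<in> set A \<Longrightarrow> order_sign p s t * (words_exponent ws + potential p s - potential p t)
      = order_sign p s' t' * (words_exponent ws' + potential p s' - potential p t')"
  shows "chord_value A (s, ws, t) = chord_value A (s', ws', t')"
proof -
  have "map (\<lambda>p. order_sign p s t * (words_exponent ws + potential p s - potential p t)) A
    = map (\<lambda>p. order_sign p s' t' * (words_exponent ws' + potential p s' - potential p t')) A"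
    using assms by simp
  then show ?thesis unfolding chord_value_def prod.case by (rule arg_cong)
qed

lemma chord_value_reverse:
  "words_exponent ws' = - words_exponent ws \<Longrightarrow> chord_value A (t, ws', s) = chord_value A (s, ws, t)"
  by (rule chord_value_eqI) (simp add: order_sign_antisym[of _ t s] algebra_simps)

lemma value_words_cong:
  assumes "words_exponent ws = words_exponent ws'"
  shows "chord_value A (s, ws, t) = chord_value A (s, ws', t)" "tadpole_value v (s, ws, t) = tadpole_value v (s, ws', t)"
  by (simp_all add: chord_value_def tadpole_value_def assms)

lemma tadpole_value_reverse:
  "words_exponent ws' = - words_exponent ws \<Longrightarrow> tadpole_value v (t, ws', s) = tadpole_value v (s, ws, t)"
  by (simp add: tadpole_value_def turn_sign_antisym[of _ t s])

lemma weight_replace_edge: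
  assumes "\<And>A. chord_value A e' = chord_value A e" "\<And>v. tadpole_value v e' = tadpole_value v e"
  shows "weight (BDiag A V (add_mset e' E)) = weight (BDiag A V (add_mset e E))"
  using assms by (simp add: weight_def)

lemma weight_arcs_cong:
  assumes "\<And>e. e \<in># E \<Longrightarrow> chord_value A' e = chord_value A e"
  shows "weight (BDiag A' V E) = weight (BDiag A V E)"
proof -
  have "(\<Sum>e\<in>#E. chord_value A' e) = (\<Sum>e\<in>#E. chord_value A e)"
    using assms by (intro arg_cong[of _ _ sum_mset] image_mset_cong)
  then show ?thesis by (simp add: weight_def)
qed

lemma chord_value_append: "chord_value (A @ p # B) e = chord_value A e + chord_value [p] e + chord_value B e"
  by (cases e) (simp add: chord_value_def)

lemma chord_value_bead_change:
  assumes "words_exponent (bead_seq r) = words_exponent (bead_seq r')" "leg_seq r = []" "leg_seq r' = []"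
  shows "chord_value (A @ (p @ r @ q) # B) e = chord_value (A @ (p @ r' @ q) # B) e"
proof -
  have nl: "Leg h \<notin> set r" "Leg h \<notin> set r'" for h
    using assms(2,3) by (simp_all add: leg_seq_eq_Nil)
  have "potential (p @ r @ q) h = potential (p @ r' @ q) h" for h
    using assms(1) nl by (simp add: potential_def)
  moreover have "order_sign (p @ r @ q) s t = order_sign (p @ r' @ q) s t" for s t
    using nl by (simp add: order_sign_def)
  ultimately have "chord_value [p @ r @ q] e = chord_value [p @ r' @ q] e"
    by (cases e) (simp add: chord_value_def)
  then show ?thesis unfolding chord_value_append by simp
qed

lemma until_rename:
  assumes "\<And>h'. Leg h' \<in> set p \<Longrightarrow> f h' = f h \<longleftrightarrow> h' = h"
  shows "until (f h) (map (rename_point f) p) = map (rename_point f) (until h p)"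
  using assms
proof (induction p)
  case (Cons x p)
  then show ?case by (cases x) auto
qed simp

lemma bead_seq_rename [simp]: "bead_seq (map (rename_point f) p) = bead_seq p"
proof (induction p)
  case (Cons x p)
  then show ?case by (cases x) auto
qed simp

lemma set_until: "set (until h p) \<subseteq> set p"
  unfolding until_def by (auto dest: set_takeWhileD)

lemma chord_value_rename:
  assumes inj: "inj_on f S" and S: "s \<in> S" "t \<in> S" "\<And>p h. \<lbrakk>p \<in> set A; Leg h \<in> set p\<rbrakk> \<Longrightarrow> h \<in> S"
  shows "chord_value (map (map (rename_point f)) A) (f s, ws, f t) = chord_value A (s, ws, t)"
proof -
  have "order_sign (map (rename_point f) p) (f s) (f t) * (words_exponent ws + potential (map (rename_point f) p) (f s) - potential (map (rename_point f) p) (f t))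
    = order_sign p s t * (words_exponent ws + potential p s - potential p t)" if p: "p \<in> set A" for p
  proof -
    have mem: "Leg (f h) \<in> set (map (rename_point f) q) \<longleftrightarrow> Leg h \<in> set q" if "h \<in> S" "set q \<subseteq> set p" for h q
      unfolding Leg_map_rename using that S(3)[OF p] inj_onD[OF inj] by (metis subsetD)
    have u: "until (f h) (map (rename_point f) p) = map (rename_point f) (until h p)" if "h \<in> S" for h
      using that S(3)[OF p] inj_on_eq_iff[OF inj] by (intro until_rename) auto
    have "order_sign (map (rename_point f) p) (f s) (f t) = order_sign p s t"
      unfolding order_sign_def u[OF S(1)] u[OF S(2)] 
      using mem[OF S(1) order_refl] mem[OF S(2) order_refl] mem[OF S(1) set_until, of t] mem[OF S(2) set_until, of s] by simp
    moreover have "potential (map (rename_point f) p) (f h) = potential p h" if "h \<in> S" for h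
      unfolding potential_def u[OF that] by simp
    ultimately show ?thesis using S(1,2) by simp
  qed
  then have "map (\<lambda>p. order_sign (map (rename_point f) p) (f s) (f t) * (words_exponent ws + potential (map (rename_point f) p) (f s) - potential (map (rename_point f) p) (f t))) A
    = map (\<lambda>p. order_sign p s t * (words_exponent ws + potential p s - potential p t)) A"
    by simp
  then show ?thesis
    unfolding chord_value_def prod.case map_map comp_def by (rule arg_cong)
qed

lemma weight_rename:
  assumes D: "beaded_diagram n m D" and inj: "inj_on f (halves D)"
  shows "weight (rename f D) = weight D"
proof -
  obtain A V E where D': "D = BDiag A V E" by (cases D) auto
  let ?H = "halves D"
  have "ends E = vertex_halves D"
    using D unfolding beaded_diagram_def by (simp add: D' edge_halves_BDiag)
  then have ends: "s \<in> ?H" "t \<in> ?H" if "(s, ws, t) \<in># E" for s ws t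
    using in_ends[OF that] by simp_all
  have V: "a \<in> ?H" "b \<in> ?H" "c \<in> ?H" if "(a, b, c) \<in># V" for a b c
    using that by (force simp: D' vertex_halves_BDiag)+
  have legs: "h \<in> ?H" if "p \<in> set A" "Leg h \<in> set p" for p h
    using that by (auto simp: D' vertex_halves_BDiag)
  let ?fE = "\<lambda>(s, ws, t). (f s, ws, f t)" and ?fV = "\<lambda>(a, b, c). (f a, f b, f c)"
  have c: "chord_value (map (map (rename_point f)) A) (?fE e) = chord_value A e" if "e \<in># E" for e
  proof -
    obtain s ws t where e: "e = (s, ws, t)" by (cases e) auto
    show ?thesis unfolding e prod.case
      using ends[of s ws t] that legs by (intro chord_value_rename[OF inj]) (auto simp: e)
  qed
  have t: "tadpole_value (?fV v) (?fE e) = tadpole_value v e" if "e \<in># E" "v \<in># V" for e v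
  proof -
    obtain s ws t where e: "e = (s, ws, t)" by (cases e) auto
    obtain a b c where v: "v = (a, b, c)" by (cases v) auto
    have "s \<in> ?H" "t \<in> ?H" "a \<in> ?H" "b \<in> ?H" "c \<in> ?H"
      using ends[of s ws t] V[of a b c] that by (auto simp: e v)
    then show ?thesis
      unfolding e v by (simp add: tadpole_value_def turn_sign_def inj_on_eq_iff[OF inj])
  qed
  have "(\<Sum>e\<in>#E. chord_value (map (map (rename_point f)) A) (?fE e)) = (\<Sum>e\<in>#E. chord_value A e)"
    using c by (intro arg_cong[of _ _ sum_mset] image_mset_cong)
  moreover have "(\<Sum>e\<in>#E. \<Sum>v\<in>#V. tadpole_value (?fV v) (?fE e)) = (\<Sum>e\<in>#E. \<Sum>v\<in>#V. tadpole_value v e)"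
    using t by (intro arg_cong[of _ _ sum_mset] image_mset_cong) auto
  ultimately show ?thesis
    by (simp add: weight_def D' rename_eq image_mset.compositionality comp_def)
qed

lemma words_exponent_emit:
  "w \<in> carrier (free_group n) \<Longrightarrow> emit n H w (s, ws, t) =
    (s, (if s \<in> H then [w] else []) @ ws @ (if t \<in> H then [inv\<^bsub>free_group n\<^esub> w] else []), t) \<and>
    words_exponent ((if s \<in> H then [w] else []) @ ws @ (if t \<in> H then [inv\<^bsub>free_group n\<^esub> w] else []))
      = words_exponent ws + exponent w * (of_bool (s \<in> H) - of_bool (t \<in> H))"
  by (simp add: emit_def exponent_inv)

text \<open>
  Only edges with both ends at the vertex have a value, and on these, the hypothesis makes the emitted
  beads cancel each other.
\<close>

lemma tadpole_value_emit:
  assumes "w \<in> carrier (free_group n)" "{s, t} \<subseteq> {a, b, c} \<Longrightarrow> s \<in> H \<longleftrightarrow> t \<in> H"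
  shows "tadpole_value (a, b, c) (emit n H w (s, ws, t)) = tadpole_value (a, b, c) (s, ws, t)"
proof (cases "{s, t} \<subseteq> {a, b, c}")
  case True
  then show ?thesis
    using words_exponent_emit[OF assms(1), of H s ws t] assms(2) by (simp add: tadpole_value_def)
next
  case False
  then show ?thesis
    using words_exponent_emit[OF assms(1), of H s ws t] turn_sign_0[OF False] by (simp add: tadpole_value_def)
qed

text \<open>
  Each half-edge occurs at one vertex only.
\<close>

lemma disjoint_halves:
  assumes D: "beaded_diagram n m (BDiag A V E)" and "Leg h \<in> set p" "p \<in> set A"
  shows "(a, b, c) \<in># V \<Longrightarrow> h \<notin> {a, b, c}"
proof
  assume "(a, b, c) \<in># V" "h \<in> {a, b, c}"
  then have "h \<in># (\<Sum>(a, b, c) \<in># V. {#a, b, c#})" by force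
  then have "count (\<Sum>(a, b, c) \<in># V. {#a, b, c#}) h \<ge> 1"
    by (simp only: Suc_le_eq One_nat_def count_greater_zero_iff)
  moreover have "h \<in> set (leg_seq (concat A))" using assms(2,3) by auto
  then have "count (mset (leg_seq (concat A))) h \<ge> 1"
    by (simp only: Suc_le_eq One_nat_def count_greater_zero_iff set_mset_mset)
  moreover have "count (vertex_halves (BDiag A V E)) h \<le> 1" using D unfolding beaded_diagram_def by blast
  ultimately show False unfolding vertex_halves_BDiag count_union by linarith
qed

text \<open>
  The exponent that the edge at \<open>v\<close> gains is the one that the potential of \<open>v\<close> loses.
\<close>

lemma weight_slide_univalent:
  assumes D: "beaded_diagram n m (BDiag (A @ (p @ Bead w # Leg v # q) # B) V E)"
  shows "weight (BDiag (A @ (p @ Leg v # Bead w # q) # B) V (image_mset (emit n {v} w) E))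
    = weight (BDiag (A @ (p @ Bead w # Leg v # q) # B) V E)"
proof -
  let ?r = "p @ Bead w # Leg v # q" and ?r' = "p @ Leg v # Bead w # q"
  have w: "w \<in> carrier (free_group n)"
    using beaded_diagram_beads_in[OF D, of ?r] by simp
  have "distinct (leg_seq (concat (A @ ?r # B)))" using distinct_leg_seq[OF D] by simp
  then have fresh: "Leg v \<notin> set p" "Leg v \<notin> set q" "\<forall>r \<in> set A \<union> set B. Leg v \<notin> set r"
    by auto
  have other: "chord_value C (emit n {v} w e) = chord_value C e" if "\<forall>r \<in> set C. Leg v \<notin> set r" for C e
  proof -
    obtain s ws t where e: "e = (s, ws, t)" by (cases e) auto
    have "order_sign r s t = 0" if "r \<in> set C" "s = v \<or> t = v" for r
      using that \<open>\<forall>r \<in> set C. Leg v \<notin> set r\<close> by (auto simp: order_sign_def)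
    then show ?thesis
      using words_exponent_emit[OF w, of "{v}" s ws t] unfolding e
      by (auto intro!: chord_value_eqI)
  qed
  have pot: "potential ?r' h = potential ?r h - (if h = v then exponent w else 0)" for h
    using fresh by (auto simp: potential_def)
  have ord: "order_sign ?r' s t = order_sign ?r s t" for s t
    using fresh by (auto simp: order_sign_def)
  have this_arc: "chord_value [?r'] (emit n {v} w e) = chord_value [?r] e" for e
  proof -
    obtain s ws t where e: "e = (s, ws, t)" by (cases e) auto
    have "order_sign ?r v v = 0" by (simp add: order_sign_def)
    then show ?thesis
      using words_exponent_emit[OF w, of "{v}" s ws t] unfolding e
      by (auto simp: chord_value_def pot ord)
  qed
  have c: "chord_value (A @ ?r' # B) (emit n {v} w e) = chord_value (A @ ?r # B) e" for e
    unfolding chord_value_append this_arc using other fresh by simp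
  have t: "tadpole_value x (emit n {v} w e) = tadpole_value x e" if "x \<in># V" for x e
  proof -
    obtain a b c where x: "x = (a, b, c)" by (cases x) auto
    have "v \<notin> {a, b, c}" using disjoint_halves[OF D, of v ?r a b c] that x by simp
    then show ?thesis unfolding x by (cases e) (auto intro!: tadpole_value_emit[OF w])
  qed
  have "(\<Sum>e\<in>#E. chord_value (A @ ?r' # B) (emit n {v} w e)) = (\<Sum>e\<in>#E. chord_value (A @ ?r # B) e)"
    using c by (intro arg_cong[of _ _ sum_mset] image_mset_cong)
  moreover have "(\<Sum>e\<in>#E. \<Sum>x\<in>#V. tadpole_value x (emit n {v} w e)) = (\<Sum>e\<in>#E. \<Sum>x\<in>#V. tadpole_value x e)"
    using t by (intro arg_cong[of _ _ sum_mset] image_mset_cong) auto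
  ultimately show ?thesis by (simp add: weight_def image_mset.compositionality comp_def)
qed

text \<open>
  On a loop at the vertex, the sliding bead and its inverse are emitted at both ends if the bead comes along
  the stem; if it comes along the loop itself, it reappears at the other end.
\<close>

lemma weight_slide_trivalent:
  assumes D: "beaded_diagram n m (BDiag A (add_mset (a, b, c) V) (add_mset (s, us @ [w], a) E))"
  shows "weight (BDiag A (add_mset (a, b, c) V) (image_mset (emit n {b, c} w) (add_mset (s, us, a) E)))
    = weight (BDiag A (add_mset (a, b, c) V) (add_mset (s, us @ [w], a) E))"
proof (cases "V = {#}")
  case True
  have w: "w \<in> carrier (free_group n)" using D by (simp add: beaded_diagram_def)
  let ?D = "BDiag A (add_mset (a, b, c) V) (add_mset (s, us @ [w], a) E)"
  have cnt: "count (vertex_halves ?D) h \<le> 1" for h using D unfolding beaded_diagram_def by blast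
  have "vertex_halves ?D = edge_halves ?D" using D unfolding beaded_diagram_def by blast
  then have cntE: "count ({#s, a#} + ends E) h \<le> 1" for h using cnt[of h] by (simp add: edge_halves_BDiag)
  have aE: "a \<notin># ends E"
  proof
    assume "a \<in># ends E"
    then have "count (ends E) a \<ge> 1" by (simp only: Suc_le_eq One_nat_def count_greater_zero_iff)
    moreover have "count {#s, a#} a \<ge> 1" by simp
    moreover have "count {#s, a#} a + count (ends E) a \<le> 1" using cntE[of a] by (simp only: count_union)
    ultimately show False by linarith
  qed
  have abc: "a \<noteq> b" "a \<noteq> c"
    using cnt[of a] by (auto simp: vertex_halves_BDiag split: if_splits)
  have 1: "tadpole_value (a, b, c) (emit n {b, c} w e) = tadpole_value (a, b, c) e" if "e \<in># E" for e
  proof -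
    obtain s' ws t' where e: "e = (s', ws, t')" by (cases e) auto
    have "s' \<noteq> a" "t' \<noteq> a" using in_ends[of s' ws t' E] that aE by (auto simp: e)
    then show ?thesis unfolding e by (intro tadpole_value_emit[OF w]) auto
  qed
  have 2: "tadpole_value (a, b, c) (emit n {b, c} w (s, us, a)) = tadpole_value (a, b, c) (s, us @ [w], a)"
  proof (cases "s \<in> {b, c}")
    case True
    then show ?thesis
      using words_exponent_emit[OF w, of "{b, c}" s us a] abc by (simp add: tadpole_value_def)
  next
    case False
    then have "turn_sign (a, b, c) s a = 0" using abc by (auto simp: turn_sign_def)
    then show ?thesis
      using words_exponent_emit[OF w, of "{b, c}" s us a] by (simp add: tadpole_value_def)
  qed
  have "(\<Sum>e\<in>#E. tadpole_value (a, b, c) (emit n {b, c} w e)) = (\<Sum>e\<in>#E. tadpole_value (a, b, c) e)"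
    using 1 by (intro arg_cong[of _ _ sum_mset] image_mset_cong)
  then show ?thesis
    by (simp add: True weight_1 image_mset.compositionality comp_def 2)
next
  case False
  then have "size (add_mset (a, b, c) V) \<ge> 2" by (cases V) auto
  then show ?thesis by (simp only: weight_2)
qed

lemma weight_bead_move:
  assumes move: "bead_move n D D'" and D: "beaded_diagram n m D" "beaded_diagram n m D'"
  shows "weight D' = weight D"
  using move
proof cases
  case (isomorphism f)
  then show ?thesis using weight_rename[OF D(1)] by simp
next
  case (cyclic A a b c V E)
  have "{(b, c), (c, a), (a, b)} = {(a, b), (b, c), (c, a)}" by blast
  then have "turn_sign (b, c, a) = turn_sign (a, b, c)" unfolding turn_sign_def prod.case by simp
  then have "tadpole_value (b, c, a) e = tadpole_value (a, b, c) e" for e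
    by (simp add: tadpole_value_def)
  then show ?thesis unfolding cyclic by (simp add: weight_def)
next
  case (merge_arc A p w x q B V E)
  have "chord_value (A @ (p @ [Bead (w \<otimes>\<^bsub>free_group n\<^esub> x)] @ q) # B) e = chord_value (A @ (p @ [Bead w, Bead x] @ q) # B) e" for e
    by (rule chord_value_bead_change) (simp_all add: exponent_mult)
  then show ?thesis unfolding merge_arc by (intro weight_arcs_cong) simp
next
  case (merge_edge A V s us w x vs t E)
  have "words_exponent (us @ (w \<otimes>\<^bsub>free_group n\<^esub> x) # vs) = words_exponent (us @ w # x # vs)" by (simp add: exponent_mult)
  then show ?thesis unfolding merge_edge
    by (intro weight_replace_edge value_words_cong)
next
  case (unit_arc A p q B V E)
  have "chord_value (A @ (p @ [] @ q) # B) e = chord_value (A @ (p @ [Bead \<one>\<^bsub>free_group n\<^esub>] @ q) # B) e" for e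
    by (rule chord_value_bead_change) (simp_all add: free_group_simps(3))
  then show ?thesis unfolding unit_arc by (intro weight_arcs_cong) simp
next
  case (unit_edge A V s us vs t E)
  have "words_exponent (us @ vs) = words_exponent (us @ \<one>\<^bsub>free_group n\<^esub> # vs)" by (simp add: free_group_simps(3))
  then show ?thesis unfolding unit_edge
    by (intro weight_replace_edge value_words_cong)
next
  case (reverse A V s w t E)
  have "w \<in> carrier (free_group n)" using D(1) by (simp add: reverse beaded_diagram_def)
  then have "words_exponent [inv\<^bsub>free_group n\<^esub> w] = - words_exponent [w]" by (simp add: exponent_inv)
  then show ?thesis unfolding reverse
    by (intro weight_replace_edge chord_value_reverse tadpole_value_reverse)
next
  case (slide_univalent A p w v q B V E)
  then show ?thesis using weight_slide_univalent D(1) by metis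
next
  case (slide_trivalent A a b c V s us w E)
  then show ?thesis using weight_slide_trivalent D(1) by metis
qed

lemma weight_stu:
  assumes D: "beaded_diagram n m D" and stu: "stu D D1 D2"
  shows "weight D = weight D1 - weight D2"
proof -
  obtain A B p q V E h x a b where
    DD: "D = BDiag (A @ (p @ Leg h # q) # B) (add_mset (x, b, a) V) (add_mset (h, [], x) E)"
    "D1 = BDiag (A @ (p @ Leg a # Leg b # q) # B) V E" "D2 = BDiag (A @ (p @ Leg b # Leg a # q) # B) V E"
    using stu unfolding stu_def by blast
  show ?thesis
  proof (cases V rule: size_cases)
    case 1
    have b1: "beaded_diagram n m D1" using beaded_stu D unfolding DD by blast
    have "distinct (leg_seq (concat (A @ (p @ Leg a # Leg b # q) # B)))" using distinct_leg_seq[OF b1] by (simp add: DD)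
    then have fresh: "Leg a \<notin> set p" "Leg b \<notin> set p" "Leg a \<notin> set q" "Leg b \<notin> set q" "a \<noteq> b" by auto
    let ?r1 = "p @ Leg a # Leg b # q" and ?r2 = "p @ Leg b # Leg a # q"
    have xE: "x \<notin># ends E" "x \<noteq> a" "x \<noteq> b"
    proof -
      have cnt: "count (vertex_halves D) h \<le> 1" for h using D unfolding beaded_diagram_def by blast
      have "vertex_halves D = {#h, x#} + ends E" using D unfolding beaded_diagram_def by (simp add: DD edge_halves_BDiag)
      then have c: "count {#h, x#} x + count (ends E) x \<le> 1" using cnt[of x] by (simp only: count_union)
      moreover have "count {#h, x#} x \<ge> 1" by simp
      ultimately have "count (ends E) x = 0" by linarith
      then show "x \<notin># ends E" by (simp only: count_eq_zero_iff not_False_eq_True)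
      show "x \<noteq> a" "x \<noteq> b" using cnt[of x] by (auto simp: DD vertex_halves_BDiag split: if_splits)
    qed
    have key: "tadpole_value (x, b, a) e = chord_value (A @ ?r1 # B) e - chord_value (A @ ?r2 # B) e" if "e \<in># E" for e
    proof -
      obtain s ws t where e: "e = (s, ws, t)" by (cases e) auto
      have st: "s \<noteq> x" "t \<noteq> x" using in_ends[of s ws t E] that xE(1) by (auto simp: e)
      have pot: "potential ?r2 h = potential ?r1 h" for h
        using fresh by (auto simp: potential_def)
      have ord: "order_sign ?r1 s t - order_sign ?r2 s t = 2 * (of_bool ((t, s) = (b, a)) - of_bool ((s, t) = (b, a)))"
        using fresh by (auto simp: order_sign_def dest: subsetD[OF set_until])
      have ab: "potential ?r1 a = potential ?r1 b" using fresh by (simp add: potential_def)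
      have "chord_value [?r1] e - chord_value [?r2] e = (order_sign ?r1 s t - order_sign ?r2 s t) * (words_exponent ws + potential ?r1 s - potential ?r1 t)"
        by (simp add: e chord_value_def pot algebra_simps)
      also have "\<dots> = tadpole_value (x, b, a) e"
      proof -
        have mem: "((t, s) \<in> {(x, b), (b, a), (a, x)}) = ((t, s) = (b, a))" "((s, t) \<in> {(x, b), (b, a), (a, x)}) = ((s, t) = (b, a))"
          using st by blast+
        have turn: "turn_sign (x, b, a) s t = of_bool ((t, s) = (b, a)) - of_bool ((s, t) = (b, a))"
          unfolding turn_sign_def prod.case mem ..
        show ?thesis
        proof (cases "(t, s) = (b, a) \<or> (s, t) = (b, a)")
          case True
          then have "potential ?r1 s = potential ?r1 t" using ab by (elim disjE) simp_all
          then show ?thesis unfolding ord by (simp add: e tadpole_value_def turn)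
        next
          case False
          then have f: "((t, s) = (b, a)) = False" "((s, t) = (b, a)) = False" by blast+
          show ?thesis unfolding ord e tadpole_value_def prod.case turn f by simp
        qed
      qed
      finally show ?thesis unfolding chord_value_append by simp
    qed
    have "(\<Sum>e\<in>#E. tadpole_value (x, b, a) e) = (\<Sum>e\<in>#E. chord_value (A @ ?r1 # B) e - chord_value (A @ ?r2 # B) e)"
      using key by (intro arg_cong[of _ _ sum_mset] image_mset_cong)
    also have "\<dots> = (\<Sum>e\<in>#E. chord_value (A @ ?r1 # B) e) - (\<Sum>e\<in>#E. chord_value (A @ ?r2 # B) e)"
      by (induction E) auto
    finally have "(\<Sum>e\<in>#E. tadpole_value (x, b, a) e) = (\<Sum>e\<in>#E. chord_value (A @ ?r1 # B) e) - (\<Sum>e\<in>#E. chord_value (A @ ?r2 # B) e)" .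
    moreover have "tadpole_value (x, b, a) (h, [], x) = 0" by (simp add: tadpole_value_def)
    ultimately show ?thesis by (simp add: DD 1 weight_0 weight_1)
  next
    case (2 v)
    then show ?thesis by (simp add: DD weight_1 weight_2)
  next
    case 3
    then show ?thesis by (simp add: DD weight_2)
  qed
qed

lemma vector_space_field: "vector_space ((*) :: 'k::field \<Rightarrow> 'k \<Rightarrow> 'k)"
  by unfold_locales (auto simp: algebra_simps)

definition weight_functional :: "(bdiag \<Rightarrow>\<^sub>0 'k::field) \<Rightarrow> 'k" where
  "weight_functional = linear_ext (*) (\<lambda>D. of_int (weight D))"

lemma weight_functional_relations:
  assumes "u \<in> relations n m"
  shows "weight_functional u = (0 :: 'k::field)"
proof -
  interpret K: vector_space "(*) :: 'k \<Rightarrow> 'k \<Rightarrow> 'k" by (rule vector_space_field)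
  note le = linear_ext_diff[OF vector_space_field] linear_ext_dgm[OF vector_space_field]
  have "weight_functional u \<in> {0 :: 'k}"
    using assms unfolding relations_def weight_functional_def
  proof (rule linear_ext_span[OF vector_space_field])
    show "K.subspace {0 :: 'k}" by (rule K.subspace_single_0)
    fix u :: "bdiag \<Rightarrow>\<^sub>0 'k"
    assume "u \<in> {dgm D - dgm D' | D D'. beaded_diagram n m D \<and> (D, D') \<in> bead_equiv n m} \<union>
       {dgm D - (dgm D1 - dgm D2) | D D1 D2. beaded_diagram n m D \<and> stu D D1 D2}"
    then consider D D' where "u = dgm D - dgm D'" "beaded_diagram n m D" "(D, D') \<in> bead_equiv n m"
      | D D1 D2 where "u = dgm D - (dgm D1 - dgm D2)" "beaded_diagram n m D" "stu D D1 D2"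
      by blast
    then show "linear_ext (*) (\<lambda>D. of_int (weight D)) u \<in> {0 :: 'k}"
    proof cases
      case 1
      have "weight D = weight D'"
        using 1(3,2) by (induction rule: bead_equiv_induct) (auto dest: weight_bead_move)
      then show ?thesis by (simp add: 1(1) le)
    next
      case 2
      then show ?thesis using weight_stu[OF 2(2,3)] by (simp add: le)
    qed
  qed
  then show ?thesis by simp
qed

lemma weight_functional_mod_eq:
  "mod_eq n m u v \<Longrightarrow> weight_functional u = (weight_functional v :: 'k::field)"
  using weight_functional_relations[of "u - v" n m]
  by (simp add: mod_eq_def weight_functional_def linear_ext_diff[OF vector_space_field])


text \<open>
  One chord with a bead joins two arcs; further chords, added for the degree only, lie on the second arc.
\<close>

definition witness :: "nat \<Rightarrow> bdiag" where
  "witness d = BDiag [[Leg 0], map Leg [1..<2 * d]] {#}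
    (add_mset (0, [gen 0], 1) (mset (map (\<lambda>i. (2 * i, [], 2 * i + 1)) [1..<d])))"

lemma ends_pairs: "ends (mset (map (\<lambda>i. (2 * i, [], 2 * i + 1)) [0..<d])) = mset [0..<2 * d]"
  by (induction d) (auto simp: add_mset_commute)

lemma witness_trivial:
  assumes "d > 0" "n > 0"
  shows "witness d \<in> trivial_diagrams d n 2"
proof -
  let ?E = "mset (map (\<lambda>i. (2 * i, [], 2 * i + 1)) [1..<d]) :: (nat \<times> word list \<times> nat) multiset"
  have E0: "mset (map (\<lambda>i. (2 * i, [], 2 * i + 1)) [0..<d]) = add_mset (0, [], 1) ?E"
    using assms(1) by (simp add: upt_conv_Cons)
  have G: "concat [[0], [1..<2 * d]] = [0..<2 * d]"
    using assms(1) by (simp add: upt_conv_Cons)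
  have "beaded_diagram n 2 (chords [[0], [1..<2 * d]] (add_mset (0, [], 1) ?E))"
  proof (rule beaded_chords)
    show "mset (concat [[0], [1..<2 * d]]) = ends (add_mset (0, [], 1) ?E)"
      unfolding G E0[symmetric] ends_pairs ..
  qed (unfold G, auto)
  then have b: "beaded_diagram n 2 (witness d)"
    using beaded_diagram_replace_edge[of n 2 _ _ 0 "[]" 1 ?E "[gen 0]"] gen_in_carrier[of 0 n] assms(2)
    by (simp add: chords_def witness_def)
  have "legs_mset (witness d) = mset [0..<2 * d]"
    unfolding witness_def legs_mset_BDiag G[symmetric] by simp
  then have "degree (witness d) = d"
    by (simp add: degree_def) (simp add: witness_def)
  moreover have "bead_product n (map Leg xs) = \<one>\<^bsub>free_group n\<^esub>" for xs
    by (induction xs) auto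
  from this[of "[0]"] this[of "[1..<2 * d]"] have "homotopically_trivial n (witness d)"
    by (simp add: homotopically_trivial_iff witness_def)
  ultimately show ?thesis using b by (simp add: trivial_diagrams_def)
qed

lemma potential_map_Leg [simp]: "potential (map Leg xs) h = 0"
proof -
  have "bead_seq (until h (map Leg xs)) = []" by (induction xs) auto
  then show ?thesis by (simp add: potential_def)
qed

lemma weight_unbeaded_arcs:
  "weight (BDiag (map (map Leg) G) {#} (add_mset (s, ws, t) (mset (map (\<lambda>i. (2 * i, [], 2 * i + 1)) xs))))
    = (\<Sum>p\<leftarrow>G. order_sign (map Leg p) s t) * words_exponent ws"
proof -
  have v: "chord_value (map (map Leg) G) (s, ws, t) = (\<Sum>p\<leftarrow>G. order_sign (map Leg p) s t) * words_exponent ws" for s ws t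
    by (induction G) (auto simp: chord_value_def algebra_simps)
  have "(\<Sum>e\<in>#mset (map (\<lambda>i. (2 * i, [], 2 * i + 1)) xs). chord_value (map (map Leg) G) e) = 0"
    by (induction xs) (auto simp: v)
  then show ?thesis by (simp add: weight_0 v)
qed

text \<open>
  Conjugation by the generator of the first arc adds to the witness the diagrams whose
  beaded chord starts at the beginning of the second arc and, with a minus sign, at its end; these have the weights
  \<open>1\<close> and \<open>- 1\<close>.  All terms whose beaded chord joins the two arcs have weight \<open>0\<close>.
\<close>

lemma conj_witness:
  assumes d: "d > 0" and n: "n > 0"
  shows "weight_functional (lact n (copies_of (conj_words 2 (gen 0))) (witness d)) = (2 :: 'k::field)"
proof -
  let ?D = "witness d" and ?R = "{1..<2 * d}"
  let ?E = "add_mset (0, [gen 0], 1) (mset (map (\<lambda>i. (2 * i, [], 2 * i + 1)) [1..<d])) :: (nat \<times> word list \<times> nat) multiset"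
  define L :: "((nat \<times> nat) \<times> letter) list list" where "L = [[((0, 0), 0, True), ((0, 1), 0, True), ((0, 2), 0, False)],
    [((1, 0), 0, True), ((1, 1), 1, True), ((1, 2), 0, False)]]"
  have L: "copies_of (conj_words 2 (gen 0)) = L"
    by (simp add: copies_of_def conj_words_def L_def upt_rec inv_letter_def)
  have cL: "copying 2 L" by (auto simp: copying_def L_def)
  have D: "beaded_diagram n 2 ?D" using witness_trivial[OF d n] by (simp add: trivial_diagrams_def)
  have legs: "legs ?D = insert 0 ?R"
    using d by (auto simp: witness_def legs_mset_BDiag)
  have p0: "places L ?D 0 = {(0, 0), (0, 1), (0, 2), (1, 0), (1, 2)}"
    using places_eq[OF D, of 0 0 L] by (auto simp: witness_def L_def)
  have pR: "places L ?D h = {(1, 1)}" if "h \<in> ?R" for h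
    using places_eq[OF D, of 1 h L] that by (auto simp: witness_def L_def)
  define \<chi>1 :: "nat \<Rightarrow> nat \<times> nat" where "\<chi>1 = restrict (\<lambda>_. (1, 1)) ?R"
  have PR: "Pi\<^sub>E ?R (places L ?D) = {\<chi>1}"
  proof -
    have "Pi\<^sub>E ?R (places L ?D) = Pi\<^sub>E ?R (\<lambda>h. {\<chi>1 h})"
      using pR by (intro PiE_cong) (simp add: \<chi>1_def)
    also have "\<dots> = {\<chi>1}" by (rule PiE_singleton) (unfold \<chi>1_def, rule restrict_extensional)
    finally show ?thesis .
  qed
  have sg: "lsign L (0, 0) = (1 :: 'k)" "lsign L (0, 1) = (1 :: 'k)" "lsign L (0, 2) = (- 1 :: 'k)"
    "lsign L (1, 0) = (1 :: 'k)" "lsign L (1, 1) = (1 :: 'k)" "lsign L (1, 2) = (- 1 :: 'k)"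
    by (auto simp: lsign_def L_def)
  have one: "(\<Prod>h\<in>insert 0 ?R. lsign L ((\<chi>1(0 := y)) h)) = (lsign L y :: 'k)" for y
  proof -
    have "(\<Prod>h\<in>?R. lsign L ((\<chi>1(0 := y)) h)) = (1 :: 'k)"
      by (rule prod.neutral) (auto simp: \<chi>1_def sg[simplified])
    then show ?thesis by simp
  qed
  define w where "w y = (of_int (weight (lattach n L (\<chi>1(0 := y)) ?D)) :: 'k)" for y
  have "lact n L ?D = (\<Sum>y\<in>places L ?D 0. scale (lsign L y) (dgm (lattach n L (\<chi>1(0 := y)) ?D)) :: bdiag \<Rightarrow>\<^sub>0 'k)"
  proof -
    have "0 \<notin> ?R" by simp
    then show ?thesis
      unfolding lact_def lattachments_def legs sum_PiE_insert[OF \<open>0 \<notin> ?R\<close>] PR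
      by (intro sum.cong refl) (simp only: sum.insert finite.emptyI empty_iff not_False_eq_True sum.empty add_0_right one)
  qed
  then have "weight_functional (lact n L ?D) = (\<Sum>y\<in>places L ?D 0. lsign L y * w y)"
    unfolding weight_functional_def w_def by (simp add: linear_ext_sum[OF vector_space_field] linear_ext_scale[OF vector_space_field] linear_ext_dgm[OF vector_space_field])
  then have sum: "weight_functional (lact n L ?D) = w (0, 0) + w (0, 1) - w (0, 2) + w (1, 0) - w (1, 2)"
    unfolding p0 by (simp add: sg[simplified])
  have att: "weight (lattach n L (\<chi>1(0 := y)) ?D) = (\<Sum>p\<leftarrow>G. order_sign (map Leg p) 0 1)"
    if "G = [(if fst y = 0 then [0] else []),
        (if y = (1, 0) then [0] else []) @ [1..<2 * d] @ (if y = (1, 2) then [0] else [])]"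
      "y \<in> {(0, 0), (0, 1), (0, 2), (1, 0), (1, 2)}" for y G
  proof -
    have f: "filter (\<lambda>h. (\<chi>1(0 := y)) h = z) [1..<2 * d] = (if z = (1, 1) then [1..<2 * d] else [])" for z
      by (auto simp: \<chi>1_def filter_empty_conv filter_id_conv)
    have k: "keep (\<chi>1(0 := y)) z (map Leg [1..<2 * d]) = (if z = (1, 1) then map Leg [1..<2 * d] else [])" for z
      unfolding keep_map_Leg f by simp
    have "arcs (lattach n L (\<chi>1(0 := y)) ?D) = map (map Leg) G"
      using that(2) unfolding that(1) by (auto simp: lattach_def L_def witness_def lcopy_def k[simplified] orient_def)
    then have eq: "lattach n L (\<chi>1(0 := y)) ?D = BDiag (map (map Leg) G) {#} ?E"
      by (simp add: lattach_def witness_def)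
    show ?thesis unfolding eq weight_unbeaded_arcs by simp
  qed
  have un: "until 1 (map Leg [1..<2 * d]) = []" "Leg 1 \<in> set (map Leg [1..<2 * d])" "Leg 0 \<notin> set (map Leg [1..<2 * d])"
    using d by (auto simp: upt_conv_Cons)
  have 0: "order_sign (map Leg xs) 0 1 = 0" if "0 \<notin> set xs \<or> 1 \<notin> set xs" for xs
    using that by (auto simp: order_sign_def)
  have first: "order_sign (map Leg (0 # [1..<2 * d])) 0 1 = 1"
    using un by (simp add: order_sign_def)
  have last: "order_sign (map Leg ([1..<2 * d] @ [0])) 0 1 = - 1"
    using un by (simp add: order_sign_def)
  have "w (0, 0) = 0" "w (0, 1) = 0" "w (0, 2) = 0"
    using att[OF refl, of "(0, 0)"] att[OF refl, of "(0, 1)"] att[OF refl, of "(0, 2)"] 0[of "[0]"] 0[of "[1..<2 * d]"]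
    by (simp_all add: w_def)
  moreover have "w (1, 0) = 1"
    using att[OF refl, of "(1, 0)"] first 0[of "[]"] by (simp add: w_def)
  moreover have "w (1, 2) = - 1"
    using att[OF refl, of "(1, 2)"] last 0[of "[]"] by (simp add: w_def)
  ultimately show ?thesis
    unfolding L sum by simp
qed

lemma not_outer_functor:
  assumes d: "d > 0" and n: "n > 0"
  shows "\<not> outer_functor (A_deg_trivial d n :: nat \<Rightarrow> ('k::field_char_0, (bdiag \<Rightarrow>\<^sub>0 'k) set) module) (A_mor n)"
proof
  assume "outer_functor (A_deg_trivial d n :: nat \<Rightarrow> ('k, (bdiag \<Rightarrow>\<^sub>0 'k) set) module) (A_mor n)"
  then interpret outer_functor "A_deg_trivial d n :: nat \<Rightarrow> ('k, (bdiag \<Rightarrow>\<^sub>0 'k) set) module" "A_mor n" .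
  let ?D = "witness d" and ?W = "conj_words 2 (gen 0)"
  have D: "?D \<in> trivial_diagrams d n 2" by (rule witness_trivial[OF d n])
  then have bD: "beaded_diagram n 2 ?D" by (simp add: trivial_diagrams_def)
  have a: "gen 0 \<in> carrier (free_group 2)" by (rule gen_in_carrier) simp
  have "rel_coset n 2 (dgm ?D :: bdiag \<Rightarrow>\<^sub>0 'k) \<in> carrier (A_deg_trivial d n 2)"
    unfolding A_deg_trivial_eq A_span_simps using D by (intro imageI diagrams.span_base)
  from inner_trivial[OF a this]
  have "mod_eq n 2 (lact n (copies_of (map reduce ?W)) ?D) (dgm ?D :: bdiag \<Rightarrow>\<^sub>0 'k)"
    unfolding A_mor_rel_coset[OF conj_hom[OF a]] rel_coset_eq act_dgm act_diagram_eq_lact gen_images_conj[OF a] .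
  moreover have "length ?W = 2" by (simp add: conj_words_def)
  then have "mod_eq n 2 (lact n (copies_of ?W) ?D) (lact n (copies_of (map reduce ?W)) ?D :: bdiag \<Rightarrow>\<^sub>0 'k)"
    using lact_reduce[OF bD conj_words_letters[OF a]] by simp
  ultimately have "mod_eq n 2 (lact n (copies_of ?W) ?D) (dgm ?D :: bdiag \<Rightarrow>\<^sub>0 'k)"
    using mod_eq_trans by blast
  then have "weight_functional (lact n (copies_of ?W) ?D) = (weight_functional (dgm ?D) :: 'k)"
    by (rule weight_functional_mod_eq)
  moreover have "weight_functional (dgm ?D) = (0 :: 'k)"
  proof -
    have D': "?D = BDiag (map (map Leg) [[0], [1..<2 * d]]) {#} (add_mset (0, [gen 0], 1) (mset (map (\<lambda>i. (2 * i, [], 2 * i + 1)) [1..<d])))"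
      by (simp add: witness_def)
    have "weight ?D = 0"
      unfolding D' weight_unbeaded_arcs by (auto simp: order_sign_def)
    then show ?thesis by (simp add: weight_functional_def linear_ext_dgm[OF vector_space_field])
  qed
  ultimately show False
    using conj_witness[OF d n, where 'k = 'k] by simp
qed

theorem theorem3:
  fixes d n :: nat
  shows "gr_op_functor (A_deg_trivial d n :: nat \<Rightarrow> ('k::field_char_0, (bdiag \<Rightarrow>\<^sub>0 'k) set) module) (A_mor n) \<and>
    (outer_functor (A_deg_trivial d n :: nat \<Rightarrow> ('k, (bdiag \<Rightarrow>\<^sub>0 'k) set) module) (A_mor n) \<longleftrightarrow> n = 0 \<or> d = 0)"
proof
  show "gr_op_functor (A_deg_trivial d n :: nat \<Rightarrow> ('k, (bdiag \<Rightarrow>\<^sub>0 'k) set) module) (A_mor n)"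
    by (rule gr_op_functor_A_deg_trivial)
  show "outer_functor (A_deg_trivial d n :: nat \<Rightarrow> ('k, (bdiag \<Rightarrow>\<^sub>0 'k) set) module) (A_mor n) \<longleftrightarrow> n = 0 \<or> d = 0"
    using not_outer_functor[of d n] outer_functor_no_beads outer_functor_degree_0 by auto
qed

end
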